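(* Let $n\geq 3$ be an integer and let $\mathcal{A}$ be a simple affine arrangement of $n$ pseudo-lines. Then $$a_3(\mathcal{A})\leq \begin{cases} n(n-5/2)/3 & \text{if } n\equiv 0,4 \pmod 6,\\ (n(n-2)-2)/3 & \text{if } n\equiv 1 \pmod 6,\\ (n(n-5/2)-2)/3 & \text{if } n\equiv 2 \pmod 6,\\ n(n-2)/3 & \text{if } n\equiv 3,5 \pmod 6. \end{cases}$$ Furthermore, for every integer $0\leq k\leq 5$ there exist infinitely many integers $n\equiv k\pmod 6$ for which some simple affine arrangement $\mathcal{A}$ of $n$ pseudo-lines attains this bound, i.e. $a_3(\mathcal{A})$ equals the right-hand side above.
   Context: A pseudo-line in the affine plane $\mathbb{R}^2$ is a curve $L$ for which there is a homeomorphism of the plane sending $L$ onto a straight line. A simple affine arrangement of $n$ pseudo-lines is a set $\mathcal{A}=\{A_1,\dots,A_n\}$ of $n$ pseudo-lines in $\mathbb{R}^2$ such that any two of them intersect transversally in exactly one point, and this point lies on no other curve of $\mathcal{A}$. The intersection points cut each pseudo-line into $n-2$ bounded segments and $2$ unbounded segments; the connected components of the complement of the union of the pseudo-lines are the polygons of $\mathcal{A}$. $a_3(\mathcal{A})$ denotes the number of bounded triangles of $\mathcal{A}$, i.e. polygons bounded by exactly three bounded segments. *)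

theory Defs
  imports "HOL-Analysis.Analysis"
begin

type_synonym plane = "real ^ 2"

definition pseudo_line :: "plane set \<Rightarrow> bool" where
  "pseudo_line L \<longleftrightarrow>
     (\<exists>(h :: plane \<Rightarrow> plane) h' S. homeomorphism UNIV UNIV h h' \<and> affine S \<and> aff_dim S = 1 \<and> h ` L = S)"

text \<open>Pseudo-lines are only topological curves, so transversality is the topological notion:
  near the point, some local chart carries the two curves to the two coordinate axes.
  A point common to both curves is then sent to the origin.\<close>

definition transversal_at :: "plane set \<Rightarrow> plane set \<Rightarrow> plane \<Rightarrow> bool" where
  "transversal_at L M p \<longleftrightarrow>
     p \<in> L \<inter> M \<and>
     (\<exists>U V (f :: plane \<Rightarrow> plane) g. open U \<and> p \<in> U \<and> open V \<and> homeomorphism U V f g \<and>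
        f ` (L \<inter> U) = {x \<in> V. x $ 2 = 0} \<and>
        f ` (M \<inter> U) = {x \<in> V. x $ 1 = 0})"

definition simple_affine_arrangement :: "nat \<Rightarrow> plane set set \<Rightarrow> bool" where
  "simple_affine_arrangement n \<A> \<longleftrightarrow>
     finite \<A> \<and> card \<A> = n \<and>
     (\<forall>L\<in>\<A>. pseudo_line L) \<and>
     (\<forall>L\<in>\<A>. \<forall>M\<in>\<A>. L \<noteq> M \<longrightarrow>
        (\<exists>p. L \<inter> M = {p} \<and> transversal_at L M p \<and> (\<forall>N\<in>\<A> - {L, M}. p \<notin> N)))"

text \<open>Segments are taken without their end points.\<close>

definition arr_segments :: "plane set set \<Rightarrow> plane set set" where
  "arr_segments \<A> = (\<Union>L\<in>\<A>. components (L - \<Union>(\<A> - {L})))"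

definition arr_polygons :: "plane set set \<Rightarrow> plane set set" where
  "arr_polygons \<A> = components (- \<Union>\<A>)"

definition bounding_segments :: "plane set set \<Rightarrow> plane set \<Rightarrow> plane set set" where
  "bounding_segments \<A> P = {s \<in> arr_segments \<A>. s \<subseteq> frontier P}"

definition bounded_triangles :: "plane set set \<Rightarrow> plane set set" where
  "bounded_triangles \<A> =
     {P \<in> arr_polygons \<A>. card (bounding_segments \<A> P) = 3 \<and>
                          (\<forall>s\<in>bounding_segments \<A> P. bounded s)}"

definition a3 :: "plane set set \<Rightarrow> nat" where
  "a3 \<A> = card (bounded_triangles \<A>)"

definition a3_bound :: "nat \<Rightarrow> real" where
  "a3_bound n =
     (if n mod 6 \<in> {0, 4} then real n * (real n - 5 / 2) / 3
      else if n mod 6 = 1 then (real n * (real n - 2) - 2) / 3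
      else if n mod 6 = 2 then (real n * (real n - 5 / 2) - 2) / 3
      else real n * (real n - 2) / 3)"

end

theory Submission
  imports Defs
begin

text \<open>Upper bound. Straightening each pseudo-line by a homeomorphism of the plane gives an order of the crossings
  on it and two sides. A bounded triangle is determined by a triple of lines whose crossings are pairwise consecutive,
  and it uses three of the \<open>n (n - 2)\<close> bounded segments, each segment being used at most once; this settles odd \<open>n\<close>.
  For even \<open>n\<close>, let \<open>e\<close> be the number of line ends whose last crossing lies on a given line \<open>L\<close>; these numbers add
  up to \<open>2 n\<close>. All those lines come from the same side of \<open>L\<close>, at most one of the two segments of \<open>L\<close> at such a crossing
  is used, and consecutive used segments have their triangles on opposite sides of \<open>L\<close>. As \<open>L\<close> has an even number
  of bounded segments, at least \<open>(e - 1) / 2\<close> of them are unused, so \<open>n / 2\<close> segments are unused altogether.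

  Attaining it. An arrangement is drawn as a sorting network, and for odd \<open>n\<close> one wants all bounded faces of even
  height to be triangles, i.e. the letters \<open>k\<close> and \<open>k \<plusminus> 1\<close> of the network to alternate for every even \<open>k\<close>. Such a
  network of \<open>n\<close> wires, placed at the centre of the arrangement of the sides and the symmetry axes of a regular
  \<open>n\<close>-gon whose triple points are resolved into triangles, gives one of \<open>2 n - 1\<close> wires. Starting with 3 and 7 lines
  this reaches the odd residues; one more line close to infinity reaches the even ones.\<close>

section \<open>Orders and sides of lines\<close>

text \<open>The curves are only topological, and the one thing transversality yields for the count
  is that a curve really changes sides where it crosses another. This and the order of the crossings
  are all that the count needs; they are the data \<open>par\<close> and \<open>side\<close>. The
  definition of a bounded triangle says nothing about vertices: that its three lines cross
  consecutively has to be recovered from charts at the crossings. For attainment a lower bound on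
  the number of triangles suffices, since the upper bound closes the gap; hence only triangles at
  even heights are ever produced. In the doubling step one side of the regular polygon plays the
  line at infinity, whence 2 n - 1 wires and not 2 n. Modulo 6 the map n -> 2 n - 1 exchanges 3 and
  5 and fixes 1, which is why two starting networks are required.\<close>

lemma extreme_count_bound:
  fixes used sd E :: "nat \<Rightarrow> bool" and e :: bool
  assumes alt: "\<And>i. Suc i < K \<Longrightarrow> used i \<Longrightarrow> used (Suc i) \<Longrightarrow> sd i \<noteq> sd (Suc i) \<and> \<not> E (Suc i)"
    and side: "\<And>i. i < K \<Longrightarrow> used i \<Longrightarrow> E i \<or> E (Suc i) \<Longrightarrow> sd i = e"
    and "even K"
  shows "card {i. i \<le> K \<and> E i} \<le> 2 * card {i. i < K \<and> \<not> used i} + 1"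
proof -
  define u where "u k = (\<Sum>i<k. of_bool (\<not> used i) :: nat)" for k
  define c where "c k = (\<Sum>i\<le>k. of_bool (E i) :: nat)" for k
  have inv: "k \<le> K \<Longrightarrow>
     (even k \<longrightarrow> c k \<le> 2 * u k + (if k > 0 \<and> used (k-1) \<and> sd (k-1) \<noteq> e then 1 else of_bool (E k))) \<and>
     (odd k \<longrightarrow> (\<not> used (k-1) \<longrightarrow> c k + 1 \<le> 2 * u k + of_bool (E k)) \<and>
                (used (k-1) \<longrightarrow> sd (k-1) \<noteq> e \<longrightarrow> c k \<le> 2 * u k) \<and>
                (used (k-1) \<longrightarrow> sd (k-1) = e \<longrightarrow> c k \<le> 2 * u k + 1 + of_bool (E k)))" for k
  proof (induction k)
    case 0
    then show ?case by (simp add: c_def u_def)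
  next
    case (Suc k)
    have IH: "(even k \<longrightarrow> c k \<le> 2 * u k + (if k > 0 \<and> used (k-1) \<and> sd (k-1) \<noteq> e then 1 else of_bool (E k))) \<and>
     (odd k \<longrightarrow> (\<not> used (k-1) \<longrightarrow> c k + 1 \<le> 2 * u k + of_bool (E k)) \<and>
                (used (k-1) \<longrightarrow> sd (k-1) \<noteq> e \<longrightarrow> c k \<le> 2 * u k) \<and>
                (used (k-1) \<longrightarrow> sd (k-1) = e \<longrightarrow> c k \<le> 2 * u k + 1 + of_bool (E k)))"
      using Suc by simp
    have c: "c (Suc k) = c k + of_bool (E (Suc k))" by (simp add: c_def)
    have u: "u (Suc k) = u k + of_bool (\<not> used k)" by (simp add: u_def)
    have s: "used k \<Longrightarrow> E k \<or> E (Suc k) \<Longrightarrow> sd k = e" using side[of k] Suc.prems by auto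
    have a: "k > 0 \<Longrightarrow> used (k-1) \<Longrightarrow> used k \<Longrightarrow> sd (k-1) \<noteq> sd k \<and> \<not> E k"
      using alt[of "k-1"] Suc.prems by auto
    have o: "odd k \<Longrightarrow> k > 0" by (simp add: odd_pos)
    show ?case using IH c u s a o
      by (cases "even k"; cases "used k"; cases "E k"; cases "E (Suc k)") (auto split: if_splits)
  qed
  have "card {i. i \<le> K \<and> E i} = c K"
    by (simp add: c_def of_bool_def sum.If_cases Int_def)
  moreover have "card {i. i < K \<and> \<not> used i} = u K"
    by (simp add: u_def of_bool_def sum.If_cases Int_def)
  moreover have "c K \<le> 2 * u K + 1" using inv[of K] \<open>even K\<close> by (cases "E K") (auto split: if_splits)
  ultimately show ?thesis by simp
qed

text \<open>\<open>par L M\<close> is the position on \<open>L\<close> of its crossing with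
  \<open>M\<close>, and \<open>side L M K\<close> the side of \<open>L\<close> on which
  \<open>M\<close> and \<open>K\<close> cross. The assumption \<open>side_switch\<close> encodes
  that \<open>M\<close> changes sides of \<open>L\<close> at their crossing and nowhere
  else.\<close>

locale line_orders =
  fixes A :: "'a set" and par :: "'a \<Rightarrow> 'a \<Rightarrow> real" and side :: "'a \<Rightarrow> 'a \<Rightarrow> 'a \<Rightarrow> bool"
  assumes finite_lines: "finite A"
    and inj_par: "L \<in> A \<Longrightarrow> inj_on (par L) (A - {L})"
    and side_sym: "side L M K = side L K M"
    and side_switch: "\<lbrakk>L \<in> A; M \<in> A; K \<in> A; J \<in> A; distinct [L, M, K, J]\<rbrakk> \<Longrightarrow>
       side L M K = side L M J \<longleftrightarrow> (par M K < par M L \<longleftrightarrow> par M J < par M L)"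
begin

definition adjacent_on :: "'a \<Rightarrow> 'a \<Rightarrow> 'a \<Rightarrow> bool" where
  "adjacent_on L M K \<longleftrightarrow> (\<forall>J\<in>A - {L, M, K}.
      \<not> (par L M < par L J \<and> par L J < par L K) \<and> \<not> (par L K < par L J \<and> par L J < par L M))"

definition triples :: "'a set set" where
  "triples = {T. \<exists>L M K. T = {L, M, K} \<and> L \<in> A \<and> M \<in> A \<and> K \<in> A \<and> distinct [L, M, K] \<and>
      adjacent_on L M K \<and> adjacent_on M L K \<and> adjacent_on K L M}"

text \<open>These are the line ends that are counted for even \<open>n\<close>: in one direction
  \<open>F\<close> has no crossing beyond \<open>L\<close>.\<close>

definition extreme_on :: "'a \<Rightarrow> 'a \<Rightarrow> bool" where
  "extreme_on F L \<longleftrightarrow> (\<forall>K\<in>A - {F, L}. par F L < par F K) \<or> (\<forall>K\<in>A - {F, L}. par F K < par F L)"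

definition is_enum :: "'a \<Rightarrow> (nat \<Rightarrow> 'a) \<Rightarrow> bool" where
  "is_enum L e \<longleftrightarrow> bij_betw e {..<card A - 1} (A - {L}) \<and>
     (\<forall>i j. i < j \<longrightarrow> j < card A - 1 \<longrightarrow> par L (e i) < par L (e j))"

definition enum :: "'a \<Rightarrow> nat \<Rightarrow> 'a" where "enum L = (SOME e. is_enum L e)"

definition used :: "'a \<Rightarrow> nat \<Rightarrow> bool" where
  "used L i \<longleftrightarrow> {L, enum L i, enum L (Suc i)} \<in> triples"

lemma adjacent_on_sym: "adjacent_on L M K = adjacent_on L K M"
  by (auto simp: adjacent_on_def)

lemma enum: "L \<in> A \<Longrightarrow> is_enum L (enum L)"
proof -
  assume L: "L \<in> A"
  have fin: "finite (par L ` (A - {L}))" using finite_lines by simp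
  have cd: "card (par L ` (A - {L})) = card A - 1"
    using L finite_lines inj_par by (simp add: card_image)
  define xs where "xs = sorted_list_of_set (par L ` (A - {L}))"
  define h where "h i = xs ! i" for i
  have xs: "sorted_wrt (<) xs" "set xs = par L ` (A - {L})" "length xs = card A - 1" "distinct xs"
    using fin cd unfolding xs_def by auto
  have h: "bij_betw h {..<card A - 1} (par L ` (A - {L}))" "strict_mono_on {..<card A - 1} h"
    using bij_betw_nth[OF xs(4), of "{..<card A - 1}" "par L ` (A - {L})"] xs sorted_wrt_nth_less[OF xs(1)]
    unfolding h_def strict_mono_on_def by auto
  define e where "e = (\<lambda>i. inv_into (A - {L}) (par L) (h i))"
  have b: "bij_betw (inv_into (A - {L}) (par L)) (par L ` (A - {L})) (A - {L})"
    using inj_par[OF L] by (simp add: bij_betw_inv_into inj_on_imp_bij_betw)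
  have "bij_betw e {..<card A - 1} (A - {L})"
    unfolding e_def using bij_betw_trans[OF h(1) b] by (simp add: comp_def)
  moreover have "par L (e i) = h i" if "i < card A - 1" for i
    unfolding e_def using h(1) that by (metis bij_betwE f_inv_into_f lessThan_iff)
  ultimately have "is_enum L e" using h(2) unfolding is_enum_def
    by (auto simp: strict_mono_on_def)
  then show ?thesis unfolding enum_def by (rule someI[where P = "is_enum L"])
qed

lemma enum_bij: "L \<in> A \<Longrightarrow> bij_betw (enum L) {..<card A - 1} (A - {L})"
  and enum_less: "L \<in> A \<Longrightarrow> i < j \<Longrightarrow> j < card A - 1 \<Longrightarrow> par L (enum L i) < par L (enum L j)"
  using enum[of L] unfolding is_enum_def by auto

lemma enum_in: "L \<in> A \<Longrightarrow> i < card A - 1 \<Longrightarrow> enum L i \<in> A \<and> enum L i \<noteq> L"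
  using enum_bij[of L] by (auto dest: bij_betwE)

lemma enum_neq: "L \<in> A \<Longrightarrow> i < card A - 1 \<Longrightarrow> j < card A - 1 \<Longrightarrow> i \<noteq> j \<Longrightarrow> enum L i \<noteq> enum L j"
  using enum_bij[of L] unfolding bij_betw_def inj_on_def by auto

lemma triplesD:
  assumes "T \<in> triples" "T = {L, M, K}" "distinct [L, M, K]"
  shows "L \<in> A \<and> M \<in> A \<and> K \<in> A \<and> adjacent_on L M K \<and> adjacent_on M L K \<and> adjacent_on K L M"
proof -
  obtain L' M' K' where *: "T = {L', M', K'}" "L' \<in> A" "M' \<in> A" "K' \<in> A" "distinct [L', M', K']"
    "adjacent_on L' M' K'" "adjacent_on M' L' K'" "adjacent_on K' L' M'"
    using assms(1) unfolding triples_def by blast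
  have "L \<in> {L', M', K'}" "M \<in> {L', M', K'}" "K \<in> {L', M', K'}"
    using *(1) assms(2) by blast+
  then show ?thesis using * assms(3) adjacent_on_sym by (elim insertE emptyE) auto
qed

lemma finite_triples: "finite triples"
proof -
  have "triples \<subseteq> Pow A" unfolding triples_def by auto
  then show ?thesis using finite_lines by (meson finite_Pow_iff finite_subset)
qed

lemma triples_card: "T \<in> triples \<Longrightarrow> card T = 3"
  unfolding triples_def by auto

lemma triples_used:
  assumes T: "T \<in> triples" and LT: "L \<in> T"
  shows "\<exists>i < card A - 2. T = {L, enum L i, enum L (Suc i)}"
proof -
  obtain M K where T2: "T = {L, M, K}" "distinct [L, M, K]"
  proof -
    obtain a b c where abc: "T = {a, b, c}" "distinct [a, b, c]" using T unfolding triples_def by blast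
    then consider "L = a" | "L = b" | "L = c" using LT by blast
    then show thesis
      by cases (use abc that[of b c] that[of a c] that[of a b] in auto)
  qed
  have in_A: "L \<in> A" "M \<in> A" "K \<in> A" and adj: "adjacent_on L M K"
    using triplesD[OF T T2] by auto
  have "M \<in> enum L ` {..<card A - 1}" "K \<in> enum L ` {..<card A - 1}"
    using enum_bij[OF in_A(1)] in_A T2 unfolding bij_betw_def by auto
  then obtain i j where ij: "i < card A - 1" "j < card A - 1" "enum L i = M" "enum L j = K" by auto
  have key: "j' = Suc i'" if "i' < j'" "j' < card A - 1" "{enum L i', enum L j'} = {M, K}" for i' j'
  proof (rule ccontr)
    assume "j' \<noteq> Suc i'"
    then have l: "Suc i' < j'" using that by simp
    define J where "J = enum L (Suc i')"
    have "J \<in> A - {L, M, K}"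
      using enum_in[OF in_A(1), of "Suc i'"] enum_neq[OF in_A(1), of "Suc i'" i'] enum_neq[OF in_A(1), of "Suc i'" j'] l that
      unfolding J_def by (auto simp: doubleton_eq_iff)
    moreover have "par L (enum L i') < par L J" "par L J < par L (enum L j')"
      using enum_less[OF in_A(1)] l that unfolding J_def by auto
    ultimately show False using adj that(3) unfolding adjacent_on_def by (auto simp: doubleton_eq_iff)
  qed
  have "i \<noteq> j" using ij T2 by auto
  then consider "i < j" | "j < i" by linarith
  then show ?thesis
  proof cases
    case 1
    then have "j = Suc i" using key[of i j] ij by auto
    then show ?thesis using ij T2 by (intro exI[of _ i]) auto
  next
    case 2
    then have "i = Suc j" using key[of j i] ij by auto
    then show ?thesis using ij T2 by (intro exI[of _ j]) auto
  qed
qed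

section \<open>Counting used segments\<close>

text \<open>Incidences of lines with triples are counted. Each comes from a used segment, and a
  segment determines its triple, namely its own line and the lines through its two ends; so no
  segment serves two triangles.\<close>

lemma triples_le_used: "3 * card triples \<le> (\<Sum>L\<in>A. card {i. i < card A - 2 \<and> used L i})"
proof -
  let ?S = "SIGMA L:A. {i. i < card A - 2 \<and> used L i}"
  let ?f = "\<lambda>(L, i). ({L, enum L i, enum L (Suc i)}, L)"
  have "(SIGMA T:triples. T) \<subseteq> ?f ` ?S"
  proof
    fix x assume "x \<in> (SIGMA T:triples. T)"
    then obtain T L where x: "x = (T, L)" "T \<in> triples" "L \<in> T" by auto
    then obtain i where i: "i < card A - 2" "T = {L, enum L i, enum L (Suc i)}" using triples_used by blast
    have "L \<in> A" using x unfolding triples_def by auto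
    then have "(L, i) \<in> ?S" using i x unfolding used_def by auto
    then show "x \<in> ?f ` ?S" using x i by (intro image_eqI[of _ _ "(L, i)"]) auto
  qed
  moreover have "finite ?S" using finite_lines by auto
  ultimately have "card (SIGMA T:triples. T) \<le> card ?S"
    by (meson card_image_le card_mono finite_imageI le_trans)
  moreover have "card (SIGMA T:triples. T) = (\<Sum>T\<in>triples. card T)"
    by (rule card_SigmaI) (use finite_triples triples_card in \<open>auto intro: card_ge_0_finite\<close>)
  moreover have "(\<Sum>T\<in>triples. card T) = 3 * card triples" using triples_card by simp
  moreover have "card ?S = (\<Sum>L\<in>A. card {i. i < card A - 2 \<and> used L i})"
    by (rule card_SigmaI) (use finite_lines in auto)
  ultimately show ?thesis by simp
qed

lemma used_plus_unused:
  "card {i. i < k \<and> used L i} + card {i. i < k \<and> \<not> used L i} = k"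
proof -
  have "card ({i. i < k \<and> used L i} \<union> {i. i < k \<and> \<not> used L i}) = card {i. i < k \<and> used L i} + card {i. i < k \<and> \<not> used L i}"
    by (intro card_Un_disjoint) auto
  moreover have "{i. i < k \<and> used L i} \<union> {i. i < k \<and> \<not> used L i} = {..<k}" by auto
  ultimately show ?thesis by simp
qed

lemma triples_plus_unused:
  "3 * card triples + (\<Sum>L\<in>A. card {i. i < card A - 2 \<and> \<not> used L i}) \<le> card A * (card A - 2)"
proof -
  have "(\<Sum>L\<in>A. card {i. i < card A - 2 \<and> used L i}) + (\<Sum>L\<in>A. card {i. i < card A - 2 \<and> \<not> used L i})
    = card A * (card A - 2)"
    by (simp add: sum.distrib[symmetric] used_plus_unused)
  then show ?thesis using triples_le_used by linarith
qed

lemma par_neq: "L \<in> A \<Longrightarrow> M \<in> A - {L} \<Longrightarrow> K \<in> A - {L} \<Longrightarrow> M \<noteq> K \<Longrightarrow> par L M \<noteq> par L K"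
  using inj_par[of L] unfolding inj_on_def by blast

section \<open>Line ends and the bound for an even number of lines\<close>

text \<open>On \<open>K\<close> the crossings with \<open>M\<close> and with \<open>J\<close> are
  both neighbours of the crossing with \<open>L\<close>. In the same direction one of them would
  separate the other from \<open>L\<close>, so \<open>L\<close> lies between them: the triangles are
  on opposite sides of \<open>L\<close>, and \<open>K\<close> has crossings beyond \<open>L\<close>
  in both directions.\<close>

lemma consecutive_triples:
  assumes T: "{L, M, K} \<in> triples" "{L, K, J} \<in> triples" and d: "distinct [L, M, K, J]"
  shows "side L M K \<noteq> side L K J \<and> \<not> extreme_on K L"
proof -
  have 1: "L \<in> A" "M \<in> A" "K \<in> A" "adjacent_on K L M" using triplesD[OF T(1) refl] d by auto
  have 2: "J \<in> A" "adjacent_on K L J" using triplesD[OF T(2) refl] d by auto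
  have ne: "par K M \<noteq> par K J" "par K M \<noteq> par K L" "par K J \<noteq> par K L"
    using par_neq[OF 1(3)] 1 2 d by auto
  have opp: "(par K M < par K L) \<noteq> (par K J < par K L)"
  proof
    assume same: "(par K M < par K L) = (par K J < par K L)"
    have "\<not> (par K L < par K J \<and> par K J < par K M) \<and> \<not> (par K M < par K J \<and> par K J < par K L)"
      using 1(4) 2 d unfolding adjacent_on_def by auto
    moreover have "\<not> (par K L < par K M \<and> par K M < par K J) \<and> \<not> (par K J < par K M \<and> par K M < par K L)"
      using 1 2(2) d unfolding adjacent_on_def by auto
    ultimately show False using same ne by linarith
  qed
  have "side L K M \<noteq> side L K J"
    using side_switch[of L K M J] 1 2 d opp by auto
  moreover have "\<not> extreme_on K L"
    using opp ne 1 2 d unfolding extreme_on_def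
    by (metis DiffI distinct_length_2_or_more insertE less_asym less_linear singletonD)
  ultimately show ?thesis using side_sym by metis
qed

text \<open>All crossings of \<open>F\<close> other than that with \<open>L\<close> lie beyond it in
  one direction, where \<open>F\<close> no longer changes sides of \<open>L\<close>.\<close>

lemma extreme_same_side:
  assumes "L \<in> A" "F \<in> A" "G \<in> A" "J \<in> A" "distinct [L, F, G]" "distinct [L, F, J]" "extreme_on F L"
  shows "side L F G = side L F J"
proof (cases "G = J")
  case False
  have "(par F L < par F G \<and> par F L < par F J) \<or> (par F G < par F L \<and> par F J < par F L)"
    using assms unfolding extreme_on_def by auto
  then have "par F G < par F L \<longleftrightarrow> par F J < par F L" by auto
  then show ?thesis using side_switch[of L F G J] assms False by auto
qed simp

lemma extreme_bound:
  assumes L: "L \<in> A" and n: "card A \<ge> 4" "even (card A)"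
  shows "card {F \<in> A - {L}. extreme_on F L} \<le> 2 * card {i. i < card A - 2 \<and> \<not> used L i} + 1"
proof -
  define K where "K = card A - 2"
  have K: "card A - 1 = Suc K" using n unfolding K_def by simp
  let ?s = "\<lambda>i. side L (enum L i) (enum L (Suc i))"
  have side: "\<exists>e. \<forall>i. i < K \<and> (extreme_on (enum L i) L \<or> extreme_on (enum L (Suc i)) L) \<longrightarrow> ?s i = e"
  proof -
    have *: "\<exists>F G. F \<in> A - {L} \<and> G \<in> A - {L} \<and> F \<noteq> G \<and> extreme_on F L \<and> ?s i = side L F G"
      if "i < K" "extreme_on (enum L i) L \<or> extreme_on (enum L (Suc i)) L" for i
      using that enum_in[OF L, of i] enum_in[OF L, of "Suc i"] enum_neq[OF L, of i "Suc i"] side_sym K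
      by (metis DiffI Suc_less_eq less_Suc_eq n_not_Suc_n singletonD)
    \<comment> \<open>Two lines that end at \<open>L\<close> cross each other, and this crossing
      lies on the side from which each of them comes; so the side is common to all such
      lines.\<close>
    have **: "side L F G = side L F' G'"
      if "F \<in> A - {L}" "G \<in> A - {L}" "F \<noteq> G" "extreme_on F L" "F' \<in> A - {L}" "G' \<in> A - {L}" "F' \<noteq> G'" "extreme_on F' L" for F G F' G'
    proof (cases "F = F'")
      case True
      then show ?thesis using extreme_same_side[of L F G G'] that L by auto
    next
      case False
      have "side L F G = side L F F'" using extreme_same_side[of L F G F'] that L False by auto
      also have "\<dots> = side L F' F" by (rule side_sym)
      also have "\<dots> = side L F' G'" using extreme_same_side[of L F' F G'] that L False by auto
      finally show ?thesis .
    qed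
    show ?thesis
    proof (rule ccontr)
      assume "\<nexists>e. \<forall>i. i < K \<and> (extreme_on (enum L i) L \<or> extreme_on (enum L (Suc i)) L) \<longrightarrow> ?s i = e"
      then obtain i j where "i < K" "extreme_on (enum L i) L \<or> extreme_on (enum L (Suc i)) L"
        "j < K" "extreme_on (enum L j) L \<or> extreme_on (enum L (Suc j)) L" "?s i \<noteq> ?s j" by (metis (full_types))
      then show False using *[of i] *[of j] ** by metis
    qed
  qed
  then obtain e where e: "\<And>i. i < K \<Longrightarrow> extreme_on (enum L i) L \<or> extreme_on (enum L (Suc i)) L \<Longrightarrow> ?s i = e" by blast
  have "card {i. i \<le> K \<and> extreme_on (enum L i) L} \<le> 2 * card {i. i < K \<and> \<not> used L i} + 1"
  proof (rule extreme_count_bound[where sd = ?s and e = e])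
    fix i assume i: "Suc i < K" "used L i" "used L (Suc i)"
    have "distinct [L, enum L i, enum L (Suc i), enum L (Suc (Suc i))]"
      using enum_in[OF L, of i] enum_in[OF L, of "Suc i"] enum_in[OF L, of "Suc (Suc i)"] enum_neq[OF L, of i "Suc i"]
        enum_neq[OF L, of i "Suc (Suc i)"] enum_neq[OF L, of "Suc i" "Suc (Suc i)"] i K by auto
    then show "?s i \<noteq> ?s (Suc i) \<and> \<not> extreme_on (enum L (Suc i)) L"
      using consecutive_triples i unfolding used_def by blast
  next
    show "even K" using n unfolding K_def by auto
  qed (use e in auto)
  moreover have "card {F \<in> A - {L}. extreme_on F L} = card {i. i \<le> K \<and> extreme_on (enum L i) L}"
  proof -
    have "bij_betw (enum L) {i. i \<le> K \<and> extreme_on (enum L i) L} {F \<in> A - {L}. extreme_on F L}"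
      using enum_bij[OF L] unfolding K bij_betw_def inj_on_def lessThan_Suc_atMost by (auto simp: image_iff)
    then show ?thesis by (simp add: bij_betw_same_card)
  qed
  ultimately show ?thesis unfolding K_def by simp
qed

lemma extreme_count:
  assumes F: "F \<in> A" and n: "card A \<ge> 3"
  shows "card {L \<in> A - {F}. extreme_on F L} \<ge> 2"
proof -
  let ?a = "enum F 0" and ?b = "enum F (card A - 2)"
  have "?a \<noteq> ?b" using enum_neq[OF F, of 0 "card A - 2"] n by auto
  have idx: "\<exists>i<card A - 1. K = enum F i" if "K \<in> A - {F}" for K
    using enum_bij[OF F] that unfolding bij_betw_def by (metis imageE lessThan_iff)
  have a: "extreme_on F ?a" unfolding extreme_on_def
  proof (rule disjI1, rule ballI)
    fix K assume K: "K \<in> A - {F, ?a}"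
    then obtain i where "i < card A - 1" "K = enum F i" using idx by auto
    then show "par F ?a < par F K" using enum_less[OF F, of 0 i] K by (cases i) auto
  qed
  have b: "extreme_on F ?b" unfolding extreme_on_def
  proof (rule disjI2, rule ballI)
    fix K assume K: "K \<in> A - {F, ?b}"
    then obtain i where i: "i < card A - 1" "K = enum F i" using idx by auto
    then have "i \<noteq> card A - 2" using K by auto
    then show "par F K < par F ?b" using enum_less[OF F, of i "card A - 2"] i n by auto
  qed
  have "{?a, ?b} \<subseteq> {L \<in> A - {F}. extreme_on F L}"
    using a b enum_in[OF F, of 0] enum_in[OF F, of "card A - 2"] n by auto
  then have "card {?a, ?b} \<le> card {L \<in> A - {F}. extreme_on F L}"
    by (rule card_mono[rotated]) (use finite_lines in auto)
  then show ?thesis using \<open>?a \<noteq> ?b\<close> by simp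
qed

lemma even_triples_bound:
  assumes n: "card A \<ge> 4" "even (card A)"
  shows "6 * card triples + card A \<le> 2 * (card A * (card A - 2))"
proof -
  have "2 * card A \<le> (\<Sum>F\<in>A. card {L \<in> A - {F}. extreme_on F L})"
    using sum_mono[of A "\<lambda>_. 2" "\<lambda>F. card {L \<in> A - {F}. extreme_on F L}"] extreme_count n by simp
  also have "\<dots> = (\<Sum>F\<in>A. \<Sum>L\<in>A. of_bool (L \<noteq> F \<and> extreme_on F L))"
    by (intro sum.cong refl) (simp add: finite_lines of_bool_def sum.If_cases Int_def Diff_eq conj_ac)
  also have "\<dots> = (\<Sum>L\<in>A. \<Sum>F\<in>A. of_bool (L \<noteq> F \<and> extreme_on F L))"
    by (rule sum.swap)
  also have "\<dots> = (\<Sum>L\<in>A. card {F \<in> A - {L}. extreme_on F L})"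
    by (intro sum.cong refl) (simp add: finite_lines of_bool_def sum.If_cases Int_def Diff_eq conj_ac eq_commute)
  also have "\<dots> \<le> (\<Sum>L\<in>A. 2 * card {i. i < card A - 2 \<and> \<not> used L i} + 1)"
    by (intro sum_mono extreme_bound n)
  also have "\<dots> = 2 * (\<Sum>L\<in>A. card {i. i < card A - 2 \<and> \<not> used L i}) + card A"
    by (simp only: sum.distrib sum_distrib_left) simp
  finally show ?thesis using triples_plus_unused by linarith
qed

end

section \<open>Straightened pseudo-lines\<close>

definition pt :: "real \<Rightarrow> real \<Rightarrow> plane" where
  "pt x y = x *\<^sub>R axis 1 1 + y *\<^sub>R axis 2 1"

lemma pt_nth [simp]: "pt x y $ 1 = x" "pt x y $ 2 = y"
  by (simp_all add: pt_def axis_def)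

lemma plane_eq_iff: "(p :: plane) = q \<longleftrightarrow> p $ 1 = q $ 1 \<and> p $ 2 = q $ 2"
  by (simp add: vec_eq_iff forall_2)

lemma continuous_on_pt [continuous_intros]:
  "continuous_on S f \<Longrightarrow> continuous_on S g \<Longrightarrow> continuous_on S (\<lambda>x. pt (f x) (g x))"
  unfolding pt_def by (intro continuous_intros)

lemma norm_pt_vertical: "norm (pt 0 y) = \<bar>y\<bar>"
  by (simp add: pt_def norm_axis_1)

lemma affine_line_straighten:
  fixes S :: "plane set"
  assumes "affine S" "aff_dim S = 1"
  obtains G G' :: "plane \<Rightarrow> plane" where "homeomorphism UNIV UNIV G G'" "\<And>p. p \<in> S \<longleftrightarrow> G p $ 2 = 0"
proof -
  obtain B where B: "\<not> affine_dependent B" "affine hull B = S"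
    using affine_basis_exists[of S] assms(1) by (metis affine_hull_eq)
  have "int (card B) = 2"
    using aff_dim_affine_independent[OF B(1)] B(2) assms(2) by (metis aff_dim_affine_hull one_add_one)
  then have "card B = 2" by simp
  then obtain a b where ab: "B = {a, b}" "a \<noteq> b" by (auto simp: card_2_iff)
  define d where "d = b - a"
  define J where "J = pt (- d $ 2) (d $ 1)"
  define N where "N = (d $ 1)\<^sup>2 + (d $ 2)\<^sup>2"
  have "d \<noteq> 0" using ab by (simp add: d_def)
  then have N: "N \<noteq> 0" unfolding N_def by (simp add: plane_eq_iff sum_power2_eq_zero_iff)
  \<comment> \<open>In complex notation this is p -> (p - a) / d: the vector \<open>J\<close> is i
    d, and \<open>N\<close> is the squared length of \<open>d\<close>.\<close>
  define G where "G p = pt (((p - a) \<bullet> d) / N) (((p - a) \<bullet> J) / N)" for p :: plane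
  define G' where "G' q = a + (q $ 1) *\<^sub>R d + (q $ 2) *\<^sub>R J" for q :: plane
  have G'G: "G' (G p) = p" for p
  proof -
    define x y where "x = p $ 1 - a $ 1" and "y = p $ 2 - a $ 2"
    have "(x * d $ 1 + y * d $ 2) * d $ 1 - (y * d $ 1 - x * d $ 2) * d $ 2 = x * N"
      "(x * d $ 1 + y * d $ 2) * d $ 2 + (y * d $ 1 - x * d $ 2) * d $ 1 = y * N"
      unfolding N_def by algebra+
    then have "((x * d $ 1 + y * d $ 2) / N) * d $ 1 - ((y * d $ 1 - x * d $ 2) / N) * d $ 2 = x"
      "((x * d $ 1 + y * d $ 2) / N) * d $ 2 + ((y * d $ 1 - x * d $ 2) / N) * d $ 1 = y"
      using N by (metis (no_types, lifting) times_divide_eq_left diff_divide_distrib nonzero_eq_divide_eq,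
                  metis (no_types, lifting) times_divide_eq_left add_divide_distrib nonzero_eq_divide_eq)
    then show ?thesis unfolding G_def G'_def plane_eq_iff
      by (simp add: inner_vec_def sum_2 J_def x_def[symmetric] y_def[symmetric]) (simp add: x_def y_def)
  qed
  have GG': "G (G' q) = q" for q
  proof -
    have "(q $ 1 * d $ 1 - q $ 2 * d $ 2) * d $ 1 + (q $ 1 * d $ 2 + q $ 2 * d $ 1) * d $ 2 = q $ 1 * N"
      "(q $ 1 * d $ 2 + q $ 2 * d $ 1) * d $ 1 - (q $ 1 * d $ 1 - q $ 2 * d $ 2) * d $ 2 = q $ 2 * N"
      unfolding N_def by algebra+
    then show ?thesis unfolding G_def G'_def plane_eq_iff using N
      by (simp add: inner_vec_def sum_2 J_def)
  qed
  have "continuous_on UNIV G" unfolding G_def using N by (intro continuous_intros) auto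
  moreover have "continuous_on UNIV G'" unfolding G'_def by (intro continuous_intros)
  ultimately have hom: "homeomorphism UNIV UNIV G G'"
    unfolding homeomorphism_def using GG' G'G by (auto simp: image_iff) metis+
  have S: "S = range (\<lambda>u. a + u *\<^sub>R d)" using B ab affine_hull_2_alt[of a b] by (simp add: d_def)
  have "p \<in> S \<longleftrightarrow> G p $ 2 = 0" for p
  proof
    assume "p \<in> S"
    then obtain u where "p = a + u *\<^sub>R d" using S by auto
    then show "G p $ 2 = 0" unfolding G_def by (simp add: inner_vec_def sum_2 J_def)
  next
    assume "G p $ 2 = 0"
    then have "p = a + (G p $ 1) *\<^sub>R d" using G'G[of p] unfolding G'_def by simp
    then show "p \<in> S" using S by blast
  qed
  then show thesis using that hom by blast
qed

lemma pseudo_line_straighten: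
  assumes "pseudo_line L"
  obtains H H' :: "plane \<Rightarrow> plane" where "homeomorphism UNIV UNIV H H'" "\<And>p. p \<in> L \<longleftrightarrow> H p $ 2 = 0"
proof -
  obtain h h' S where h: "homeomorphism UNIV UNIV (h :: plane \<Rightarrow> plane) h'" "affine S" "aff_dim S = 1" "h ` L = S"
    using assms unfolding pseudo_line_def by blast
  obtain G G' :: "plane \<Rightarrow> plane" where G: "homeomorphism UNIV UNIV G G'" "\<And>p. p \<in> S \<longleftrightarrow> G p $ 2 = 0"
    using affine_line_straighten[OF h(2,3)] by blast
  have "homeomorphism UNIV UNIV (G \<circ> h) (h' \<circ> G')" using homeomorphism_compose[OF h(1) G(1)] .
  moreover have "p \<in> L \<longleftrightarrow> (G \<circ> h) p $ 2 = 0" for p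
  proof -
    have "p \<in> L \<longleftrightarrow> h p \<in> S" using h(1,4) unfolding homeomorphism_def by (metis UNIV_I imageE image_eqI)
    then show ?thesis using G(2) by simp
  qed
  ultimately show thesis using that by blast
qed

lemma connected_same_sign:
  fixes f :: "'a::topological_space \<Rightarrow> real"
  assumes "connected S" "continuous_on S f" "\<And>x. x \<in> S \<Longrightarrow> f x \<noteq> 0" "p \<in> S" "q \<in> S"
  shows "0 < f p \<longleftrightarrow> 0 < f q"
proof -
  have c: "connected (f ` S)" using assms by (simp add: connected_continuous_image)
  have "0 \<notin> f ` S" using assms(3) by force
  then have "\<not> (f p < 0 \<and> 0 < f q)" "\<not> (f q < 0 \<and> 0 < f p)"
    using connectedD_interval[OF c, of "f p" "f q" 0] connectedD_interval[OF c, of "f q" "f p" 0] assms(4,5) by auto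
  then show ?thesis using assms(3)[OF assms(4)] assms(3)[OF assms(5)] by linarith
qed

lemma homeomorphism_open_image:
  assumes "homeomorphism UNIV UNIV h h'" "open W"
  shows "open (h ` W)"
proof -
  have "h ` W = h' -` W" using assms(1) unfolding homeomorphism_def by (auto simp: image_iff) metis
  moreover have "open (h' -` W)" using assms unfolding homeomorphism_def by (simp add: open_vimage)
  ultimately show ?thesis by simp
qed

section \<open>Charts at the crossings\<close>

text \<open>Half-discs, quarter-discs and half-axes of a chart are connected, so their images cannot
  leave a polygon or a segment as long as they avoid the lines in question.\<close>

lemma convex_signed_ball:
  fixes c d :: real
  shows "convex {q \<in> ball (z :: plane) e. 0 < q $ 2 * d}"
    "convex {q \<in> ball (z :: plane) e. 0 < q $ 1 * c \<and> 0 < q $ 2 * d}"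
    "convex {q \<in> ball (z :: plane) e. q $ 1 = 0 \<and> 0 < q $ 2 * d}"
proof -
  have 1: "convex {q :: plane. 0 < q $ i * c}" for i c
  proof -
    have "{q :: plane. 0 < q $ i * c} = {q. (c *\<^sub>R axis i 1) \<bullet> q > 0}"
      by (auto simp: inner_axis inner_commute mult.commute)
    then show ?thesis using convex_halfspace_gt[of 0 "c *\<^sub>R axis i 1"] by (simp add: inner_commute)
  qed
  have 2: "convex {q :: plane. q $ 1 = 0}"
  proof -
    have "{q :: plane. q $ 1 = 0} = {q. axis 1 1 \<bullet> q = 0}" by (auto simp: inner_axis inner_commute)
    then show ?thesis using convex_hyperplane by metis
  qed
  show "convex {q \<in> ball (z :: plane) e. 0 < q $ 2 * d}"
    using convex_Int[OF convex_ball[of z e] 1[of 2 d]] by (auto simp: Int_def)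
  show "convex {q \<in> ball (z :: plane) e. 0 < q $ 1 * c \<and> 0 < q $ 2 * d}"
    using convex_Int[OF convex_Int[OF convex_ball[of z e] 1[of 1 c]] 1[of 2 d]] by (auto simp: Int_def conj_ac)
  show "convex {q \<in> ball (z :: plane) e. q $ 1 = 0 \<and> 0 < q $ 2 * d}"
    using convex_Int[OF convex_Int[OF convex_ball[of z e] 2] 1[of 2 d]] by (auto simp: Int_def conj_ac)
qed

text \<open>The chart is shrunk to a ball, so that its halves and quarters are connected, and its
  image is kept inside \<open>W\<close>, so that the other lines can be excluded.\<close>

lemma transversal_chart:
  assumes "transversal_at L M v" "open W" "v \<in> W"
  obtains f g e where "e > 0" "continuous_on (ball (0 :: plane) e) g" "g 0 = v" "g ` ball 0 e \<subseteq> W" "open (g ` ball 0 e)"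
    "\<And>q. q \<in> ball 0 e \<Longrightarrow> f (g q) = (q :: plane)"
    "\<And>q. q \<in> ball 0 e \<Longrightarrow> g q \<in> L \<longleftrightarrow> q $ 2 = 0" "\<And>q. q \<in> ball 0 e \<Longrightarrow> g q \<in> M \<longleftrightarrow> q $ 1 = 0"
proof -
  obtain U V f g where c: "open U" "v \<in> U" "open V" "homeomorphism U V (f :: plane \<Rightarrow> plane) g"
      "f ` (L \<inter> U) = {x \<in> V. x $ 2 = 0}" "f ` (M \<inter> U) = {x \<in> V. x $ 1 = 0}" and v: "v \<in> L \<inter> M"
    using assms(1) unfolding transversal_at_def by blast
  have fg: "\<And>q. q \<in> V \<Longrightarrow> f (g q) = q" "\<And>p. p \<in> U \<Longrightarrow> g (f p) = p" "\<And>q. q \<in> V \<Longrightarrow> g q \<in> U" "\<And>p. p \<in> U \<Longrightarrow> f p \<in> V"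
    and cont: "continuous_on U f" "continuous_on V g"
    using c(4) unfolding homeomorphism_def by auto
  have fv: "f v = 0" using c(2,5,6) v by (auto simp: plane_eq_iff)
  have image_mem: "g q \<in> X \<longleftrightarrow> q \<in> f ` (X \<inter> U)" if "q \<in> V" for q X
  proof
    assume "g q \<in> X"
    then show "q \<in> f ` (X \<inter> U)" using fg(1)[OF that] fg(3)[OF that] by (intro image_eqI[of _ _ "g q"]) auto
  next
    assume "q \<in> f ` (X \<inter> U)"
    then show "g q \<in> X" using fg(2) by auto
  qed
  have L: "g q \<in> L \<longleftrightarrow> q $ 2 = 0" and M: "g q \<in> M \<longleftrightarrow> q $ 1 = 0" if "q \<in> V" for q
    using image_mem[OF that, of L] image_mem[OF that, of M] that unfolding c(5) c(6) by simp_all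
  have "open (V \<inter> g -` W)" using continuous_open_preimage[OF cont(2) c(3) assms(2)] .
  moreover have "0 \<in> V \<inter> g -` W" using fv fg c(2) assms(3) by (metis IntI vimageI)
  ultimately obtain e where e: "e > 0" "ball 0 e \<subseteq> V \<inter> g -` W" by (meson openE)
  have "g ` ball 0 e = U \<inter> f -` ball 0 e"
  proof (intro equalityI subsetI)
    fix x assume "x \<in> g ` ball 0 e"
    then obtain q where "x = g q" "q \<in> ball 0 e" by blast
    then show "x \<in> U \<inter> f -` ball 0 e" using e fg(1,3)[of q] by auto
  next
    fix x assume "x \<in> U \<inter> f -` ball 0 e"
    then show "x \<in> g ` ball 0 e" using fg(2)[of x] by (intro image_eqI[of _ _ "f x"]) auto
  qed
  then have "open (g ` ball 0 e)" using continuous_open_preimage[OF cont(1) c(1), of "ball 0 e"] by simp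
  moreover have "ball 0 e \<subseteq> V" "g ` ball 0 e \<subseteq> W" using e by auto
  moreover have "g 0 = v" using fg(2)[OF c(2)] fv by simp
  ultimately show thesis
    using that[of e g f] e(1) fg(1) L M continuous_on_subset[OF cont(2)] by blast
qed

text \<open>One straightening homeomorphism is fixed for each line: the first coordinate of
  \<open>H L\<close> orders the points of \<open>L\<close>, and the sign of the second tells the two
  sides of \<open>L\<close> apart.\<close>

locale straightened_arrangement =
  fixes n :: nat and A :: "plane set set" and H H' :: "plane set \<Rightarrow> plane \<Rightarrow> plane"
  assumes simple: "simple_affine_arrangement n A"
    and homeo: "\<And>L. L \<in> A \<Longrightarrow> homeomorphism UNIV UNIV (H L) (H' L)"
    and mem_line: "\<And>L p. L \<in> A \<Longrightarrow> p \<in> L \<longleftrightarrow> H L p $ 2 = 0"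
begin

lemma fin: "finite A" and card_A: "card A = n" using simple unfolding simple_affine_arrangement_def by auto

lemma H_inv [simp]: "L \<in> A \<Longrightarrow> H L (H' L q) = q" "L \<in> A \<Longrightarrow> H' L (H L q) = q"
  and cont_H: "L \<in> A \<Longrightarrow> continuous_on S (H L)" and cont_H': "L \<in> A \<Longrightarrow> continuous_on S (H' L)"
  using homeo[of L] unfolding homeomorphism_def by (auto intro: continuous_on_subset)

lemma cont_height: "L \<in> A \<Longrightarrow> continuous_on S (\<lambda>p. H L p $ 2)"
  using cont_H by (intro continuous_intros) auto

lemma closed_line: "L \<in> A \<Longrightarrow> closed L"
proof -
  assume L: "L \<in> A"
  have "L = (\<lambda>p. H L p $ 2) -` {0}" using mem_line[OF L] by auto
  moreover have "closed ((\<lambda>p. H L p $ 2) -` {0})" by (intro closed_vimage cont_height L) auto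
  ultimately show ?thesis by metis
qed

lemma closed_lines: "B \<subseteq> A \<Longrightarrow> closed (\<Union>B)"
  using fin closed_line by (meson closed_Union finite_subset subsetD)

definition cr :: "plane set \<Rightarrow> plane set \<Rightarrow> plane" where "cr L M = (SOME p. p \<in> L \<inter> M)"
definition par :: "plane set \<Rightarrow> plane set \<Rightarrow> real" where "par L M = H L (cr L M) $ 1"
definition side :: "plane set \<Rightarrow> plane set \<Rightarrow> plane set \<Rightarrow> bool" where "side L M K \<longleftrightarrow> 0 < H L (cr M K) $ 2"
definition path :: "plane set \<Rightarrow> real \<Rightarrow> plane" where "path L t = H' L (pt t 0)"

lemma cr:
  assumes "L \<in> A" "M \<in> A" "L \<noteq> M"
  shows "L \<inter> M = {cr L M}" "transversal_at L M (cr L M)" "\<And>N. N \<in> A \<Longrightarrow> N \<noteq> L \<Longrightarrow> N \<noteq> M \<Longrightarrow> cr L M \<notin> N"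
proof -
  obtain p where p: "L \<inter> M = {p}" "transversal_at L M p" "\<forall>N\<in>A - {L, M}. p \<notin> N"
    using simple assms unfolding simple_affine_arrangement_def by blast
  have "cr L M = p" unfolding cr_def using p(1) by auto
  then show "L \<inter> M = {cr L M}" "transversal_at L M (cr L M)" "\<And>N. N \<in> A \<Longrightarrow> N \<noteq> L \<Longrightarrow> N \<noteq> M \<Longrightarrow> cr L M \<notin> N"
    using p by auto
qed

lemma cr_sym: "cr L M = cr M L" unfolding cr_def by (simp add: Int_commute)

lemma cr_eqI: "L \<in> A \<Longrightarrow> M \<in> A \<Longrightarrow> L \<noteq> M \<Longrightarrow> p \<in> L \<Longrightarrow> p \<in> M \<Longrightarrow> p = cr L M"
  using cr(1) by blast

lemma cr_in: "L \<in> A \<Longrightarrow> M \<in> A \<Longrightarrow> L \<noteq> M \<Longrightarrow> cr L M \<in> L \<and> cr L M \<in> M"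
  using cr(1) by blast

lemma path_in: "L \<in> A \<Longrightarrow> path L t \<in> L" and path_coord: "L \<in> A \<Longrightarrow> H L (path L t) = pt t 0"
  by (auto simp: path_def mem_line)

lemma path_of: "L \<in> A \<Longrightarrow> p \<in> L \<Longrightarrow> path L (H L p $ 1) = p"
proof -
  assume L: "L \<in> A" and p: "p \<in> L"
  have "pt (H L p $ 1) 0 = H L p" using mem_line[OF L, of p] p by (simp add: plane_eq_iff)
  then show ?thesis using L by (simp add: path_def)
qed

lemma cont_path: "L \<in> A \<Longrightarrow> continuous_on S (path L)"
proof -
  assume L: "L \<in> A"
  have "continuous_on S (H' L \<circ> (\<lambda>t. pt t 0))"
    by (intro continuous_on_compose continuous_intros cont_H' L)
  then show ?thesis unfolding path_def comp_def .
qed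

lemma path_par: "L \<in> A \<Longrightarrow> M \<in> A \<Longrightarrow> L \<noteq> M \<Longrightarrow> path L (par L M) = cr L M"
  unfolding par_def using path_of cr_in by blast

lemma path_mem_other: "L \<in> A \<Longrightarrow> M \<in> A \<Longrightarrow> L \<noteq> M \<Longrightarrow> path L t \<in> M \<longleftrightarrow> t = par L M"
proof
  assume a: "L \<in> A" "M \<in> A" "L \<noteq> M" "path L t \<in> M"
  then have "path L t = cr L M" using cr_eqI path_in by blast
  then show "t = par L M" unfolding par_def using path_coord[of L t] a by (metis pt_nth(1))
next
  assume a: "L \<in> A" "M \<in> A" "L \<noteq> M" "t = par L M"
  then show "path L t \<in> M" using path_par cr_in by metis
qed

text \<open>In the chart \<open>M\<close> is the vertical axis and enters both half-discs bounded by
  \<open>L\<close>. If \<open>M\<close> stayed on one side of \<open>L\<close>, both half-discs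
  would be on that side, and so would a whole neighbourhood of the crossing, up to points of
  \<open>L\<close> itself.\<close>

lemma transversal_not_one_sided:
  assumes L: "L \<in> A" and M: "M \<in> A" and ne: "L \<noteq> M" and s: "s \<noteq> 0"
    and pos: "\<And>p. p \<in> M \<Longrightarrow> p \<noteq> cr L M \<Longrightarrow> 0 < s * H L p $ 2"
  shows False
proof -
  obtain f g e where c: "e > 0" "continuous_on (ball (0 :: plane) e) g" "g 0 = cr L M" "open (g ` ball 0 e)"
    "\<And>q. q \<in> ball 0 e \<Longrightarrow> f (g q) = (q :: plane)"
    "\<And>q. q \<in> ball 0 e \<Longrightarrow> g q \<in> L \<longleftrightarrow> q $ 2 = 0" "\<And>q. q \<in> ball 0 e \<Longrightarrow> g q \<in> M \<longleftrightarrow> q $ 1 = 0"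
    using transversal_chart[OF cr(2)[OF L M ne], of UNIV] by (metis UNIV_I open_UNIV)
  have half: "0 < s * H L (g q) $ 2" if q: "q \<in> ball 0 e" "0 < q $ 2 * d" and d: "d = 1 \<or> d = -1" for q d
  proof -
    let ?B = "{q \<in> ball (0 :: plane) e. 0 < q $ 2 * d}"
    let ?r = "pt 0 (d * e / 2)"
    have r: "?r \<in> ?B" using c(1) d by (auto simp: dist_norm norm_pt_vertical)
    have cont: "continuous_on ?B (\<lambda>q. s * H L (g q) $ 2)"
    proof -
      have "continuous_on ?B (H L \<circ> g)"
        by (intro continuous_on_compose cont_H L) (use c(2) in \<open>auto intro: continuous_on_subset\<close>)
      then show ?thesis by (intro continuous_intros) (simp add: comp_def)
    qed
    have nz: "s * H L (g q) $ 2 \<noteq> 0" if "q \<in> ?B" for q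
      using that c(6)[of q] mem_line[OF L, of "g q"] s by auto
    have "?r $ 2 \<noteq> 0" using d c(1) by auto
    then have "?r \<noteq> 0" by (metis zero_index)
    moreover have "f (g ?r) = ?r" "f (g 0) = 0" using r c(1,5) by auto
    ultimately have "g ?r \<noteq> cr L M" using c(3) by metis
    moreover have "g ?r \<in> M" using r c(7)[of ?r] by simp
    ultimately have "0 < s * H L (g ?r) $ 2" using pos by blast
    then show ?thesis
      using connected_same_sign[OF convex_connected[OF convex_signed_ball(1)] cont nz r, of q] q by auto
  qed
  have nonneg: "0 \<le> s * H L (g q) $ 2" if "q \<in> ball 0 e" for q
  proof -
    consider "q $ 2 = 0" | "q $ 2 > 0" | "q $ 2 < 0" by linarith
    then show ?thesis
    proof cases
      case 1
      then show ?thesis using c(6)[OF that] mem_line[OF L] by simp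
    next
      case 2
      then show ?thesis using half[OF that, of 1] by simp
    next
      case 3
      then show ?thesis using half[OF that, of "-1"] by simp
    qed
  qed
  have "open (H L ` (g ` ball 0 e))" using homeomorphism_open_image[OF homeo[OF L] c(4)] .
  moreover have "H L (cr L M) \<in> H L ` (g ` ball 0 e)" using c(1,3) by (metis centre_in_ball imageI)
  ultimately obtain \<delta> where \<delta>: "\<delta> > 0" "ball (H L (cr L M)) \<delta> \<subseteq> H L ` (g ` ball 0 e)" by (meson openE)
  \<comment> \<open>A small move from the crossing against the sign of \<open>s\<close> stays in the
    image of the chart, which is open, but makes the signed height negative.\<close>
  let ?z = "H L (cr L M) + pt 0 (- sgn s * \<delta> / 2)"
  have "?z \<in> ball (H L (cr L M)) \<delta>" using \<delta>(1) s by (simp add: dist_norm norm_pt_vertical abs_mult sgn_if)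
  then have "?z \<in> H L ` (g ` ball 0 e)" using \<delta>(2) by blast
  then obtain q where q: "q \<in> ball 0 e" "?z = H L (g q)" by blast
  have "H L (cr L M) $ 2 = 0" using mem_line[OF L] cr_in[OF L M ne] by blast
  then have "s * H L (g q) $ 2 = - \<bar>s\<bar> * \<delta> / 2" unfolding q(2)[symmetric] by (simp add: sgn_if abs_if)
  moreover have "0 < \<bar>s\<bar> * \<delta>" using \<delta>(1) s by simp
  ultimately show False using nonneg[OF q(1)] by linarith
qed

text \<open>Before and after its only meeting with \<open>L\<close>, the curve \<open>M\<close>
  keeps a constant sign of the height over \<open>L\<close>; equal signs would make it one-sided,
  which transversality excludes.\<close>

lemma crossing_switches_side:
  assumes L: "L \<in> A" and M: "M \<in> A" and ne: "L \<noteq> M" and p: "p \<in> M" "p \<noteq> cr L M" and q: "q \<in> M" "q \<noteq> cr L M"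
  shows "(0 < H L p $ 2 \<longleftrightarrow> 0 < H L q $ 2) \<longleftrightarrow> (H M p $ 1 < par M L \<longleftrightarrow> H M q $ 1 < par M L)"
proof -
  let ?h = "\<lambda>t. H L (path M t) $ 2"
  have cont: "continuous_on S ?h" for S
  proof -
    have "continuous_on S (H L \<circ> path M)" by (intro continuous_on_compose cont_H cont_path L M)
    then show ?thesis by (intro continuous_intros) (simp add: comp_def)
  qed
  have nz: "?h t \<noteq> 0" if "t \<noteq> par M L" for t
    using path_mem_other[OF M L] ne that mem_line[OF L] by metis
  have left: "0 < ?h s \<longleftrightarrow> 0 < ?h t" if "s < par M L" "t < par M L" for s t
    using connected_same_sign[OF _ cont, of "{..<par M L}" s t] nz that by auto
  have right: "0 < ?h s \<longleftrightarrow> 0 < ?h t" if "s > par M L" "t > par M L" for s t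
    using connected_same_sign[OF _ cont, of "{par M L<..}" s t] nz that by auto
  have opp: "0 < ?h s \<longleftrightarrow> \<not> 0 < ?h t" if st: "s < par M L" "t > par M L" for s t
  proof (rule ccontr)
    assume "\<not> (0 < ?h s \<longleftrightarrow> \<not> 0 < ?h t)"
    then have same: "0 < ?h s \<longleftrightarrow> 0 < ?h t" by blast
    have "0 < ?h s * H L x $ 2" if x: "x \<in> M" "x \<noteq> cr L M" for x
    proof -
      have xp: "x = path M (H M x $ 1)" using path_of[OF M x(1)] by simp
      then have "H M x $ 1 \<noteq> par M L" using x path_par[OF M L] ne cr_sym[of L M] by metis
      then have "0 < ?h s \<longleftrightarrow> 0 < ?h (H M x $ 1)" using left[of s] right[of t] same st by (metis linorder_neqE_linordered_idom)
      then show ?thesis using nz[of s] nz[of "H M x $ 1"] st xp \<open>H M x $ 1 \<noteq> par M L\<close>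
        by (metis less_irrefl linorder_neqE_linordered_idom zero_less_mult_iff)
    qed
    then show False using transversal_not_one_sided[OF L M ne, of "?h s"] nz[of s] st by auto
  qed
  have pp: "p = path M (H M p $ 1)" "q = path M (H M q $ 1)" using path_of[OF M] p q by auto
  then have "H M p $ 1 \<noteq> par M L" "H M q $ 1 \<noteq> par M L" using p q path_par[OF M L] ne cr_sym[of L M] by metis+
  then show ?thesis using left right opp pp by (metis linorder_neqE_linordered_idom)
qed

lemma par_inj: "L \<in> A \<Longrightarrow> inj_on (par L) (A - {L})"
proof (rule inj_onI)
  fix M K assume a: "L \<in> A" "M \<in> A - {L}" "K \<in> A - {L}" "par L M = par L K"
  then have "cr L M = cr L K" using path_par by (metis DiffD1 DiffD2 insertI1)
  then show "M = K" using cr(3)[of L M K] cr_in[of L K] a by fastforce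
qed

lemma orders: "line_orders A par side"
proof
  show "finite A" by (rule fin)
next
  fix L assume "L \<in> A" then show "inj_on (par L) (A - {L})" by (rule par_inj)
next
  fix L M K show "side L M K = side L K M" unfolding side_def using cr_sym[of M K] by simp
next
  fix L M K J assume a: "L \<in> A" "M \<in> A" "K \<in> A" "J \<in> A" "distinct [L, M, K, J]"
  have "cr M K \<in> M" "cr M J \<in> M" using cr_in a by auto
  moreover have "cr M K \<notin> L" "cr M J \<notin> L" using cr(3)[of M K L] cr(3)[of M J L] a by auto
  moreover have "cr L M \<in> L" using cr_in a by auto
  ultimately have "(0 < H L (cr M K) $ 2 \<longleftrightarrow> 0 < H L (cr M J) $ 2) \<longleftrightarrow> (H M (cr M K) $ 1 < par M L \<longleftrightarrow> H M (cr M J) $ 1 < par M L)"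
    using a by (intro crossing_switches_side) auto
  then show "side L M K = side L M J \<longleftrightarrow> (par M K < par M L \<longleftrightarrow> par M J < par M L)"
    unfolding side_def par_def by simp
qed

end

section \<open>Polygons and segments near a line and near a crossing\<close>

lemma closure_signed_ball:
  fixes z :: plane
  assumes y: "y \<in> ball z e" "y $ 2 = 0" and d: "d \<noteq> 0"
  shows "y \<in> closure {q \<in> ball z e. 0 < q $ 2 * d}"
  unfolding closure_approachable
proof (intro allI impI)
  fix \<epsilon> :: real assume "\<epsilon> > 0"
  define r where "r = min \<epsilon> (e - dist z y) / 2"
  have r: "r > 0" "r < \<epsilon>" "r < e - dist z y" using \<open>\<epsilon> > 0\<close> y(1) unfolding r_def by auto
  let ?q = "y + pt 0 (r * sgn d)"
  have dist: "dist ?q y = r" using r(1) d by (simp add: dist_norm norm_pt_vertical abs_mult sgn_if)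
  have "dist z ?q \<le> dist z y + dist ?q y" by (metis dist_commute dist_triangle)
  then have "?q \<in> ball z e" using r dist by auto
  moreover have "0 < ?q $ 2 * d" using r(1) d y(2) by (simp add: sgn_if zero_less_mult_iff)
  ultimately show "\<exists>q\<in>{q \<in> ball z e. 0 < q $ 2 * d}. dist q y < \<epsilon>" using dist r by (intro bexI[of _ ?q]) auto
qed

context straightened_arrangement
begin

sublocale line_orders A par side by (rule orders)

lemma polygon_open: "P \<in> arr_polygons A \<Longrightarrow> open P"
  unfolding arr_polygons_def using closed_lines[of A] open_components[of "- \<Union>A"] by (simp add: open_Compl)

lemma polygon_facts:
  assumes "P \<in> arr_polygons A"
  shows "connected P" "P \<noteq> {}" "L \<in> A \<Longrightarrow> P \<inter> L = {}" "connected t \<Longrightarrow> t \<inter> \<Union>A = {} \<Longrightarrow> P \<inter> t \<noteq> {} \<Longrightarrow> t \<subseteq> P"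
proof -
  have P: "P \<in> components (- \<Union>A)" using assms unfolding arr_polygons_def .
  show "connected P" "P \<noteq> {}" using P in_components_connected in_components_nonempty by auto
  show "P \<inter> L = {}" if "L \<in> A" using in_components_subset[OF P] that by auto
  show "t \<subseteq> P" if "connected t" "t \<inter> \<Union>A = {}" "P \<inter> t \<noteq> {}"
    using components_maximal[OF P that(1)] that by auto
qed

lemma polygon_sign:
  assumes P: "P \<in> arr_polygons A" and L: "L \<in> A" and x: "x \<in> P" "y \<in> P"
  shows "0 < H L x $ 2 * H L y $ 2"
proof -
  have nz: "H L z $ 2 \<noteq> 0" if "z \<in> P" for z using polygon_facts(3)[OF P L] mem_line[OF L] that by blast
  have "0 < H L x $ 2 \<longleftrightarrow> 0 < H L y $ 2"
    using connected_same_sign[OF polygon_facts(1)[OF P] cont_height[OF L] nz x] by blast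
  then show ?thesis using nz[OF x(1)] nz[OF x(2)] by (auto simp: zero_less_mult_iff)
qed

text \<open>Near a point of \<open>L\<close> on no other line, each side of \<open>L\<close> is a
  connected half-disc free of lines, hence inside \<open>P\<close> as soon as \<open>P\<close> meets
  it. The sample point \<open>x\<close> only tells on which side of \<open>L\<close> the polygon
  lies.\<close>

lemma half_disc:
  assumes P: "P \<in> arr_polygons A" and L: "L \<in> A" and p: "p \<in> L" "p \<notin> \<Union>(A - {L})" "p \<in> closure P" and x: "x \<in> P"
  shows "\<exists>e>0. \<forall>q\<in>ball (H L p) e. 0 < q $ 2 * H L x $ 2 \<longrightarrow> H' L q \<in> P"
proof -
  have "open (H L ` (- \<Union>(A - {L})))"
    using closed_lines[of "A - {L}"] by (intro homeomorphism_open_image[OF homeo[OF L]]) (auto simp: open_Compl)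
  then obtain e where e: "e > 0" "ball (H L p) e \<subseteq> H L ` (- \<Union>(A - {L}))"
    using p(2) by (meson ComplI imageI openE)
  let ?B = "{q \<in> ball (H L p) e. 0 < q $ 2 * H L x $ 2}"
  have "open (H' L ` ball (H L p) e)"
    using homeomorphism_open_image[of "H' L" "H L"] homeo[OF L] by (simp add: homeomorphism_symD)
  moreover have "p \<in> H' L ` ball (H L p) e" using e(1) L by (metis H_inv(2) centre_in_ball imageI)
  ultimately have "H' L ` ball (H L p) e \<inter> P \<noteq> {}" using p(3) by (metis IntI Int_commute closure_iff_nhds_not_empty empty_iff order_refl)
  then obtain q where q: "q \<in> ball (H L p) e" "H' L q \<in> P" by blast
  have "q \<in> ?B" using polygon_sign[OF P L q(2) x] q(1) L by simp
  have "connected (H' L ` ?B)"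
    by (intro connected_continuous_image cont_H' L convex_connected convex_signed_ball)
  moreover have "H' L ` ?B \<inter> \<Union>A = {}"
  proof -
    have "H' L r \<notin> M" if r: "r \<in> ?B" and M: "M \<in> A" for r M
    proof (cases "M = L")
      case True
      then show ?thesis using r mem_line[OF L, of "H' L r"] L by auto
    next
      case False
      have "r \<in> H L ` (- \<Union>(A - {L}))" using r e(2) by blast
      then obtain w where "w \<notin> \<Union>(A - {L})" "r = H L w" by blast
      then show ?thesis using False M L by auto
    qed
    then show ?thesis by blast
  qed
  moreover have "P \<inter> H' L ` ?B \<noteq> {}" using q(2) \<open>q \<in> ?B\<close> by blast
  ultimately have "H' L ` ?B \<subseteq> P" using polygon_facts(4)[OF P] by blast
  then show ?thesis using e(1) by blast
qed

lemma segment_facts: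
  assumes "s \<in> components (L - \<Union>(A - {L}))"
  shows "connected s" "s \<noteq> {}" "s \<subseteq> L" "M \<in> A \<Longrightarrow> M \<noteq> L \<Longrightarrow> s \<inter> M = {}"
    "connected t \<Longrightarrow> t \<subseteq> L \<Longrightarrow> t \<inter> \<Union>(A - {L}) = {} \<Longrightarrow> s \<inter> t \<noteq> {} \<Longrightarrow> t \<subseteq> s"
proof -
  show "connected s" "s \<noteq> {}" using assms in_components_connected in_components_nonempty by auto
  have sub: "s \<subseteq> L - \<Union>(A - {L})" using assms by (rule in_components_subset)
  show "s \<subseteq> L" using sub by auto
  show "s \<inter> M = {}" if "M \<in> A" "M \<noteq> L" using sub that by auto
  show "t \<subseteq> s" if "connected t" "t \<subseteq> L" "t \<inter> \<Union>(A - {L}) = {}" "s \<inter> t \<noteq> {}"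
  proof (rule components_maximal[OF assms that(1) _ that(4)])
    show "t \<subseteq> L - \<Union>(A - {L})" using that(2,3) by auto
  qed
qed

lemma frontier_polygon: "P \<in> arr_polygons A \<Longrightarrow> frontier P = closure P - P"
  unfolding frontier_def using polygon_open by (simp add: interior_open)

text \<open>The part of \<open>s\<close> in \<open>closure P\<close> is closed in \<open>s\<close>,
  and by the half-disc property it is also open; as \<open>s\<close> is connected, one point
  suffices.\<close>

lemma segment_in_frontier:
  assumes P: "P \<in> arr_polygons A" and L: "L \<in> A" and s: "s \<in> components (L - \<Union>(A - {L}))"
    and p: "p \<in> s" "p \<in> closure P"
  shows "s \<subseteq> frontier P"
proof -
  obtain x where x: "x \<in> P" using polygon_facts(2)[OF P] by blast
  have hx: "H L x $ 2 \<noteq> 0" using polygon_facts(3)[OF P L] mem_line[OF L] x by blast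
  have open_part: "openin (top_of_set s) (s \<inter> closure P)"
  proof (subst openin_subopen, intro ballI)
    fix y assume y: "y \<in> s \<inter> closure P"
    have yL: "y \<in> L" "y \<notin> \<Union>(A - {L})" using y segment_facts(3,4)[OF s] by auto
    obtain e where e: "e > 0" "\<And>q. q \<in> ball (H L y) e \<Longrightarrow> 0 < q $ 2 * H L x $ 2 \<Longrightarrow> H' L q \<in> P"
      using half_disc[OF P L yL _ x] y by blast
    let ?W = "H' L ` ball (H L y) e"
    let ?B = "{q \<in> ball (H L y) e. 0 < q $ 2 * H L x $ 2}"
    have "open ?W" using homeomorphism_open_image[of "H' L" "H L"] homeo[OF L] by (simp add: homeomorphism_symD)
    moreover have "y \<in> ?W" using e(1) L by (metis H_inv(2) centre_in_ball imageI)
    moreover have "s \<inter> ?W \<subseteq> closure P"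
    proof
      fix w assume w: "w \<in> s \<inter> ?W"
      then have "H L w \<in> ball (H L y) e" using L by auto
      moreover have "H L w $ 2 = 0" using w segment_facts(3)[OF s] mem_line[OF L] by blast
      ultimately have "H L w \<in> closure ?B" using closure_signed_ball hx by blast
      moreover have "H' L ` closure ?B \<subseteq> closure P"
      proof (rule image_closure_subset[OF cont_H'[OF L] closed_closure])
        show "H' L ` ?B \<subseteq> closure P"
        proof (rule image_subsetI)
          fix q assume "q \<in> ?B"
          then have "H' L q \<in> P" using e(2)[of q] by simp
          then show "H' L q \<in> closure P" using closure_subset by (rule rev_subsetD)
        qed
      qed
      ultimately have "H' L (H L w) \<in> closure P" by blast
      then show "w \<in> closure P" using L by simp
    qed
    ultimately show "\<exists>T. openin (top_of_set s) T \<and> y \<in> T \<and> T \<subseteq> s \<inter> closure P"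
      using y openin_open_Int[of ?W s] by blast
  qed
  have "closedin (top_of_set s) (s \<inter> closure P)" by (rule closedin_closed_Int) (rule closed_closure)
  then have "s \<inter> closure P = {} \<or> s \<inter> closure P = s"
    using connected_clopen[THEN iffD1, OF segment_facts(1)[OF s], THEN spec[of _ "s \<inter> closure P"]] open_part by blast
  then have "s \<subseteq> closure P" using p by blast
  moreover have "s \<inter> P = {}" using polygon_facts(3)[OF P L] segment_facts(3)[OF s] by blast
  ultimately show ?thesis using frontier_polygon[OF P] by blast
qed

text \<open>A quarter of the chart at the crossing lies in \<open>P\<close>. The half-axis of
  \<open>M\<close> that bounds this quarter is part of one segment of \<open>M\<close>, which
  therefore lies in the frontier and ends at the crossing.\<close>

lemma vertex_segment:
  assumes P: "P \<in> arr_polygons A" and L: "L \<in> A" and M: "M \<in> A" and ne: "L \<noteq> M" and v: "cr L M \<in> closure P"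
  shows "\<exists>s \<in> components (M - \<Union>(A - {M})). s \<subseteq> frontier P \<and> cr L M \<in> closure s"
proof -
  have "open (- \<Union>(A - {L, M}))" using closed_lines[of "A - {L, M}"] by (auto simp: open_Compl)
  moreover have "cr L M \<in> - \<Union>(A - {L, M})" using cr(3)[OF L M ne] by auto
  ultimately obtain f g e where c: "e > 0" "continuous_on (ball (0 :: plane) e) g" "g 0 = cr L M"
    "g ` ball 0 e \<subseteq> - \<Union>(A - {L, M})" "open (g ` ball 0 e)"
    "\<And>q. q \<in> ball 0 e \<Longrightarrow> f (g q) = (q :: plane)"
    "\<And>q. q \<in> ball 0 e \<Longrightarrow> g q \<in> L \<longleftrightarrow> q $ 2 = 0" "\<And>q. q \<in> ball 0 e \<Longrightarrow> g q \<in> M \<longleftrightarrow> q $ 1 = 0"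
    using transversal_chart[OF cr(2)[OF L M ne]] by metis
  have "cr L M \<in> g ` ball 0 e" using c(1,3) by (metis centre_in_ball imageI)
  then have "g ` ball 0 e \<inter> P \<noteq> {}" using c(5) v by (metis Int_commute closure_iff_nhds_not_empty order_refl)
  then obtain z where z: "z \<in> ball 0 e" "g z \<in> P" by blast
  have z0: "z $ 1 \<noteq> 0" "z $ 2 \<noteq> 0" using c(7,8)[OF z(1)] z(2) polygon_facts(3)[OF P] L M by blast+
  let ?Q = "{q \<in> ball (0 :: plane) e. 0 < q $ 1 * z $ 1 \<and> 0 < q $ 2 * z $ 2}"
  let ?B = "{q \<in> ball (0 :: plane) e. q $ 1 = 0 \<and> 0 < q $ 2 * z $ 2}"
  have others: "g q \<notin> N" if "q \<in> ball 0 e" "N \<in> A" "N \<noteq> L" "N \<noteq> M" for q N using c(4) that by blast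
  have sub: "continuous_on ?Q g" "continuous_on ?B g" using c(2) by (auto intro: continuous_on_subset)
  have QP: "g ` ?Q \<subseteq> P"
  proof (rule polygon_facts(4)[OF P])
    show "connected (g ` ?Q)" using sub by (intro connected_continuous_image convex_connected convex_signed_ball)
    show "g ` ?Q \<inter> \<Union>A = {}" using others c(7,8) by fastforce
    have "z \<in> ?Q" using z z0 by (simp add: zero_less_mult_iff) linarith
    then show "P \<inter> g ` ?Q \<noteq> {}" using z(2) by blast
  qed
  have con: "connected (g ` ?B)" using sub by (intro connected_continuous_image convex_connected convex_signed_ball)
  have BM: "g ` ?B \<subseteq> M" using c(8) by auto
  have Bo: "g ` ?B \<inter> \<Union>(A - {M}) = {}" using others c(7) by fastforce
  \<comment> \<open>\<open>b\<close> runs along the half-axis next to the quarter of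
    \<open>z\<close>: its value at 1/2 is a point of the segment in \<open>closure P\<close>, and
    its limit at 0 is the crossing.\<close>
  define b where "b t = pt 0 (t * sgn (z $ 2) * e)" for t
  have b: "b t \<in> ?B" if "0 < t" "t < 1" for t
    using that c(1) z0 unfolding b_def by (auto simp: dist_norm norm_pt_vertical abs_mult sgn_if zero_less_mult_iff)
  have "g (b (1/2)) \<in> M - \<Union>(A - {M})" using BM Bo b[of "1/2"] by auto
  then obtain s where s: "s \<in> components (M - \<Union>(A - {M}))" "g (b (1/2)) \<in> s"
    using Union_components[of "M - \<Union>(A - {M})"] by blast
  have Bs: "g ` ?B \<subseteq> s"   proof (rule segment_facts(5)[OF s(1) con BM Bo])
    have "b (1/2) \<in> ?B" by (rule b) auto
    then show "s \<inter> g ` ?B \<noteq> {}" using s(2) by blast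
  qed
  have "b (1/2) \<in> closure ?Q"
    unfolding closure_approachable
  proof (intro allI impI)
    fix \<epsilon> :: real assume "\<epsilon> > 0"
    define r where "r = min \<epsilon> (e - norm (b (1/2))) / 2"
    have nb: "norm (b (1/2)) < e" using b[of "1/2"] by (simp add: dist_norm)
    have r: "r > 0" "r < \<epsilon>" "r < e - norm (b (1/2))" using \<open>\<epsilon> > 0\<close> nb unfolding r_def by auto
    let ?d = "pt (r * sgn (z $ 1)) 0"
    have nd: "norm ?d = r" using r z0 by (simp add: pt_def norm_axis_1 abs_mult sgn_if)
    have "norm (b (1/2) + ?d) < e" using norm_triangle_ineq[of "b (1/2)" ?d] nd r by linarith
    moreover have "0 < (b (1/2) + ?d) $ 1 * z $ 1" "0 < (b (1/2) + ?d) $ 2 * z $ 2"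
      using r z0 c(1) unfolding b_def by (auto simp: sgn_if zero_less_mult_iff)
    ultimately have "b (1/2) + ?d \<in> ?Q" by (simp add: dist_norm)
    then show "\<exists>y\<in>?Q. dist y (b (1/2)) < \<epsilon>" using nd r by (intro bexI[of _ "b (1/2) + ?d"]) (auto simp: dist_norm)
  qed
  moreover have "b (1/2) \<in> ball 0 e" using b[of "1/2"] by simp
  ultimately have "g (b (1/2)) \<in> closure (g ` ?Q)"
  proof -
    assume cl: "b (1/2) \<in> closure ?Q" and bb: "b (1/2) \<in> ball 0 e"
    have "continuous (at (b (1/2))) g" using c(2) bb by (simp add: continuous_on_eq_continuous_at)
    moreover obtain w where "\<And>k. w k \<in> ?Q" "w \<longlonglongrightarrow> b (1/2)" using cl unfolding closure_sequential by blast
    ultimately have "\<And>k. (g \<circ> w) k \<in> g ` ?Q" "(g \<circ> w) \<longlonglongrightarrow> g (b (1/2))"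
      unfolding continuous_at_sequentially by auto
    then show ?thesis unfolding closure_sequential by blast
  qed
  then have "g (b (1/2)) \<in> closure P" using closure_mono[OF QP] by blast
  then have "s \<subseteq> frontier P" using segment_in_frontier[OF P M s(1) s(2)] by blast
  moreover have "cr L M \<in> closure s"
  proof -
    \<comment> \<open>Two successors keep the parameter strictly below 1, where \<open>b\<close>
      stays inside the ball.\<close>
    have lim: "(\<lambda>k. b (1 / real (Suc (Suc k)))) \<longlonglongrightarrow> 0"
    proof -
      have "(\<lambda>k. (1 / real (Suc (Suc k)))) \<longlonglongrightarrow> 0"
        using LIMSEQ_Suc[OF LIMSEQ_Suc[OF lim_1_over_n]] by simp
      then have "(\<lambda>k. pt 0 ((1 / real (Suc (Suc k))) * sgn (z $ 2) * e)) \<longlonglongrightarrow> pt 0 (0 * sgn (z $ 2) * e)"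
        unfolding pt_def by (intro tendsto_intros)
      moreover have "pt 0 (0 * sgn (z $ 2) * e) = 0" by (simp add: pt_def)
      ultimately show ?thesis unfolding b_def by simp
    qed
    have "continuous (at 0) g" using c(1,2) by (simp add: continuous_on_eq_continuous_at)
    then have "(\<lambda>k. g (b (1 / real (Suc (Suc k))))) \<longlonglongrightarrow> g 0"
      using lim by (simp add: continuous_at_sequentially comp_def)
    moreover have "g (b (1 / real (Suc (Suc k)))) \<in> s" for k
    proof -
      have "b (1 / real (Suc (Suc k))) \<in> ?B" by (rule b) auto
      then show ?thesis using Bs by blast
    qed
    ultimately show ?thesis unfolding closure_sequential c(3)[symmetric]
      by (intro exI[of _ "\<lambda>k. g (b (1 / real (Suc (Suc k))))"]) simp
  qed
  ultimately show ?thesis by (intro bexI[OF _ s(1)] conjI)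
qed

text \<open>If the image were bounded, \<open>H L\<close> would map its compact closure to a bounded
  set, whose first coordinates include all of \<open>T\<close>.\<close>

lemma ray_unbounded:
  assumes L: "L \<in> A" and T: "\<not> bounded T"
  shows "\<not> bounded (path L ` T)"
proof
  assume "bounded (path L ` T)"
  then have "compact (H L ` closure (path L ` T))"
    using L by (intro compact_continuous_image cont_H) auto
  then have "bounded (H L ` (path L ` T))"
    by (meson bounded_subset closure_subset compact_imp_bounded image_mono)
  then have "bounded ((\<lambda>q. q $ 1) ` (H L ` (path L ` T)))" by (rule bounded_component_cart)
  moreover have "(\<lambda>q. q $ 1) ` (H L ` (path L ` T)) = T" using L by (simp add: image_image path_coord)
  ultimately show False using T by simp
qed

text \<open>From a point of the segment, take the nearest crossing in each direction. If one were
  missing, a whole ray of \<open>L\<close> would belong to the segment, which would then be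
  unbounded.\<close>

lemma bounded_segment:
  assumes L: "L \<in> A" and s: "s \<in> components (L - \<Union>(A - {L}))" and bd: "bounded s"
  obtains M K where "M \<in> A" "K \<in> A" "distinct [L, M, K]" "adjacent_on L M K" "par L M < par L K"
    "s = path L ` {par L M<..<par L K}" "cr L M \<in> closure s" "cr L K \<in> closure s"
proof -
  obtain p where p: "p \<in> s" using segment_facts(2)[OF s] by blast
  define t where "t = H L p $ 1"
  have pt: "path L t = p" using path_of[OF L] p segment_facts(3)[OF s] unfolding t_def by blast
  have tne: "par L M \<noteq> t" if "M \<in> A" "M \<noteq> L" for M
    using path_mem_other[OF L that(1)] that pt segment_facts(4)[OF s that] p by blast
  have grow: "path L ` T \<subseteq> s" if T: "connected T" "t \<in> T" "\<And>M. M \<in> A - {L} \<Longrightarrow> par L M \<notin> T" for T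
  proof (rule segment_facts(5)[OF s])
    show "connected (path L ` T)" using T by (intro connected_continuous_image cont_path L)
    show "path L ` T \<subseteq> L" using path_in[OF L] by auto
    show "path L ` T \<inter> \<Union>(A - {L}) = {}" using path_mem_other[OF L] T(3) by fastforce
    show "s \<inter> path L ` T \<noteq> {}" using p pt T(2) by blast
  qed
  let ?up = "{M \<in> A - {L}. t < par L M}" and ?dn = "{M \<in> A - {L}. par L M < t}"
  have "?up \<noteq> {}"
  proof
    assume e: "?up = {}"
    have "path L ` {t..} \<subseteq> s" using e tne by (intro grow) force+
    moreover have "\<not> bounded {t..}"
    proof
      assume "bounded {t..}"
      then obtain B where "\<forall>x\<in>{t..}. \<bar>x\<bar> \<le> B" by (auto simp: bounded_iff)
      then have "\<bar>max t (B + 1)\<bar> \<le> B" by (metis atLeast_iff max.cobounded1)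
      then show False by linarith
    qed
    ultimately show False using ray_unbounded[OF L] bd bounded_subset by blast
  qed
  have "?dn \<noteq> {}"
  proof
    assume e: "?dn = {}"
    have "path L ` {..t} \<subseteq> s" using e tne by (intro grow) force+
    moreover have "\<not> bounded {..t}"
    proof
      assume "bounded {..t}"
      then obtain B where "\<forall>x\<in>{..t}. \<bar>x\<bar> \<le> B" by (auto simp: bounded_iff)
      then have "\<bar>min t (- B - 1)\<bar> \<le> B" by (metis atMost_iff min.cobounded1)
      then show False by linarith
    qed
    ultimately show False using ray_unbounded[OF L] bd bounded_subset by blast
  qed
  have fin2: "finite ?up" "finite ?dn" using fin by auto
  have "Min (par L ` ?up) \<in> par L ` ?up" "Max (par L ` ?dn) \<in> par L ` ?dn"
    using fin2 \<open>?up \<noteq> {}\<close> \<open>?dn \<noteq> {}\<close> by (intro Min_in Max_in; simp)+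
  then obtain K M where KM: "K \<in> ?up" "Min (par L ` ?up) = par L K" "M \<in> ?dn" "Max (par L ` ?dn) = par L M" by blast
  have K: "K \<in> ?up" "\<And>J. J \<in> ?up \<Longrightarrow> par L K \<le> par L J"
    using KM(1) Min_le[of "par L ` ?up"] fin2 unfolding KM(2)[symmetric] by blast+
  have M: "M \<in> ?dn" "\<And>J. J \<in> ?dn \<Longrightarrow> par L J \<le> par L M"
    using KM(3) Max_ge[of "par L ` ?dn"] fin2 unfolding KM(4)[symmetric] by blast+
  let ?I = "{par L M<..<par L K}"
  have MK: "M \<in> A" "K \<in> A" "distinct [L, M, K]" "par L M < par L K" using M(1) K(1) by auto
  have noI: "par L J \<notin> ?I" if "J \<in> A - {L}" for J
    using tne[of J] K(2)[of J] M(2)[of J] that by (cases "par L J < t") force+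
  have "adjacent_on L M K" unfolding adjacent_on_def using noI MK by auto
  moreover have sI: "s = path L ` ?I"
  proof
    show "path L ` ?I \<subseteq> s" using M(1) K(1) noI by (intro grow) auto
    show "s \<subseteq> path L ` ?I"
    proof
      fix y assume y: "y \<in> s"
      let ?c = "(\<lambda>p. H L p $ 1) ` s"
      have con: "connected ?c" using segment_facts(1)[OF s] cont_H[OF L] by (intro connected_continuous_image continuous_intros)
      have notin: "par L J \<notin> ?c" if "J \<in> A" "J \<noteq> L" for J
      proof
        assume "par L J \<in> ?c"
        then obtain w where w: "w \<in> s" "H L w $ 1 = par L J" by auto
        then have "w = path L (par L J)" using path_of[OF L] segment_facts(3)[OF s] by (metis subsetD)
        then have "w \<in> J" using path_mem_other[OF L that(1)] that by blast
        then show False using w segment_facts(4)[OF s that] by blast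
      qed
      have yc: "H L y $ 1 \<in> ?c" "t \<in> ?c" using y p unfolding t_def by auto
      have "par L M < H L y $ 1"
      proof (rule ccontr)
        assume "\<not> par L M < H L y $ 1"
        then have "par L M \<in> ?c" using connectedD_interval[OF con yc, of "par L M"] M(1) by auto
        then show False using notin M(1) by auto
      qed
      moreover have "H L y $ 1 < par L K"
      proof (rule ccontr)
        assume "\<not> H L y $ 1 < par L K"
        then have "par L K \<in> ?c" using connectedD_interval[OF con yc(2,1), of "par L K"] K(1) by auto
        then show False using notin K(1) by auto
      qed
      moreover have "y = path L (H L y $ 1)" using path_of[OF L] segment_facts(3)[OF s] y by (metis subsetD)
      ultimately show "y \<in> path L ` ?I" by (metis greaterThanLessThan_iff imageI)
    qed
  qed
  moreover have "path L ` closure ?I \<subseteq> closure s"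
    unfolding sI by (rule image_closure_subset) (rule cont_path[OF L], rule closed_closure, rule closure_subset)
  then have "path L (par L M) \<in> closure s" "path L (par L K) \<in> closure s"
    using MK(4) by (auto simp: closure_greaterThanLessThan)
  ultimately show thesis using that[of M K] MK path_par[OF L] by auto
qed

end

section \<open>From triangles to triples of lines\<close>

context straightened_arrangement
begin

lemma segment_line_unique:
  assumes "s \<in> components (L - \<Union>(A - {L}))" "s \<subseteq> M" "M \<in> A"
  shows "L = M"
  using segment_facts(2,4)[OF assms(1)] assms(2,3) by blast

text \<open>Taking the closure adds nothing beyond the two end crossings, and no crossing lies on
  the open segment; so \<open>L\<close> passes through one end, and \<open>J\<close> is the line
  through the other.\<close>

lemma segment_other_end:
  assumes M: "M \<in> A" and s: "s \<in> components (M - \<Union>(A - {M}))" "bounded s"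
    and L: "L \<in> A" "L \<noteq> M" "cr L M \<in> closure s"
  obtains J where "J \<in> A" "distinct [L, M, J]" "adjacent_on M L J" "cr M J \<in> closure s"
proof -
  obtain B C where BC: "B \<in> A" "C \<in> A" "distinct [M, B, C]" "adjacent_on M B C" "par M B < par M C"
    "s = path M ` {par M B<..<par M C}" "cr M B \<in> closure s" "cr M C \<in> closure s"
    using bounded_segment[OF M s] by metis
  have "closure s \<subseteq> path M ` {par M B..par M C}"
  proof (rule closure_minimal)
    show "s \<subseteq> path M ` {par M B..par M C}" unfolding BC(6) by auto
    show "closed (path M ` {par M B..par M C})"
      by (intro compact_imp_closed compact_continuous_image cont_path M) simp
  qed
  then obtain t where t: "t \<in> {par M B..par M C}" "cr L M = path M t" using L(3) by blast
  have "path M t \<in> L" using t(2) cr_in[OF L(1) M L(2)] by simp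
  then have tL: "t = par M L" using path_mem_other[OF M L(1)] L(2) by blast
  have "par M L \<notin> {par M B<..<par M C}"
  proof
    assume "par M L \<in> {par M B<..<par M C}"
    then have "cr L M \<in> s" unfolding BC(6) t(2) tL by blast
    then show False using segment_facts(4)[OF s(1) L(1,2)] cr_in[OF L(1) M L(2)] by blast
  qed
  then have "par M L = par M B \<or> par M L = par M C" using t(1) tL by auto
  then have "L = B \<or> L = C" using inj_onD[OF par_inj[OF M]] L BC(1-3) by auto
  then show thesis
  proof
    assume "L = B"
    then show thesis using that[of C] BC by auto
  next
    assume "L = C"
    then show thesis using that[of B] BC adjacent_on_sym by auto
  qed
qed

definition lines_of :: "plane set \<Rightarrow> plane set set" where
  "lines_of P = {J \<in> A. \<exists>s\<in>bounding_segments A P. s \<subseteq> J}"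

text \<open>The two ends of a side on \<open>L\<close> are vertices; each yields a side on the other
  line through it, and these make up all three sides. The far end of the side on \<open>M\<close> is
  again a vertex, so the second line through it carries a side too and can only be
  \<open>K\<close>.\<close>

lemma triangle_sides:
  assumes P: "P \<in> bounded_triangles A" and L: "L \<in> A" and s: "s \<in> components (L - \<Union>(A - {L}))" "s \<subseteq> frontier P"
  obtains M K where "M \<in> A" "K \<in> A" "distinct [L, M, K]" "s = path L ` {par L M<..<par L K}" "par L M < par L K"
    "adjacent_on L M K" "adjacent_on M L K" "adjacent_on K L M" "cr M K \<in> closure P" "lines_of P = {L, M, K}"
proof -
  let ?B = "bounding_segments A P"
  have poly: "P \<in> arr_polygons A" and c3: "card ?B = 3" and bd: "\<And>s. s \<in> ?B \<Longrightarrow> bounded s"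
    using P unfolding bounded_triangles_def by auto
  have inB: "s \<in> ?B" if "M \<in> A" "s \<in> components (M - \<Union>(A - {M}))" "s \<subseteq> frontier P" for s M
    using that unfolding bounding_segments_def arr_segments_def by blast
  have clP: "closure s \<subseteq> closure P" if "s \<subseteq> frontier P" for s
    using that frontier_polygon[OF poly] by (metis Diff_subset closure_closure closure_mono order_trans)
  have sB: "s \<in> ?B" using inB[OF L s] .
  obtain M K where MK: "M \<in> A" "K \<in> A" "distinct [L, M, K]" "adjacent_on L M K" "par L M < par L K"
    "s = path L ` {par L M<..<par L K}" "cr L M \<in> closure s" "cr L K \<in> closure s"
    using bounded_segment[OF L s(1) bd[OF sB]] by metis
  have vM: "cr L M \<in> closure P" and vK: "cr L K \<in> closure P" using clP[OF s(2)] MK by auto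
  obtain sM where sM: "sM \<in> components (M - \<Union>(A - {M}))" "sM \<subseteq> frontier P" "cr L M \<in> closure sM"
    using vertex_segment[OF poly L MK(1) _ vM] MK(3) by auto
  obtain sK where sK: "sK \<in> components (K - \<Union>(A - {K}))" "sK \<subseteq> frontier P" "cr L K \<in> closure sK"
    using vertex_segment[OF poly L MK(2) _ vK] MK(3) by auto
  have sMB: "sM \<in> ?B" and sKB: "sK \<in> ?B" using inB MK(1,2) sM(1,2) sK(1,2) by blast+
  have d: "s \<noteq> sM" "s \<noteq> sK" "sM \<noteq> sK"
    using segment_line_unique[OF s(1), of M] segment_line_unique[OF s(1), of K] segment_line_unique[OF sM(1), of K]
      segment_facts(3)[OF sM(1)] segment_facts(3)[OF sK(1)] MK(1-3) by auto
  have B: "?B = {s, sM, sK}"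
  proof (rule card_subset_eq[symmetric])
    show "finite ?B" using c3 by (intro card_ge_0_finite) simp
    show "{s, sM, sK} \<subseteq> ?B" using sB sMB sKB by auto
    show "card {s, sM, sK} = card ?B" using c3 d by simp
  qed
  have lines: "J = L \<or> J = M \<or> J = K" if J: "J \<in> A" "s' \<in> ?B" "s' \<subseteq> J" for J s'
    using J segment_line_unique[OF s(1), of J] segment_line_unique[OF sM(1), of J] segment_line_unique[OF sK(1), of J]
    unfolding B by auto
  have lines2: "J = L \<or> J = M \<or> J = K" if J: "J \<in> A" "N \<in> A" "N \<noteq> J" "cr N J \<in> closure P" for J N
  proof -
    obtain s' where "s' \<in> components (J - \<Union>(A - {J}))" "s' \<subseteq> frontier P"
      using vertex_segment[OF poly J(2,1,3,4)] by auto
    then show ?thesis using lines[of J s'] inB[OF J(1)] segment_facts(3) J(1) by blast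
  qed
  obtain J where J: "J \<in> A" "distinct [L, M, J]" "adjacent_on M L J" "cr M J \<in> closure sM"
    using segment_other_end[OF MK(1) sM(1) bd[OF sMB] L _ sM(3)] MK(3) by auto
  have JK: "J = K" using lines2[of J M] J MK clP[OF sM(2)] by auto
  obtain J' where J': "J' \<in> A" "distinct [L, K, J']" "adjacent_on K L J'" "cr K J' \<in> closure sK"
    using segment_other_end[OF MK(2) sK(1) bd[OF sKB] L _ sK(3)] MK(3) by auto
  have JM: "J' = M" using lines2[of J' K] J' MK clP[OF sK(2)] by auto
  have "lines_of P = {L, M, K}"
    unfolding lines_of_def using lines L MK(1,2) sB sMB sKB segment_facts(3)[OF s(1)] segment_facts(3)[OF sM(1)] segment_facts(3)[OF sK(1)]
    by blast
  moreover have "cr M K \<in> closure P" using J(4) JK clP[OF sM(2)] by auto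
  ultimately show thesis using that[of M K] MK J(3) J'(3) JK JM by blast
qed

lemma bounding_segment_line:
  assumes "s \<in> bounding_segments A P"
  obtains L where "L \<in> A" "s \<in> components (L - \<Union>(A - {L}))" "s \<subseteq> frontier P"
  using assms unfolding bounding_segments_def arr_segments_def by blast

lemma lines_of_triples: "P \<in> bounded_triangles A \<Longrightarrow> lines_of P \<in> triples"
proof -
  assume P: "P \<in> bounded_triangles A"
  then have "bounding_segments A P \<noteq> {}" unfolding bounded_triangles_def by auto
  then obtain s where "s \<in> bounding_segments A P" by blast
  then obtain L where L: "L \<in> A" "s \<in> components (L - \<Union>(A - {L}))" "s \<subseteq> frontier P"
    by (rule bounding_segment_line)
  obtain M K where "M \<in> A" "K \<in> A" "distinct [L, M, K]" "s = path L ` {par L M<..<par L K}" "par L M < par L K"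
    "adjacent_on L M K" "adjacent_on M L K" "adjacent_on K L M" "cr M K \<in> closure P" "lines_of P = {L, M, K}"
    by (rule triangle_sides[OF P L])
  then show ?thesis using L(1) unfolding triples_def by blast
qed

lemma closure_polygon_sign:
  assumes P: "P \<in> arr_polygons A" and L: "L \<in> A" and v: "v \<in> closure P" "v \<notin> L" and x: "x \<in> P"
  shows "0 < H L v $ 2 * H L x $ 2"
proof -
  let ?W = "{w. 0 < H L w $ 2 * H L v $ 2}"
  have v0: "H L v $ 2 \<noteq> 0" using mem_line[OF L] v(2) by blast
  have "open ?W" by (intro open_Collect_less continuous_intros cont_height L)
  moreover have "v \<in> ?W" using v0 by (simp add: zero_less_mult_iff) linarith
  ultimately have "P \<inter> ?W \<noteq> {}" using v(1) unfolding closure_iff_nhds_not_empty by blast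
  then obtain z where z: "z \<in> P" "0 < H L z $ 2 * H L v $ 2" by blast
  then show ?thesis using polygon_sign[OF P L z(1) x] by (auto simp: zero_less_mult_iff)
qed

text \<open>The three lines determine the side on \<open>L\<close>, and the opposite vertex
  determines on which side of \<open>L\<close> the triangle lies. Two such triangles share points
  next to the middle of that side, hence are the same component.\<close>

lemma lines_of_inj:
  assumes P: "P \<in> bounded_triangles A" and Q: "Q \<in> bounded_triangles A" and eq: "lines_of P = lines_of Q"
  shows "P = Q"
proof -
  have poly: "P \<in> arr_polygons A" "Q \<in> arr_polygons A" using P Q unfolding bounded_triangles_def by auto
  have "bounding_segments A P \<noteq> {}" using P unfolding bounded_triangles_def by auto
  then obtain s where sB: "s \<in> bounding_segments A P" by blast
  then obtain L where L: "L \<in> A" "s \<in> components (L - \<Union>(A - {L}))" "s \<subseteq> frontier P"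
    by (rule bounding_segment_line)
  obtain M K where MK: "M \<in> A" "K \<in> A" "distinct [L, M, K]" "s = path L ` {par L M<..<par L K}" "par L M < par L K"
    "adjacent_on L M K" "adjacent_on M L K" "adjacent_on K L M" "cr M K \<in> closure P" "lines_of P = {L, M, K}"
    by (rule triangle_sides[OF P L])
  have "L \<in> lines_of Q" using MK(10) eq by auto
  then obtain s' where s': "s' \<in> bounding_segments A Q" "s' \<subseteq> L" unfolding lines_of_def by blast
  obtain L' where L': "L' \<in> A" "s' \<in> components (L' - \<Union>(A - {L'}))" "s' \<subseteq> frontier Q"
    using bounding_segment_line[OF s'(1)] by blast
  have LL: "L' = L" using segment_line_unique[OF L'(2) s'(2) L(1)] .
  obtain M' K' where MK': "M' \<in> A" "K' \<in> A" "distinct [L, M', K']" "s' = path L ` {par L M'<..<par L K'}" "par L M' < par L K'"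
    "adjacent_on L M' K'" "adjacent_on M' L K'" "adjacent_on K' L M'" "cr M' K' \<in> closure Q" "lines_of Q = {L, M', K'}"
    by (rule triangle_sides[OF Q L'[unfolded LL]])
  have "{L, M, K} = {L, M', K'}" using MK(10) MK'(10) eq by simp
  then have "M \<in> {L, M', K'}" "K \<in> {L, M', K'}" by blast+
  then have same: "M' = M" "K' = K" using MK(3,5) MK'(3,5) by auto
  define p where "p = path L ((par L M + par L K) / 2)"
  have ps: "p \<in> s" unfolding p_def MK(4) by (rule imageI) (use MK(5) in auto)
  have ps': "p \<in> s'" using ps MK(4) MK'(4) same by simp
  have pc: "p \<in> closure P" "p \<in> closure Q" using ps ps' L(3) L'(3) frontier_polygon[OF poly(1)] frontier_polygon[OF poly(2)] by auto
  have pL: "p \<in> L" "p \<notin> \<Union>(A - {L})" using ps segment_facts(3,4)[OF L(2)] by auto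
  obtain x y where xy: "x \<in> P" "y \<in> Q" using polygon_facts(2)[OF poly(1)] polygon_facts(2)[OF poly(2)] by blast
  have notL: "cr M K \<notin> L" using cr(3)[OF MK(1,2) _ L(1)] MK(3) by auto
  have "0 < H L (cr M K) $ 2 * H L x $ 2" "0 < H L (cr M K) $ 2 * H L y $ 2"
    using closure_polygon_sign[OF poly(1) L(1) MK(9) notL xy(1)] closure_polygon_sign[OF poly(2) L(1) _ notL xy(2)] MK'(9) same by auto
  then have sgn: "0 < q * H L x $ 2 \<longleftrightarrow> 0 < q * H L y $ 2" for q by (auto simp: zero_less_mult_iff)
  obtain e1 where e1: "e1 > 0" "\<And>q. q \<in> ball (H L p) e1 \<Longrightarrow> 0 < q $ 2 * H L x $ 2 \<Longrightarrow> H' L q \<in> P"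
    using half_disc[OF poly(1) L(1) pL pc(1) xy(1)] by blast
  obtain e2 where e2: "e2 > 0" "\<And>q. q \<in> ball (H L p) e2 \<Longrightarrow> 0 < q $ 2 * H L y $ 2 \<Longrightarrow> H' L q \<in> Q"
    using half_disc[OF poly(2) L(1) pL pc(2) xy(2)] by blast
  have hx: "H L x $ 2 \<noteq> 0" using polygon_facts(3)[OF poly(1) L(1)] mem_line[OF L(1)] xy by blast
  define r where "r = min e1 e2 / 2"
  have r: "r > 0" "r < e1" "r < e2" using e1(1) e2(1) unfolding r_def by auto
  let ?q = "H L p + pt 0 (r * sgn (H L x $ 2))"
  have "dist (H L p) ?q = r" using r hx by (simp add: dist_norm norm_pt_vertical abs_mult sgn_if)
  moreover have "0 < ?q $ 2 * H L x $ 2"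
    using mem_line[OF L(1), of p] pL(1) r hx by (simp add: sgn_if zero_less_mult_iff)
  ultimately have "H' L ?q \<in> P \<inter> Q" using e1(2)[of ?q] e2(2)[of ?q] r sgn[of "?q $ 2"] by auto
  then show ?thesis using poly components_nonoverlap[of P "- \<Union>A" Q] unfolding arr_polygons_def by auto
qed

lemma lines_of_inj_on: "inj_on lines_of (bounded_triangles A)"
  using lines_of_inj by (intro inj_onI)

lemma lines_of_image: "lines_of ` bounded_triangles A \<subseteq> triples"
  using lines_of_triples by blast

lemma finite_bounded_triangles: "finite (bounded_triangles A)"
  using inj_on_finite[OF lines_of_inj_on lines_of_image finite_triples] .

lemma a3_le_triples: "a3 A \<le> card triples"
  unfolding a3_def by (rule card_inj_on_le[OF lines_of_inj_on lines_of_image finite_triples])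

end

section \<open>Rounding and the upper bound\<close>

text \<open>Rounding is carried out only for the residues 1 and 2. For n = 6 q + 1 one has 3 c \<le>
  36 q^2 - 1, and for n = 6 q + 2 one has 6 c \<le> 72 q^2 + 18 q - 2; for an integer c both can be
  sharpened. Writing \<open>Q\<close> for the square of \<open>q\<close> makes this linear.\<close>

lemma bound_by_integrality:
  fixes c n :: nat
  assumes n: "n \<ge> 3" and all: "3 * c \<le> n * (n - 2)" and ev: "even n \<Longrightarrow> 6 * c + n \<le> 2 * (n * (n - 2))"
  shows "real c \<le> a3_bound n"
proof -
  define q where "q = n div 6"
  define Q where "Q = q * q"
  have nq: "int n = 6 * int q + int (n mod 6)" unfolding q_def by presburger
  have int: "int (n * (n - 2)) = int n * (int n - 2)" using n by (simp add: of_nat_diff)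
  have all': "3 * int c \<le> int n * (int n - 2)" using all int by linarith
  have ev': "6 * int c + int n \<le> 2 * (int n * (int n - 2))" if "even n" using ev[OF that] int by linarith
  have rall: "3 * real c \<le> real n * (real n - 2)"
    using all'[THEN of_int_le_iff[where 'a = real, THEN iffD2]] by simp
  consider "n mod 6 \<in> {0, 4}" | "n mod 6 = 1" | "n mod 6 = 2" | "n mod 6 \<notin> {0, 1, 2, 4}" by blast
  then show ?thesis
  proof cases
    case 1
    then have "even n" by (metis empty_iff even_numeral even_zero insert_iff dvd_mod_iff)
    then have "6 * real c + real n \<le> 2 * (real n * (real n - 2))"
      using ev'[THEN of_int_le_iff[where 'a = real, THEN iffD2]] by simp
    then show ?thesis using 1 unfolding a3_bound_def by (simp add: algebra_simps)
  next
    case 2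
    then have nn: "int n = 6 * int q + 1" using nq by simp
    have "int n * (int n - 2) = 36 * int Q - 1" unfolding nn Q_def by (simp add: algebra_simps)
    then have "int c \<le> 12 * int Q - 1" using all' by linarith
    then have "real c \<le> 12 * real Q - 1" by linarith
    moreover have "real n = 6 * real q + 1" using nn by linarith
    ultimately show ?thesis using 2 unfolding a3_bound_def Q_def by (simp add: field_simps)
  next
    case 3
    then have nn: "int n = 6 * int q + 2" using nq by simp
    have "int n * (int n - 2) = 36 * int Q + 12 * int q" unfolding nn Q_def by (simp add: algebra_simps)
    moreover have "even n" using 3 by presburger
    ultimately have "int c \<le> 12 * int Q + 3 * int q - 1" using ev' nn by linarith
    then have "real c \<le> 12 * real Q + 3 * real q - 1" by linarith
    moreover have "real n = 6 * real q + 2" using nn by linarith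
    ultimately show ?thesis using 3 unfolding a3_bound_def Q_def by (simp add: field_simps)
  next
    case 4
    then show ?thesis using rall unfolding a3_bound_def by auto
  qed
qed

lemma simple_arrangement_straightened:
  assumes A: "simple_affine_arrangement n A"
  obtains H H' where "straightened_arrangement n A H H'"
proof -
  have "\<forall>L\<in>A. \<exists>H H'. homeomorphism UNIV UNIV H H' \<and> (\<forall>p. p \<in> L \<longleftrightarrow> (H p :: plane) $ 2 = 0)"
    using A pseudo_line_straighten unfolding simple_affine_arrangement_def by metis
  then obtain H where "\<forall>L\<in>A. \<exists>H'. homeomorphism UNIV UNIV (H L) H' \<and> (\<forall>p. p \<in> L \<longleftrightarrow> (H L p :: plane) $ 2 = 0)"
    by (rule bchoice[THEN exE])
  then obtain H' where H: "\<forall>L\<in>A. homeomorphism UNIV UNIV (H L) (H' L) \<and> (\<forall>p. p \<in> L \<longleftrightarrow> (H L p :: plane) $ 2 = 0)"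
    by (rule bchoice[THEN exE])
  have "straightened_arrangement n A H H'"
    by unfold_locales (use A H in auto)
  then show thesis by (rule that)
qed

lemma finite_triangles: "simple_affine_arrangement n A \<Longrightarrow> finite (bounded_triangles A)"
  by (metis simple_arrangement_straightened straightened_arrangement.finite_bounded_triangles)

lemma a3_upper_bound:
  assumes n: "n \<ge> 3" and A: "simple_affine_arrangement n A"
  shows "real (a3 A) \<le> a3_bound n"
proof -
  obtain H H' where "straightened_arrangement n A H H'" using simple_arrangement_straightened[OF A] .
  then interpret straightened_arrangement n A H H' .
  have "3 * card triples \<le> n * (n - 2)" using triples_plus_unused card_A by simp
  moreover have "6 * card triples + n \<le> 2 * (n * (n - 2))" if "even n"
  proof -
    have "n \<noteq> 3" using that by auto
    then show ?thesis using even_triples_bound card_A n that by simp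
  qed
  ultimately have "real (card triples) \<le> a3_bound n" using bound_by_integrality n by blast
  then show ?thesis using a3_le_triples by linarith
qed

section \<open>Arrangements of graphs of functions\<close>

text \<open>The sign \<open>s\<close>, which is 1 or -1, turns the picture upside down, so that
  triangles above and below their long edge are treated together.\<close>

definition band :: "real \<Rightarrow> real \<Rightarrow> real \<Rightarrow> (real \<Rightarrow> real) \<Rightarrow> (real \<Rightarrow> real) \<Rightarrow> plane set" where
  "band s x1 x2 lo hi = {p. x1 < p $ 1 \<and> p $ 1 < x2 \<and> lo (p $ 1) < s * p $ 2 \<and> s * p $ 2 < hi (p $ 1)}"

lemma continuous_compose_nth:
  fixes f :: "real \<Rightarrow> real"
  assumes "continuous_on UNIV f"
  shows "continuous_on S (\<lambda>p :: plane. f (p $ i))"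
proof -
  have "continuous_on S (f \<circ> (\<lambda>p :: plane. p $ i))"
    by (intro continuous_on_compose continuous_intros continuous_on_subset[OF assms]) auto
  then show ?thesis by (simp add: comp_def)
qed

lemma band_facts:
  assumes s: "s = 1 \<or> s = -1" and x: "x1 < x2"
    and cont: "continuous_on UNIV lo" "continuous_on UNIV hi"
    and less: "\<And>x. x1 < x \<Longrightarrow> x < x2 \<Longrightarrow> lo x < hi x" and ends: "lo x1 = hi x1" "lo x2 = hi x2"
  shows "open (band s x1 x2 lo hi)" "connected (band s x1 x2 lo hi)"
    "(\<lambda>p. p $ 1) ` band s x1 x2 lo hi = {x1<..<x2}"
    "frontier (band s x1 x2 lo hi) = {p. x1 \<le> p $ 1 \<and> p $ 1 \<le> x2 \<and> (s * p $ 2 = lo (p $ 1) \<or> s * p $ 2 = hi (p $ 1))}"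
proof -
  let ?R = "band s x1 x2 lo hi"
  note cn = continuous_compose_nth[OF cont(1)] continuous_compose_nth[OF cont(2)]
  have "s * s = 1" using s by auto
  then have ss: "s * (s * y) = y" for y by (simp add: mult.assoc[symmetric])
  show op: "open ?R" unfolding band_def
    by (intro open_Collect_conj open_Collect_less continuous_intros cn)
  \<comment> \<open>Interpolation between the two graphs maps an open rectangle onto the band and
    the closed rectangle into its closure. As the graphs meet over both ends, there are no vertical
    edges.\<close>
  define \<phi> where "\<phi> z = pt (fst z) (s * (lo (fst z) + snd z * (hi (fst z) - lo (fst z))))" for z :: "real \<times> real"
  have cphi: "continuous_on UNIV \<phi>"
  proof -
    have "continuous_on UNIV (lo \<circ> (fst :: real \<times> real \<Rightarrow> real))" "continuous_on UNIV (hi \<circ> (fst :: real \<times> real \<Rightarrow> real))"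
      by (intro continuous_on_compose continuous_intros continuous_on_subset[OF cont(1)] continuous_on_subset[OF cont(2)]; simp)+
    then show ?thesis unfolding \<phi>_def by (intro continuous_intros) (simp_all add: comp_def)
  qed
  have img: "?R = \<phi> ` ({x1<..<x2} \<times> {0<..<1})"
  proof (intro equalityI subsetI)
    fix p assume p: "p \<in> ?R"
    define d where "d = hi (p $ 1) - lo (p $ 1)"
    define t where "t = (s * p $ 2 - lo (p $ 1)) / d"
    have d: "d > 0" using p unfolding band_def d_def by auto
    have td: "t * d = s * p $ 2 - lo (p $ 1)" using d unfolding t_def by simp
    have "0 < t" using p d unfolding t_def band_def by auto
    moreover have "t < 1" using p d unfolding t_def band_def d_def by auto
    moreover have "p = \<phi> (p $ 1, t)"
      unfolding \<phi>_def plane_eq_iff fst_conv snd_conv pt_nth d_def[symmetric] td by (simp add: ss)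
    ultimately show "p \<in> \<phi> ` ({x1<..<x2} \<times> {0<..<1})" using p unfolding band_def by auto
  next
    fix p assume "p \<in> \<phi> ` ({x1<..<x2} \<times> {0<..<1})"
    then obtain x t where xt: "x1 < x" "x < x2" "0 < t" "t < 1" "p = \<phi> (x, t)" by auto
    have d: "0 < hi x - lo x" using less[OF xt(1,2)] by simp
    have "0 < t * (hi x - lo x)" "t * (hi x - lo x) < 1 * (hi x - lo x)"
      using xt d by (simp, intro mult_strict_right_mono) auto
    moreover have "s * p $ 2 = lo x + t * (hi x - lo x)" "p $ 1 = x"
      unfolding xt(5) \<phi>_def fst_conv snd_conv pt_nth by (rule ss, rule refl)
    ultimately show "p \<in> ?R" using xt unfolding band_def by simp
  qed
  show "connected ?R" unfolding img
    by (intro connected_continuous_image connected_Times continuous_on_subset[OF cphi]) auto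
  show "(\<lambda>p. p $ 1) ` ?R = {x1<..<x2}"
  proof
    show "(\<lambda>p. p $ 1) ` ?R \<subseteq> {x1<..<x2}" unfolding band_def by auto
    show "{x1<..<x2} \<subseteq> (\<lambda>p. p $ 1) ` ?R"
    proof
      fix x assume "x \<in> {x1<..<x2}"
      then have "\<phi> (x, 1/2) \<in> ?R" unfolding img by auto
      then show "x \<in> (\<lambda>p. p $ 1) ` ?R" by (rule image_eqI[rotated]) (simp add: \<phi>_def)
    qed
  qed
  have cl1: "closure ?R \<subseteq> {p. x1 \<le> p $ 1 \<and> p $ 1 \<le> x2 \<and> lo (p $ 1) \<le> s * p $ 2 \<and> s * p $ 2 \<le> hi (p $ 1)}"
    by (rule closure_minimal)
      (auto simp: band_def intro!: closed_Collect_conj closed_Collect_le continuous_intros cn)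
  have "\<phi> ` closure ({x1<..<x2} \<times> {0<..<1}) \<subseteq> closure ?R"
    unfolding img by (rule image_closure_subset[OF continuous_on_subset[OF cphi]]) (auto intro: closure_subset[THEN subsetD])
  then have cl2: "\<phi> (x, t) \<in> closure ?R" if "x1 \<le> x" "x \<le> x2" "0 \<le> t" "t \<le> 1" for x t
    using that x by (auto simp: closure_Times closure_greaterThanLessThan)
  show "frontier ?R = {p. x1 \<le> p $ 1 \<and> p $ 1 \<le> x2 \<and> (s * p $ 2 = lo (p $ 1) \<or> s * p $ 2 = hi (p $ 1))}"
    (is "_ = ?D")
  proof
    show "frontier ?R \<subseteq> ?D"
    proof
      fix p assume "p \<in> frontier ?R"
      then have p: "p \<in> closure ?R" "p \<notin> ?R" using op by (auto simp: frontier_def interior_open)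
      have c: "x1 \<le> p $ 1" "p $ 1 \<le> x2" "lo (p $ 1) \<le> s * p $ 2" "s * p $ 2 \<le> hi (p $ 1)" using p(1) cl1 by auto
      show "p \<in> ?D"
      proof (cases "p $ 1 = x1 \<or> p $ 1 = x2")
        case True
        then show ?thesis using c ends x by auto
      next
        case False
        then show ?thesis using c p(2) unfolding band_def by auto
      qed
    qed
    show "?D \<subseteq> frontier ?R"
    proof
      fix p assume p: "p \<in> ?D"
      have "p = \<phi> (p $ 1, if s * p $ 2 = lo (p $ 1) then 0 else 1)"
      proof (cases "s * p $ 2 = lo (p $ 1)")
        case True
        then show ?thesis unfolding \<phi>_def plane_eq_iff by (simp add: True[symmetric] ss)
      next
        case False
        then have "s * p $ 2 = hi (p $ 1)" using p by auto
        then show ?thesis unfolding \<phi>_def plane_eq_iff using False by (simp add: ss flip: \<open>s * p $ 2 = hi (p $ 1)\<close>)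
      qed
      then have "p \<in> closure ?R" using cl2[of "p $ 1" "if s * p $ 2 = lo (p $ 1) then 0 else 1"] p by auto
      moreover have "p \<notin> ?R" using p unfolding band_def by auto
      ultimately show "p \<in> frontier ?R" using op by (simp add: frontier_def interior_open)
    qed
  qed
qed

text \<open>A larger connected set outside \<open>U\<close> would have to meet the frontier of
  \<open>R\<close>, which lies in \<open>U\<close>.\<close>

lemma component_of_frontier:
  assumes "connected R" "R \<noteq> {}" "R \<inter> U = {}" "frontier R \<subseteq> U"
  shows "R \<in> components (- U)"
  unfolding in_components_maximal
proof (intro conjI allI impI)
  fix d assume d: "d \<noteq> {} \<and> R \<subseteq> d \<and> d \<subseteq> - U \<and> connected d"
  show "d = R"
  proof (rule ccontr)
    assume "d \<noteq> R"
    then have "d - R \<noteq> {}" "d \<inter> R \<noteq> {}" using d assms(2) by auto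
    then have "d \<inter> frontier R \<noteq> {}" using connected_Int_frontier[of d R] d by blast
    then show False using d assms(4) by blast
  qed
qed (use assms in auto)

text \<open>\<open>X i j\<close> is the abscissa of the crossing of two graphs;
  \<open>locally_inj\<close> is the form that transversality takes for them.\<close>

locale graph_arrangement =
  fixes N :: nat and F :: "nat \<Rightarrow> real \<Rightarrow> real" and X :: "nat \<Rightarrow> nat \<Rightarrow> real"
  assumes cont: "\<And>i. continuous_on UNIV (F i)"
    and cross: "\<And>i j x. i < N \<Longrightarrow> j < N \<Longrightarrow> i \<noteq> j \<Longrightarrow> F i x = F j x \<longleftrightarrow> x = X i j"
    and simple: "\<And>i j k. i < N \<Longrightarrow> j < N \<Longrightarrow> k < N \<Longrightarrow> distinct [i, j, k] \<Longrightarrow> X i j \<noteq> X i k"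
    and locally_inj: "\<And>i j. i < N \<Longrightarrow> j < N \<Longrightarrow> i \<noteq> j \<Longrightarrow>
      \<exists>e>0. inj_on (\<lambda>x. F i x - F j x) {X i j - e<..<X i j + e}"
begin

definition graph :: "nat \<Rightarrow> plane set" where "graph i = {p. p $ 2 = F i (p $ 1)}"
definition arc :: "nat \<Rightarrow> real \<Rightarrow> real \<Rightarrow> plane set" where "arc i u v = (\<lambda>x. pt x (F i x)) ` {u<..<v}"
definition lines :: "plane set set" where "lines = graph ` {..<N}"

lemma cont_nth: "continuous_on S (\<lambda>p :: plane. F i (p $ 1))"
  using continuous_compose_nth[OF cont] .

lemma X_sym: "i < N \<Longrightarrow> j < N \<Longrightarrow> i \<noteq> j \<Longrightarrow> X i j = X j i"
  using cross[of i j "X i j"] cross[of j i "X i j"] by auto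

lemma graph_eq_iff: "i < N \<Longrightarrow> j < N \<Longrightarrow> graph i = graph j \<longleftrightarrow> i = j"
proof
  assume ij: "i < N" "j < N" "graph i = graph j"
  show "i = j"
  proof (rule ccontr)
    assume "i \<noteq> j"
    then have "F i (X i j + 1) \<noteq> F j (X i j + 1)" using cross[of i j] ij by simp
    moreover have "pt (X i j + 1) (F i (X i j + 1)) \<in> graph i" unfolding graph_def by simp
    then have "pt (X i j + 1) (F i (X i j + 1)) \<in> graph j" using ij(3) by simp
    ultimately show False unfolding graph_def by simp
  qed
qed simp

lemma graph_Int: "i < N \<Longrightarrow> j < N \<Longrightarrow> i \<noteq> j \<Longrightarrow> graph i \<inter> graph j = {pt (X i j) (F i (X i j))}"
  using cross[of i j] unfolding graph_def by (auto simp: plane_eq_iff) metis+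

text \<open>A vertical shear flattens the graph.\<close>

lemma pseudo_line_graph: "pseudo_line (graph i)"
proof -
  let ?h = "\<lambda>p :: plane. pt (p $ 1) (p $ 2 - F i (p $ 1))" and ?h' = "\<lambda>p :: plane. pt (p $ 1) (p $ 2 + F i (p $ 1))"
  let ?S = "{p :: plane. axis 2 1 \<bullet> p = 0}"
  have "homeomorphism UNIV UNIV ?h ?h'"
  proof (rule homeomorphismI)
    show "continuous_on UNIV ?h" "continuous_on UNIV ?h'" by (intro continuous_intros cont_nth)+
  qed (auto simp: plane_eq_iff)
  moreover have "affine ?S" by (rule affine_hyperplane)
  moreover have "aff_dim ?S = 1"
    using aff_dim_hyperplane[of "axis 2 1 :: plane" 0] by (simp add: axis_eq_0_iff)
  moreover have "?h ` graph i = ?S"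
  proof (intro equalityI subsetI)
    fix p :: plane assume "p \<in> ?S"
    then have "p = ?h (pt (p $ 1) (F i (p $ 1)))" by (simp add: plane_eq_iff inner_axis')
    moreover have "pt (p $ 1) (F i (p $ 1)) \<in> graph i" unfolding graph_def by simp
    ultimately show "p \<in> ?h ` graph i" by blast
  qed (auto simp: graph_def inner_axis')
  ultimately show ?thesis unfolding pseudo_line_def by blast
qed

text \<open>The vertical offsets from the two graphs serve as coordinates: their difference recovers
  the abscissa by local injectivity, and invariance of domain turns the injective map
  \<open>f\<close> into a chart.\<close>

lemma transversal_graph:
  assumes ij: "i < N" "j < N" "i \<noteq> j"
  shows "transversal_at (graph i) (graph j) (pt (X i j) (F i (X i j)))"
proof -
  let ?v = "pt (X i j) (F i (X i j))"
  obtain e where e: "e > 0" "inj_on (\<lambda>x. F i x - F j x) {X i j - e<..<X i j + e}" using locally_inj[OF ij] by blast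
  define U where "U = {p :: plane. X i j - e < p $ 1 \<and> p $ 1 < X i j + e}"
  define f where "f p = pt (p $ 2 - F j (p $ 1)) (p $ 2 - F i (p $ 1))" for p :: plane
  have U: "open U" unfolding U_def by (intro open_Collect_conj open_Collect_less continuous_intros)
  have cf: "continuous_on U f" unfolding f_def by (intro continuous_intros cont_nth)
  have inj: "inj_on f U"
  proof (rule inj_onI)
    fix p q assume pq: "p \<in> U" "q \<in> U" "f p = f q"
    then have *: "p $ 2 - F j (p $ 1) = q $ 2 - F j (q $ 1)" "p $ 2 - F i (p $ 1) = q $ 2 - F i (q $ 1)"
      unfolding f_def by (simp_all add: plane_eq_iff)
    then have "F i (p $ 1) - F j (p $ 1) = F i (q $ 1) - F j (q $ 1)" by linarith
    then have "p $ 1 = q $ 1" using inj_onD[OF e(2), of "p $ 1" "q $ 1"] pq unfolding U_def by simp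
    then show "p = q" using * by (simp add: plane_eq_iff)
  qed
  have V: "open (f ` U)" using invariance_of_domain[OF cf U inj] .
  obtain g where g: "homeomorphism U (f ` U) f g" using invariance_of_domain_homeomorphism[OF U cf _ inj] by auto
  have "?v \<in> graph i \<inter> graph j" using graph_Int[OF ij] by auto
  moreover have "?v \<in> U" using e(1) unfolding U_def by simp
  moreover have "f p $ 2 = 0 \<longleftrightarrow> p \<in> graph i" "f p $ 1 = 0 \<longleftrightarrow> p \<in> graph j" for p
    unfolding graph_def f_def by auto
  then have "f ` (graph i \<inter> U) = {x \<in> f ` U. x $ 2 = 0}" "f ` (graph j \<inter> U) = {x \<in> f ` U. x $ 1 = 0}"
    by blast+
  ultimately show ?thesis unfolding transversal_at_def using U V g by blast
qed

lemma simple_lines: "simple_affine_arrangement N lines"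
  unfolding simple_affine_arrangement_def
proof (intro conjI ballI impI)
  show "finite lines" unfolding lines_def by simp
  show "card lines = N" unfolding lines_def using card_image[of graph "{..<N}"] graph_eq_iff by (simp add: inj_on_def)
  show "pseudo_line L" if "L \<in> lines" for L using that pseudo_line_graph unfolding lines_def by auto
  fix L M assume LM: "L \<in> lines" "M \<in> lines" "L \<noteq> M"
  then obtain i j where ij: "i < N" "j < N" "i \<noteq> j" "L = graph i" "M = graph j" unfolding lines_def by auto
  have "pt (X i j) (F i (X i j)) \<notin> K" if K: "K \<in> lines - {L, M}" for K
  proof
    assume "pt (X i j) (F i (X i j)) \<in> K"
    moreover obtain k where k: "k < N" "K = graph k" "k \<noteq> i" "k \<noteq> j" using K ij unfolding lines_def by auto
    ultimately have "F i (X i j) = F k (X i j)" unfolding graph_def by simp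
    then have "X i j = X i k" using cross[of i k] k ij by auto
    then show False using simple[of i j k] k ij by auto
  qed
  then show "\<exists>p. L \<inter> M = {p} \<and> transversal_at L M p \<and> (\<forall>N\<in>lines - {L, M}. p \<notin> N)"
    using graph_Int[OF ij(1-3)] transversal_graph[OF ij(1-3)] ij(4,5) by blast
qed

lemma mem_graph_unique:
  assumes "p \<in> graph i - \<Union>(lines - {graph i})" "i < N" "j < N" "p \<in> graph j"
  shows "j = i"
  using assms graph_eq_iff[of i j] unfolding lines_def by auto

text \<open>The abscissas of a connected set that properly extends the arc would include
  \<open>u\<close> or \<open>v\<close>, where the graph meets another line.\<close>

lemma arc_segment:
  assumes i: "i < N" and j: "j < N" "j \<noteq> i" "X i j = u" and k: "k < N" "k \<noteq> i" "X i k = v" and uv: "u < v"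
    and free: "\<And>d. d < N \<Longrightarrow> d \<noteq> i \<Longrightarrow> X i d \<notin> {u<..<v}"
  shows "arc i u v \<in> components (graph i - \<Union>(lines - {graph i}))"
  unfolding in_components_maximal
proof (intro conjI allI impI)
  show "arc i u v \<noteq> {}" using uv unfolding arc_def by auto
  have ci: "continuous_on S (\<lambda>x. pt x (F i x))" for S by (intro continuous_intros continuous_on_subset[OF cont]) auto
  show "connected (arc i u v)" unfolding arc_def by (intro connected_continuous_image ci) auto
  show "arc i u v \<subseteq> graph i - \<Union>(lines - {graph i})"
  proof
    fix p assume "p \<in> arc i u v"
    then obtain x where x: "x \<in> {u<..<v}" "p = pt x (F i x)" unfolding arc_def by blast
    have "p \<notin> L" if L: "L \<in> lines - {graph i}" for L
    proof
      assume "p \<in> L"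
      obtain d where d: "d < N" "L = graph d" "d \<noteq> i" using L unfolding lines_def by auto
      then have "x = X i d" using \<open>p \<in> L\<close> x cross[of i d x] i unfolding graph_def by auto
      then show False using free d x by auto
    qed
    then show "p \<in> graph i - \<Union>(lines - {graph i})" using x unfolding graph_def by auto
  qed
  fix d assume d: "d \<noteq> {} \<and> arc i u v \<subseteq> d \<and> d \<subseteq> graph i - \<Union>(lines - {graph i}) \<and> connected d"
  have con: "connected ((\<lambda>p. p $ 1) ` d)" using d by (intro connected_continuous_image continuous_intros) auto
  have notin: "X i l \<notin> (\<lambda>p. p $ 1) ` d" if l: "l < N" "l \<noteq> i" for l
  proof
    assume "X i l \<in> (\<lambda>p. p $ 1) ` d"
    then obtain p where p: "p \<in> d" "p $ 1 = X i l" by auto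
    then have "p \<in> graph i" using d by auto
    then have "p \<in> graph l" using cross[of i l "X i l"] i l p unfolding graph_def by auto
    then show False using mem_graph_unique[of p i l] p d i l by auto
  qed
  let ?m = "(u + v) / 2"
  have m: "?m \<in> (\<lambda>p. p $ 1) ` d"
  proof -
    have "pt ?m (F i ?m) \<in> arc i u v" unfolding arc_def by (rule imageI) (use uv in auto)
    then have "pt ?m (F i ?m) \<in> d" using d by blast
    then show ?thesis by (rule image_eqI[rotated]) simp
  qed
  have "d \<subseteq> arc i u v"
  proof
    fix p assume p: "p \<in> d"
    then have p1: "p $ 1 \<in> (\<lambda>p. p $ 1) ` d" by auto
    have "u < p $ 1"
    proof (rule ccontr)
      assume "\<not> u < p $ 1"
      then have "X i j \<in> (\<lambda>p. p $ 1) ` d" using connectedD_interval[OF con p1 m, of u] uv j(3) by auto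
      then show False using notin j by auto
    qed
    moreover have "p $ 1 < v"
    proof (rule ccontr)
      assume "\<not> p $ 1 < v"
      then have "X i k \<in> (\<lambda>p. p $ 1) ` d" using connectedD_interval[OF con m p1, of v] uv k(3) by auto
      then show False using notin k by auto
    qed
    moreover have "p = pt (p $ 1) (F i (p $ 1))" using p d unfolding graph_def by (auto simp: plane_eq_iff)
    ultimately show "p \<in> arc i u v" unfolding arc_def by (metis greaterThanLessThan_iff imageI)
  qed
  then show "d = arc i u v" using d by auto
qed

lemma arc_bounded: "bounded (arc i u v)"
proof -
  have "compact ((\<lambda>x. pt x (F i x)) ` {u..v})"
    by (intro compact_continuous_image continuous_intros continuous_on_subset[OF cont]) auto
  then have "bounded ((\<lambda>x. pt x (F i x)) ` {u..v})" by (rule compact_imp_bounded)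
  then show ?thesis unfolding arc_def by (rule bounded_subset) auto
qed

section \<open>Triangles bounded by three graphs\<close>

lemma same_sign:
  assumes "i < N" "j < N" "i \<noteq> j" "s = 1 \<or> s = -1" "(x < X i j \<and> y < X i j) \<or> (X i j < x \<and> X i j < y)"
  shows "s * F i x < s * F j x \<longleftrightarrow> s * F i y < s * F j y"
proof -
  let ?S = "if x < X i j then {..<X i j} else {X i j<..}"
  have "0 < s * F j x - s * F i x \<longleftrightarrow> 0 < s * F j y - s * F i y"
  proof (rule connected_same_sign[where S = ?S and f = "\<lambda>x. s * F j x - s * F i x"])
    show "connected ?S" by auto
    show "continuous_on ?S (\<lambda>x. s * F j x - s * F i x)" by (intro continuous_intros continuous_on_subset[OF cont]) auto
    show "s * F j x - s * F i x \<noteq> 0" if "x \<in> ?S" for x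
      using cross[of i j x] assms that by (auto split: if_splits)
  qed (use assms(5) in auto)
  then show ?thesis by simp
qed

text \<open>A graph strictly between those of \<open>a\<close> and \<open>b\<close> could be
  followed to the corner where these two meet; crossing neither of them on the way, it would still
  be strictly between two equal values.\<close>

lemma no_entry:
  assumes d: "d < N" "a < N" "b < N" "d \<noteq> a" "d \<noteq> b" "a \<noteq> b" and s: "s = 1 \<or> s = -1"
    and bet: "s * F a x < s * F d x" "s * F d x < s * F b x"
    and free: "\<And>y. (X a b < y \<and> y < x) \<or> (x < y \<and> y < X a b) \<Longrightarrow> y \<noteq> X a d \<and> y \<noteq> X b d"
  shows False
proof -
  let ?y = "X a b"
  have xy: "x \<noteq> ?y" using bet cross[of a b x] d by auto
  have dab: "X a d \<noteq> ?y" using simple[of a b d] d by auto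
  have dba: "X b d \<noteq> ?y" using simple[of b a d] X_sym[of a b] d by auto
  have eq: "F a ?y = F b ?y" using cross[of a b ?y] d by auto
  have ne: "F d ?y \<noteq> F a ?y" using cross[of a d ?y] d dab by auto
  have 1: "s * F a ?y < s * F d ?y"
  proof (rule ccontr)
    assume n: "\<not> s * F a ?y < s * F d ?y"
    have "\<not> ((x < X a d \<and> ?y < X a d) \<or> (X a d < x \<and> X a d < ?y))"
      using same_sign[of a d s x ?y] n bet(1) d s by blast
    moreover have "X a d \<noteq> x" using bet(1) cross[of a d x] d by auto
    ultimately show False using free[of "X a d"] dab by linarith
  qed
  have 2: "s * F d ?y < s * F b ?y"
  proof (rule ccontr)
    assume n: "\<not> s * F d ?y < s * F b ?y"
    have "\<not> ((x < X b d \<and> ?y < X b d) \<or> (X b d < x \<and> X b d < ?y))"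
      using same_sign[of d b s x ?y] X_sym[of b d] n bet(2) d s by auto
    moreover have "X b d \<noteq> x" using bet(2) cross[of b d x] d by auto
    ultimately show False using free[of "X b d"] dba by linarith
  qed
  show False using 1 2 eq by simp
qed

text \<open>\<open>a\<close> carries the long edge over the whole interval, \<open>b\<close> the
  edge from the left vertex and \<open>c\<close> the edge to the right one; up to turning upside
  down, the region is bounded by \<open>a\<close> and by the lower of \<open>b\<close> and
  \<open>c\<close>. Its projection is recorded because the left vertex will tell different triangles
  apart.\<close>

lemma triangle_band:
  assumes abc: "a < N" "b < N" "c < N" "distinct [a, b, c]"
    and x13: "X a b < X b c" and x32: "X b c < X a c"
    and free: "\<And>d. d < N \<Longrightarrow> d \<notin> {a, b, c} \<Longrightarrow>
        X a d \<notin> {X a b<..<X a c} \<and> X b d \<notin> {X a b<..<X b c} \<and> X c d \<notin> {X b c<..<X a c}"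
  shows "\<exists>R\<in>bounded_triangles lines. (\<lambda>p. p $ 1) ` R = {X a b<..<X a c}"
proof -
  define x1 x2 x3 where "x1 = X a b" and "x2 = X a c" and "x3 = X b c"
  have lt: "x1 < x3" "x3 < x2" using x13 x32 unfolding x1_def x2_def x3_def by auto
  have ne: "a \<noteq> b" "a \<noteq> c" "b \<noteq> c" using abc by auto
  have crab: "F a x = F b x \<longleftrightarrow> x = x1" and crac: "F a x = F c x \<longleftrightarrow> x = x2" and crbc: "F b x = F c x \<longleftrightarrow> x = x3" for x
    using cross abc(1-3) ne unfolding x1_def x2_def x3_def by auto
  \<comment> \<open>This sign puts the third vertex above the long edge.\<close>
  define s :: real where "s = (if F a x3 < F b x3 then 1 else -1)"
  have s: "s = 1 \<or> s = -1" unfolding s_def by auto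
  then have s0: "s * y = s * z \<longleftrightarrow> y = z" for y z by auto
  define f where "f i x = s * F i x" for i x
  have f0: "f i x = f j x \<longleftrightarrow> F i x = F j x" for i j x unfolding f_def by (rule s0)
  have fc: "continuous_on S (f i)" for i S unfolding f_def by (intro continuous_intros continuous_on_subset[OF cont]) auto
  have sab: "f a x < f b x \<longleftrightarrow> f a y < f b y" if "(x < x1 \<and> y < x1) \<or> (x1 < x \<and> x1 < y)" for x y
    using same_sign[OF abc(1,2) ne(1) s] that unfolding f_def x1_def by blast
  have sac: "f a x < f c x \<longleftrightarrow> f a y < f c y" if "(x < x2 \<and> y < x2) \<or> (x2 < x \<and> x2 < y)" for x y
    using same_sign[OF abc(1,3) ne(2) s] that unfolding f_def x2_def by blast
  have sbc: "f b x < f c x \<longleftrightarrow> f b y < f c y" if "(x < x3 \<and> y < x3) \<or> (x3 < x \<and> x3 < y)" for x y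
    using same_sign[OF abc(2,3) ne(3) s] that unfolding f_def x3_def by blast
  have "f a x3 < f b x3" using crab[of x3] lt unfolding f_def s_def by auto
  then have ab: "f a x < f b x" if "x1 < x" for x using sab[of x3 x] lt that by blast
  have "f b x3 = f c x3" using crbc f0 by blast
  then have "f a x3 < f c x3" using \<open>f a x3 < f b x3\<close> by simp
  then have ac: "f a x < f c x" if "x < x2" for x using sac[of x3 x] lt that by blast
  have eq1: "f a x1 = f b x1" and eq2: "f a x2 = f c x2" using crab crac f0 by blast+
  have "f b x1 < f c x1" using ac[of x1] eq1 lt by simp
  then have bc: "f b x < f c x" if "x < x3" for x using sbc[of x1 x] lt that by blast
  have "\<not> f b x2 < f c x2" using ab[of x2] eq2 lt by simp
  then have "\<not> f b x < f c x" if "x3 < x" for x using sbc[of x2 x] lt that by blast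
  then have cb: "f c x \<le> f b x" if "x3 \<le> x" for x using that \<open>f b x3 = f c x3\<close> by (cases "x = x3") (auto simp: not_less)
  define lo hi where "lo = f a" and "hi = (\<lambda>x. min (f b x) (f c x))"
  have hib: "hi x = f b x" if "x \<le> x3" for x
    using bc[of x] that \<open>f b x3 = f c x3\<close> unfolding hi_def by (cases "x = x3") auto
  have hic: "hi x = f c x" if "x3 \<le> x" for x using cb[OF that] unfolding hi_def by simp
  have h: "x1 < x2" "continuous_on UNIV lo" "continuous_on UNIV hi" "\<And>x. x1 < x \<Longrightarrow> x < x2 \<Longrightarrow> lo x < hi x"
    "lo x1 = hi x1" "lo x2 = hi x2"
  proof -
    show "continuous_on UNIV lo" "continuous_on UNIV hi" unfolding lo_def hi_def by (intro fc continuous_intros)+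
    show "lo x < hi x" if "x1 < x" "x < x2" for x using ab ac that unfolding lo_def hi_def by simp
    show "lo x1 = hi x1" "lo x2 = hi x2" using eq1 eq2 hib[of x1] hic[of x2] lt unfolding lo_def by auto
  qed (use lt in simp)
  define R where "R = band s x1 x2 lo hi"
  have R: "open R" "connected R" "(\<lambda>p. p $ 1) ` R = {x1<..<x2}"
    "frontier R = {p. x1 \<le> p $ 1 \<and> p $ 1 \<le> x2 \<and> (s * p $ 2 = lo (p $ 1) \<or> s * p $ 2 = hi (p $ 1))}"
    using band_facts[OF s h(1-6)] unfolding R_def by auto
  have frontier: "p \<in> frontier R \<longleftrightarrow> (x1 \<le> p $ 1 \<and> p $ 1 \<le> x2 \<and> p \<in> graph a) \<or> (x1 \<le> p $ 1 \<and> p $ 1 \<le> x3 \<and> p \<in> graph b)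
      \<or> (x3 \<le> p $ 1 \<and> p $ 1 \<le> x2 \<and> p \<in> graph c)" for p
  proof -
    have g: "p \<in> graph i \<longleftrightarrow> s * p $ 2 = f i (p $ 1)" for i
      unfolding graph_def f_def s0 by (rule mem_Collect_eq)
    show ?thesis
    proof (cases "p $ 1 = x3")
      case True
      then show ?thesis unfolding R(4) g lo_def mem_Collect_eq using hib[of "p $ 1"] hic[of "p $ 1"] lt by auto
    next
      case False
      then consider "p $ 1 < x3" | "x3 < p $ 1" by linarith
      then show ?thesis
      proof cases
        case 1
        then have "hi (p $ 1) = f b (p $ 1)" "\<not> x3 \<le> p $ 1" using hib by auto
        then show ?thesis unfolding R(4) g lo_def mem_Collect_eq using 1 lt by auto
      next
        case 2
        then have "hi (p $ 1) = f c (p $ 1)" "\<not> p $ 1 \<le> x3" using hic by auto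
        then show ?thesis unfolding R(4) g lo_def mem_Collect_eq using 2 lt by auto
      qed
    qed
  qed
  \<comment> \<open>A line through a point of the region could be followed to the left corner if the
    point is left of the third vertex, and to the right corner otherwise.\<close>
  have disj: "R \<inter> \<Union>lines = {}"
  proof -
    have False if p: "p \<in> R" and d: "d < N" "p \<in> graph d" for p d
    proof -
      have fd: "s * p $ 2 = f d (p $ 1)" using d(2) unfolding graph_def f_def by simp
      have b: "x1 < p $ 1" "p $ 1 < x2" "f a (p $ 1) < f d (p $ 1)" "f d (p $ 1) < f b (p $ 1)" "f d (p $ 1) < f c (p $ 1)"
        using p fd unfolding R_def band_def lo_def hi_def by auto
      then have dn: "d \<notin> {a, b, c}" by auto
      have fr: "X a d \<notin> {x1<..<x2}" "X b d \<notin> {x1<..<x3}" "X c d \<notin> {x3<..<x2}"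
        using free[OF d(1) dn] unfolding x1_def x2_def x3_def by blast+
      show False
      proof (cases "p $ 1 \<le> x3")
        case True
        show False
        proof (rule no_entry[OF d(1) abc(1,2) _ _ ne(1) s, of "p $ 1"])
          show "y \<noteq> X a d \<and> y \<noteq> X b d" if "X a b < y \<and> y < p $ 1 \<or> p $ 1 < y \<and> y < X a b" for y
            using that fr True b(1) lt unfolding x1_def[symmetric] by auto
        qed (use b dn in \<open>auto simp: f_def\<close>)
      next
        case False
        show False
        proof (rule no_entry[OF d(1) abc(1,3) _ _ ne(2) s, of "p $ 1"])
          show "y \<noteq> X a d \<and> y \<noteq> X c d" if "X a c < y \<and> y < p $ 1 \<or> p $ 1 < y \<and> y < X a c" for y
            using that fr False b(2) lt unfolding x2_def[symmetric] by auto
        qed (use b dn in \<open>auto simp: f_def\<close>)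
      qed
    qed
    then show ?thesis unfolding lines_def by blast
  qed
  have "R \<noteq> {}" using R(3) lt by auto
  moreover have "frontier R \<subseteq> \<Union>lines" using frontier abc unfolding lines_def by auto
  ultimately have poly: "R \<in> arr_polygons lines" unfolding arr_polygons_def using component_of_frontier R(2) disj by blast
  let ?A = "arc a x1 x2" and ?B = "arc b x1 x3" and ?C = "arc c x3 x2"
  have Xs: "X b a = x1" "X c a = x2" "X c b = x3" using X_sym abc ne unfolding x1_def x2_def x3_def by auto
  have sA: "?A \<in> components (graph a - \<Union>(lines - {graph a}))"
  proof (rule arc_segment[OF abc(1,2) _ _ abc(3)])
    fix d assume "d < N" "d \<noteq> a"
    then show "X a d \<notin> {x1<..<x2}" using free[of d] unfolding x1_def x2_def by (cases "d = b \<or> d = c") auto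
  qed (use ne lt in \<open>auto simp: x1_def x2_def\<close>)
  have sB: "?B \<in> components (graph b - \<Union>(lines - {graph b}))"
  proof (rule arc_segment[OF abc(2,1) _ _ abc(3)])
    fix d assume "d < N" "d \<noteq> b"
    then show "X b d \<notin> {x1<..<x3}" using free[of d] Xs unfolding x1_def x3_def by (cases "d = a \<or> d = c") auto
  qed (use ne lt Xs in \<open>auto simp: x1_def x3_def\<close>)
  have sC: "?C \<in> components (graph c - \<Union>(lines - {graph c}))"
  proof (rule arc_segment[OF abc(3,2) _ _ abc(1)])
    fix d assume "d < N" "d \<noteq> c"
    then show "X c d \<notin> {x3<..<x2}" using free[of d] Xs unfolding x2_def x3_def by (cases "d = a \<or> d = b") auto
  qed (use ne lt Xs in \<open>auto simp: x2_def x3_def\<close>)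
  have in_lines: "graph a \<in> lines" "graph b \<in> lines" "graph c \<in> lines" using abc unfolding lines_def by auto
  have mem_arc: "p \<in> arc i u v \<longleftrightarrow> u < p $ 1 \<and> p $ 1 < v \<and> p \<in> graph i" for p i u v
    unfolding arc_def graph_def by (auto simp: plane_eq_iff image_iff)
  \<comment> \<open>A point of a bounding segment lies on the frontier but at no crossing, hence on
    one of the three open arcs, and that arc is then the segment.\<close>
  have bs: "bounding_segments lines R = {?A, ?B, ?C}"
  proof (intro equalityI subsetI)
    fix t assume "t \<in> {?A, ?B, ?C}"
    moreover have "t \<subseteq> frontier R" if "t \<in> {?A, ?B, ?C}" using that lt by (auto simp: mem_arc frontier)
    ultimately show "t \<in> bounding_segments lines R"
      using sA sB sC in_lines unfolding bounding_segments_def arr_segments_def by blast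
  next
    fix t assume t: "t \<in> bounding_segments lines R"
    then obtain i where i: "i < N" "t \<in> components (graph i - \<Union>(lines - {graph i}))" and tf: "t \<subseteq> frontier R"
      unfolding bounding_segments_def arr_segments_def lines_def by blast
    obtain p where p: "p \<in> t" using in_components_nonempty[OF i(2)] by blast
    have pi: "p \<in> graph i - \<Union>(lines - {graph i})" using p in_components_subset[OF i(2)] by blast
    have uniq: "j = i" if "j < N" "p \<in> graph j" for j using mem_graph_unique[OF pi i(1) that] .
    have on: "p \<in> graph k" if "j < N" "k < N" "j \<noteq> k" "p \<in> graph j" "p $ 1 = X j k" for j k
      using that cross[of j k "X j k"] unfolding graph_def by auto
    have same: "t = t'" if "t' \<in> components (graph i - \<Union>(lines - {graph i}))" "p \<in> t'" for t'
      using components_nonoverlap[OF i(2) that(1)] p that(2) by auto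
    have pf: "p \<in> frontier R" using p tf by blast
    have nx: "p $ 1 \<noteq> X i k" if "k < N" "k \<noteq> i" for k using on[OF i(1) that(1)] uniq[OF that(1)] that pi by auto
    consider (a) "x1 \<le> p $ 1" "p $ 1 \<le> x2" "p \<in> graph a" | (b) "x1 \<le> p $ 1" "p $ 1 \<le> x3" "p \<in> graph b"
      | (c) "x3 \<le> p $ 1" "p $ 1 \<le> x2" "p \<in> graph c" using pf frontier by blast
    then show "t \<in> {?A, ?B, ?C}"
    proof cases
      case a
      then have "i = a" using uniq abc by blast
      then have "p $ 1 \<noteq> x1" "p $ 1 \<noteq> x2" using nx[of b] nx[of c] abc ne unfolding x1_def x2_def by auto
      then have "p \<in> ?A" using a mem_arc by simp
      then show ?thesis using same sA \<open>i = a\<close> by blast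
    next
      case b
      then have "i = b" using uniq abc by blast
      then have "p $ 1 \<noteq> x1" "p $ 1 \<noteq> x3" using nx[of a] nx[of c] abc ne Xs unfolding x3_def by auto
      then have "p \<in> ?B" using b mem_arc by simp
      then show ?thesis using same sB \<open>i = b\<close> by blast
    next
      case c
      then have "i = c" using uniq abc by blast
      then have "p $ 1 \<noteq> x2" "p $ 1 \<noteq> x3" using nx[of a] nx[of b] abc ne Xs by auto
      then have "p \<in> ?C" using c mem_arc by simp
      then show ?thesis using same sC \<open>i = c\<close> by blast
    qed
  qed
  have "?A \<noteq> ?B" "?A \<noteq> ?C" "?B \<noteq> ?C"
  proof -
    have *: "arc i u v \<noteq> arc j u' v'" if asm: "i < N" "j < N" "i \<noteq> j" "arc i u v \<in> components (graph i - \<Union>(lines - {graph i}))" for i j u v u' v'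
    proof
      assume eq: "arc i u v = arc j u' v'"
      obtain p where p: "p \<in> arc i u v" using in_components_nonempty[OF asm(4)] by blast
      then have "p \<in> graph i - \<Union>(lines - {graph i})" "p \<in> graph j"
        using in_components_subset[OF asm(4)] eq mem_arc by blast+
      then show False using mem_graph_unique asm by blast
    qed
    show "?A \<noteq> ?B" "?A \<noteq> ?C" "?B \<noteq> ?C" using *[OF _ _ _ sA] *[OF _ _ _ sB] abc ne by auto
  qed
  then have "R \<in> bounded_triangles lines"
    unfolding bounded_triangles_def using poly bs arc_bounded by auto
  then show ?thesis using R(3) unfolding x1_def x2_def by blast
qed

end

section \<open>Sorting networks\<close>

definition swp :: "nat \<Rightarrow> nat \<Rightarrow> nat" where
  "swp k p = (if p = k then Suc k else if p = Suc k then k else p)"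

lemma swp_swp [simp]: "swp k (swp k p) = p"
  by (simp add: swp_def)

lemma fold_swp_rev: "fold swp (rev w) (fold swp w p) = p"
  by (induction w arbitrary: p) simp_all

lemma fold_swp_rev': "fold swp w (fold swp (rev w) p) = p"
  using fold_swp_rev[of "rev w"] by simp

lemma fold_swp_eq_iff [simp]: "fold swp w p = fold swp w q \<longleftrightarrow> p = q"
  by (metis fold_swp_rev)

lemma fold_swp_less: "set w \<subseteq> {..<N - 1} \<Longrightarrow> p < N \<Longrightarrow> fold swp w p < N"
proof (induction w arbitrary: p)
  case (Cons k w)
  have "swp k p < N" using Cons.prems by (auto simp: swp_def)
  then show ?case using Cons by simp
qed simp

text \<open>Wires are named by their heights at the start; this is the height of wire
  \<open>i\<close> after \<open>t\<close> letters.\<close>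

definition pos :: "nat list \<Rightarrow> nat \<Rightarrow> nat \<Rightarrow> nat" where "pos w t i = fold swp (take t w) i"

lemma pos_Suc: "t < length w \<Longrightarrow> pos w (Suc t) i = swp (w ! t) (pos w t i)"
  by (simp add: pos_def take_Suc_conv_app_nth)

lemma pos_eq_iff [simp]: "pos w t i = pos w t j \<longleftrightarrow> i = j"
  by (simp add: pos_def)

lemma pairs_card: "2 * card {(i, j). i < j \<and> j < (N :: nat)} = N * (N - 1)"
proof -
  have "{(i, j). i < j \<and> j < N} = (\<lambda>(j, i). (i, j)) ` (SIGMA j:{..<N}. {..<j})" by auto
  moreover have "inj_on (\<lambda>(j, i). (i, j)) (SIGMA j:{..<N}. {..<j})" by (auto simp: inj_on_def)
  ultimately have "card {(i, j). i < j \<and> j < N} = (\<Sum>j<N. j)" by (simp add: card_image)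
  moreover have "2 * (\<Sum>j<N. j) = N * (N - 1)"
  proof (induction N)
    case (Suc N)
    then show ?case by (cases N) (simp_all add: algebra_simps)
  qed simp
  ultimately show ?thesis by simp
qed

text \<open>A word is a sorting network: its letter \<open>k\<close> exchanges the wires at the heights \<open>k\<close> and \<open>k + 1\<close>,
  and the whole word reverses the order of the \<open>N\<close> wires. As its length is the number of pairs of wires,
  any two wires are exchanged exactly once.\<close>

locale reversing_word =
  fixes w :: "nat list" and N :: nat
  assumes letters: "set w \<subseteq> {..<N - 1}" and len: "2 * length w = N * (N - 1)"
    and reversal: "\<And>i. i < N \<Longrightarrow> fold swp w i = N - 1 - i"
begin

definition exchanges :: "nat \<Rightarrow> nat \<Rightarrow> nat set" where
  "exchanges i j = {t. t < length w \<and> {pos w t i, pos w t j} = {w ! t, Suc (w ! t)}}"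

lemma exchanges_sym: "exchanges i j = exchanges j i"
  unfolding exchanges_def by (simp add: insert_commute)

lemma order_preserved:
  assumes "t < length w" "i \<noteq> j" "t \<notin> exchanges i j"
  shows "pos w (Suc t) i < pos w (Suc t) j \<longleftrightarrow> pos w t i < pos w t j"
proof -
  define p q k where "p = pos w t i" and "q = pos w t j" and "k = w ! t"
  have "p \<noteq> q" using assms(2) unfolding p_def q_def by simp
  moreover have "\<not> (p = k \<and> q = Suc k)" "\<not> (p = Suc k \<and> q = k)"
    using assms unfolding exchanges_def p_def q_def k_def by auto
  ultimately have "swp k p < swp k q \<longleftrightarrow> p < q" unfolding swp_def by auto
  then show ?thesis using pos_Suc[OF assms(1)] unfolding p_def q_def k_def by simp
qed

lemma exchanges_nonempty:
  assumes "i < j" "j < N"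
  shows "exchanges i j \<noteq> {}"
proof
  assume e: "exchanges i j = {}"
  have "t \<le> length w \<Longrightarrow> pos w t i < pos w t j" for t
  proof (induction t)
    case 0
    then show ?case using assms by (simp add: pos_def)
  next
    case (Suc t)
    then show ?case using order_preserved[of t i j] e assms by auto
  qed
  from this[of "length w"] show False using reversal[of i] reversal[of j] assms by (simp add: pos_def)
qed

lemma exchanges_disjoint:
  assumes "t \<in> exchanges i j" "t \<in> exchanges i' j'"
  shows "{i, j} = {i', j'}"
proof -
  have "{pos w t i, pos w t j} = {pos w t i', pos w t j'}" using assms unfolding exchanges_def by auto
  then show ?thesis by (auto simp: doubleton_eq_iff)
qed

text \<open>Each pair is exchanged at least once because its order is reversed. A letter exchanges a
  single pair, and there are only as many letters as pairs.\<close>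

lemma exchanges_card:
  assumes "i < j" "j < N"
  shows "card (exchanges i j) = 1"
proof -
  let ?P = "{(i, j). i < j \<and> j < N}"
  have finP: "finite ?P" by (rule finite_subset[of _ "{..<N} \<times> {..<N}"]) auto
  have fin: "finite (exchanges i j)" for i j unfolding exchanges_def by auto
  have ge: "1 \<le> card (exchanges i j)" if "(i, j) \<in> ?P" for i j
    using exchanges_nonempty[of i j] that fin by (simp add: Suc_le_eq card_gt_0_iff)
  have "(\<Sum>(i, j)\<in>?P. card (exchanges i j)) = card (\<Union>(i, j)\<in>?P. exchanges i j)"
  proof -
    have "(\<Sum>p\<in>?P. card (case p of (i, j) \<Rightarrow> exchanges i j)) = card (\<Union>p\<in>?P. case p of (i, j) \<Rightarrow> exchanges i j)"
    proof (rule card_UN_disjoint[symmetric])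
      show "\<forall>p\<in>?P. \<forall>q\<in>?P. p \<noteq> q \<longrightarrow> (case p of (i, j) \<Rightarrow> exchanges i j) \<inter> (case q of (i, j) \<Rightarrow> exchanges i j) = {}"
        using exchanges_disjoint by (fastforce simp: doubleton_eq_iff)
    qed (use finP fin in auto)
    then show ?thesis by (simp add: case_prod_beta)
  qed
  also have "\<dots> \<le> card {..<length w}" by (rule card_mono) (auto simp: exchanges_def)
  also have "\<dots> = card ?P" using pairs_card[of N] len by simp
  finally have le: "(\<Sum>(i, j)\<in>?P. card (exchanges i j)) \<le> (\<Sum>p\<in>?P. 1)" by simp
  have "(\<Sum>p\<in>?P. 1) \<le> (\<Sum>(i, j)\<in>?P. card (exchanges i j))" using ge by (intro sum_mono) auto
  then have eq: "(\<Sum>p\<in>?P. 1) = (\<Sum>p\<in>?P. card (exchanges (fst p) (snd p)))" using le by (simp add: case_prod_beta)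
  have "1 = card (exchanges (fst (i, j)) (snd (i, j)))"
    by (rule sum_mono_inv[OF eq _ _ finP]) (use ge assms in auto)
  then show ?thesis by simp
qed

definition time :: "nat \<Rightarrow> nat \<Rightarrow> nat" where "time i j = (THE t. t \<in> exchanges i j)"

lemma exchanges_eq: "i < N \<Longrightarrow> j < N \<Longrightarrow> i \<noteq> j \<Longrightarrow> exchanges i j = {time i j}"
proof -
  assume ij: "i < N" "j < N" "i \<noteq> j"
  have "card (exchanges i j) = 1"
    using exchanges_card[of i j] exchanges_card[of j i] exchanges_sym[of i j] ij by (cases "i < j") auto
  then obtain t where "exchanges i j = {t}" by (auto simp: card_1_singleton_iff)
  then show ?thesis unfolding time_def by simp
qed

lemma time_eqI: "i < N \<Longrightarrow> j < N \<Longrightarrow> i \<noteq> j \<Longrightarrow> t \<in> exchanges i j \<Longrightarrow> time i j = t"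
  using exchanges_eq by auto

lemma time_in: "i < N \<Longrightarrow> j < N \<Longrightarrow> i \<noteq> j \<Longrightarrow> time i j \<in> exchanges i j"
  using exchanges_eq by auto

text \<open>A sum of ramps: the summand \<open>t\<close> changes linearly during [t, t + 1] and is
  constant before and after, so the wire passes through the heights \<open>pos w t i\<close> at the
  integers and is constant outside the word.\<close>

definition wire :: "nat \<Rightarrow> real \<Rightarrow> real" where
  "wire i x = real i + (\<Sum>t<length w. (real (pos w (Suc t) i) - real (pos w t i)) * max 0 (min 1 (x - real t)))"

lemma wire_between:
  assumes t: "t < length w" and x: "real t \<le> x" "x \<le> real t + 1"
  shows "wire i x = real (pos w t i) + (real (pos w (Suc t) i) - real (pos w t i)) * (x - real t)"
proof -
  let ?g = "\<lambda>s. (real (pos w (Suc s) i) - real (pos w s i)) * max 0 (min 1 (x - real s))"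
  have "{..<length w} = {..<t} \<union> {t} \<union> {Suc t..<length w}" using t by auto
  then have "(\<Sum>s<length w. ?g s) = (\<Sum>s\<in>{..<t} \<union> {t} \<union> {Suc t..<length w}. ?g s)" by simp
  also have "\<dots> = (\<Sum>s<t. ?g s) + ?g t + (\<Sum>s\<in>{Suc t..<length w}. ?g s)"
  proof -
    have "({..<t} \<union> {t}) \<inter> {Suc t..<length w} = {}" "{..<t} \<inter> {t} = {}" by auto
    then show ?thesis by (simp only: sum.union_disjoint finite_lessThan finite_Un finite.emptyI finite.insertI finite_atLeastLessThan) simp
  qed
  also have "(\<Sum>s<t. ?g s) = (\<Sum>s<t. real (pos w (Suc s) i) - real (pos w s i))"
    by (intro sum.cong refl) (use x in auto)
  also have "\<dots> = real (pos w t i) - real (pos w 0 i)" by (rule sum_lessThan_telescope)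
  also have "(\<Sum>s\<in>{Suc t..<length w}. ?g s) = 0"
    by (intro sum.neutral ballI) (use x in auto)
  finally show ?thesis unfolding wire_def using x by (simp add: pos_def)
qed

lemma wire_before: "x \<le> 0 \<Longrightarrow> wire i x = real i"
  unfolding wire_def by (simp add: sum.neutral)

lemma wire_after:
  assumes "real (length w) \<le> x"
  shows "wire i x = real (pos w (length w) i)"
proof -
  have "wire i x = real i + (\<Sum>t<length w. real (pos w (Suc t) i) - real (pos w t i))"
    unfolding wire_def using assms by (intro arg_cong[where f = "\<lambda>z. real i + z"] sum.cong refl) auto
  also have "\<dots> = real i + (real (pos w (length w) i) - real (pos w 0 i))" by (subst sum_lessThan_telescope) simp
  finally show ?thesis by (simp add: pos_def)
qed

lemma exchange_values:
  assumes "t \<in> exchanges i j"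
  shows "real (pos w (Suc t) i) = real (pos w t j)" "real (pos w (Suc t) j) = real (pos w t i)"
  using assms pos_Suc[of t w] unfolding exchanges_def by (auto simp: doubleton_eq_iff swp_def)

lemma wire_difference:
  assumes t: "t \<in> exchanges i j" and x: "real t \<le> x" "x \<le> real t + 1"
  shows "wire i x - wire j x = (real (pos w t i) - real (pos w t j)) * (1 - 2 * (x - real t))"
proof -
  have tl: "t < length w" using t unfolding exchanges_def by auto
  show ?thesis unfolding wire_between[OF tl x] exchange_values[OF t] by (simp add: algebra_simps)
qed

lemma wire_cross:
  assumes ij: "i < N" "j < N" "i \<noteq> j"
  shows "wire i x = wire j x \<longleftrightarrow> x = real (time i j) + 1/2"
proof
  assume "x = real (time i j) + 1/2"
  then show "wire i x = wire j x" using wire_difference[OF time_in[OF ij], of x] by simp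
next
  assume eq: "wire i x = wire j x"
  have "0 \<le> x" using eq wire_before[of x] ij by (cases "x \<le> 0") auto
  moreover have "x \<le> real (length w)" using eq wire_after[of x] ij by (cases "real (length w) \<le> x") auto
  ultimately have "\<exists>t<length w. real t \<le> x \<and> x \<le> real t + 1"
  proof (cases "x = real (length w)")
    \<comment> \<open>At the right end of the word the integer part of \<open>x\<close> is no index
      of a letter, so this value is treated apart.\<close>
    case True
    have "pos w (length w) i \<noteq> pos w (length w) j" using ij by simp
    then have False using eq wire_after[of x] True by auto
    then show ?thesis by simp
  next
    case False
    assume "0 \<le> x" "x \<le> real (length w)"
    define t where "t = nat \<lfloor>x\<rfloor>"
    have "real t \<le> x" "x < real t + 1" using \<open>0 \<le> x\<close> unfolding t_def by (simp_all add: of_nat_nat)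
    moreover have "t < length w" using \<open>real t \<le> x\<close> False \<open>x \<le> real (length w)\<close> by linarith
    ultimately show ?thesis by (intro exI[of _ t]) auto
  qed
  then obtain t where t: "t < length w" "real t \<le> x" "x \<le> real t + 1" by blast
  show "x = real (time i j) + 1/2"
  proof (cases "t \<in> exchanges i j")
    case True
    have "pos w t i \<noteq> pos w t j" using ij by simp
    then have "1 - 2 * (x - real t) = 0" using wire_difference[OF True t(2,3)] eq by simp
    then show ?thesis using time_eqI[OF ij True] by simp
  next
    case False
    \<comment> \<open>Without an exchange the difference of the wires has the same sign at both ends
      of the step, and a convex combination of two such values does not vanish.\<close>
    define a b c d where "a = real (pos w t i)" and "b = real (pos w t j)"
      and "c = real (pos w (Suc t) i)" and "d = real (pos w (Suc t) j)"
    have "a \<noteq> b" "c \<noteq> d" using ij unfolding a_def b_def c_def d_def by simp_all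
    moreover have "a < b \<longleftrightarrow> c < d" using order_preserved[OF t(1) ij(3) False] unfolding a_def b_def c_def d_def by simp
    moreover define y where "y = x - real t"
    moreover have "(1 - y) * (a - b) + y * (c - d) = 0" "0 \<le> 1 - y" "0 \<le> y"
      using eq wire_between[OF t] t(2,3) unfolding a_def b_def c_def d_def y_def by (simp_all add: algebra_simps)
    moreover from this have "(1 - y) * (a - b) \<le> 0 \<and> y * (c - d) \<le> 0 \<or> 0 \<le> (1 - y) * (a - b) \<and> 0 \<le> y * (c - d)"
      using calculation(3) by (cases "a < b") (auto simp: mult_nonneg_nonpos)
    ultimately have "(1 - y) * (a - b) = 0" "y * (c - d) = 0" by linarith+
    then have False using \<open>a \<noteq> b\<close> \<open>c \<noteq> d\<close> by simp
    then show ?thesis by simp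
  qed
qed

text \<open>During the step in which two wires are exchanged their difference is linear and changes
  sign in the middle; hence the crossing at one half and the local injectivity.\<close>

sublocale graph_arrangement N wire "\<lambda>i j. real (time i j) + 1/2"
proof
  fix i show "continuous_on UNIV (wire i)" unfolding wire_def by (intro continuous_intros)
next
  fix i j x assume "i < N" "j < N" "i \<noteq> j"
  then show "wire i x = wire j x \<longleftrightarrow> x = real (time i j) + 1/2" by (rule wire_cross)
next
  fix i j k assume a: "i < N" "j < N" "k < N" "distinct [i, j, k]"
  show "real (time i j) + 1/2 \<noteq> real (time i k) + 1/2"
  proof
    assume "real (time i j) + 1/2 = real (time i k) + 1/2"
    then have "time i j = time i k" by simp
    then have "{i, j} = {i, k}" using exchanges_disjoint[of "time i j" i j i k] time_in[of i j] time_in[of i k] a by auto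
    then show False using a by (auto simp: doubleton_eq_iff)
  qed
next
  fix i j assume ij: "i < N" "j < N" "i \<noteq> j"
  let ?t = "time i j"
  have "inj_on (\<lambda>x. wire i x - wire j x) {real ?t + 1/2 - 1/2<..<real ?t + 1/2 + 1/2}"
  proof (rule inj_onI)
    fix x y assume x: "x \<in> {real ?t + 1/2 - 1/2<..<real ?t + 1/2 + 1/2}" and y: "y \<in> {real ?t + 1/2 - 1/2<..<real ?t + 1/2 + 1/2}"
      and eq: "wire i x - wire j x = wire i y - wire j y"
    have ne: "real (pos w ?t i) - real (pos w ?t j) \<noteq> 0" using ij by simp
    have "(real (pos w ?t i) - real (pos w ?t j)) * (1 - 2 * (x - real ?t)) = (real (pos w ?t i) - real (pos w ?t j)) * (1 - 2 * (y - real ?t))"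
      using wire_difference[OF time_in[OF ij], of x] wire_difference[OF time_in[OF ij], of y] eq x y by auto
    then have "1 - 2 * (x - real ?t) = 1 - 2 * (y - real ?t)" using ne by (metis mult_left_cancel)
    then show "x = y" by simp
  qed
  then show "\<exists>e>0. inj_on (\<lambda>x. wire i x - wire j x) {real ?t + 1/2 - e<..<real ?t + 1/2 + e}"
    by (intro exI[of _ "1/2"]) simp
qed

lemma pos_pred: "t < length w \<Longrightarrow> pos w t i = swp (w ! t) (pos w (Suc t) i)"
  using pos_Suc[of t w i] by simp

lemma wire_at: "p < N \<Longrightarrow> \<exists>i<N. pos w t i = p"
proof -
  assume p: "p < N"
  have "set (rev (take t w)) \<subseteq> {..<N - 1}" using letters set_take_subset[of t w] by auto
  then have "fold swp (rev (take t w)) p < N" using fold_swp_less p by blast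
  then show ?thesis using fold_swp_rev'[of "take t w" p] unfolding pos_def by blast
qed

lemma pos_stays:
  assumes "pos w s i = p" "s \<le> s'" "s' \<le> length w" "\<And>r. s \<le> r \<Longrightarrow> r < s' \<Longrightarrow> p \<noteq> w ! r \<and> p \<noteq> Suc (w ! r)"
  shows "pos w s' i = p"
  using assms(2,3,4)
proof (induction s' rule: dec_induct)
  case base
  then show ?case using assms(1) by simp
next
  case (step r)
  then have "pos w r i = p" by simp
  then show ?case using step pos_Suc[of r w i] by (auto simp: swp_def)
qed

end

section \<open>Triangles of a sorting network\<close>

text \<open>\<open>v\<close> is the rest of the word after a letter \<open>k\<close>: the face that
  opens there is closed by the next \<open>k\<close>, and \<open>y\<close> is its only other
  corner.\<close>

definition starts_triangle :: "nat \<Rightarrow> nat list \<Rightarrow> bool" where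
  "starts_triangle k v \<longleftrightarrow> (\<exists>us y vs ws. v = us @ y # vs @ k # ws \<and> (y = Suc k \<or> Suc y = k) \<and>
     (\<forall>z\<in>set us \<union> set vs. z \<noteq> k \<and> z \<noteq> Suc k \<and> Suc z \<noteq> k))"

context reversing_word
begin

text \<open>Three wires are followed. \<open>a\<close> keeps its height from the opening letter to
  the closing one; \<open>b\<close> keeps the other height of the face up to the letter
  \<open>y\<close>, where \<open>c\<close> takes it over. The remaining letters in between do not
  touch these heights.\<close>

lemma triangle_at:
  assumes t: "t < length w" and st: "starts_triangle (w ! t) (drop (Suc t) w)"
  shows "\<exists>R\<in>bounded_triangles lines. \<exists>x. real t + 1/2 < x \<and> (\<lambda>p. p $ 1) ` R = {real t + 1/2<..<x}"
proof -
  define k where "k = w ! t"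
  obtain us y vs ws where v: "drop (Suc t) w = us @ y # vs @ k # ws" and y: "y = Suc k \<or> Suc y = k"
    and far: "\<And>z. z \<in> set us \<union> set vs \<Longrightarrow> z \<noteq> k \<and> z \<noteq> Suc k \<and> Suc z \<noteq> k"
    using st unfolding starts_triangle_def k_def by blast
  define t3 t2 where "t3 = Suc t + length us" and "t2 = Suc t3 + length vs"
  have nth: "w ! (Suc t + r) = (us @ y # vs @ k # ws) ! r" for r
    using t v by (metis Suc_leI nth_drop)
  have lenw: "length w = Suc t + length (us @ y # vs @ k # ws)" using t v by (metis Suc_leI length_drop le_add_diff_inverse)
  have t2l: "t2 < length w" "t < t3" "t3 < t2" unfolding lenw t2_def t3_def by auto
  have w3: "w ! t3 = y" using nth[of "length us"] unfolding t3_def by simp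
  have w2: "w ! t2 = k" using nth[of "length us + Suc (length vs)"] unfolding t2_def t3_def by (simp add: nth_append add.assoc)
  have wr: "w ! s \<noteq> k \<and> w ! s \<noteq> Suc k \<and> Suc (w ! s) \<noteq> k" if s: "t < s" "s < t2" "s \<noteq> t3" for s
  proof (cases "s < t3")
    case True
    define r where "r = s - Suc t"
    have r: "s = Suc t + r" "r < length us" using s True unfolding r_def t3_def by auto
    have "w ! s = us ! r" unfolding r(1) nth using r(2) by (simp add: nth_append)
    then show ?thesis using far[of "us ! r"] r(2) by simp
  next
    case False
    define r where "r = s - Suc t3"
    have r: "s = Suc t + (length us + Suc r)" "r < length vs" using s False unfolding r_def t3_def t2_def by auto
    have "w ! s = vs ! r" unfolding r(1) nth using r(2) by (simp add: nth_append)
    then show ?thesis using far[of "vs ! r"] r(2) by simp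
  qed
  have "k \<in> set w" "y \<in> set w" using t t2l w3 nth_mem[of t w] nth_mem[of t3 w] unfolding k_def by auto
  then have "k < N - 1" "y < N - 1" using letters by auto
  then have kN: "Suc k < N" and yN: "Suc y < N" by linarith+
  \<comment> \<open>\<open>\<alpha>\<close> is the height of the face that \<open>y\<close> leaves
    alone, \<open>\<beta>\<close> the one that \<open>y\<close> exchanges, and
    \<open>\<gamma>\<close> the height outside the face from which the third wire comes.\<close>
  define \<alpha> \<beta> \<gamma> where "\<alpha> = (if y = Suc k then k else Suc k)" and "\<beta> = (if y = Suc k then Suc k else k)"
    and "\<gamma> = (if y = Suc k then Suc (Suc k) else y)"
  have ab: "{\<alpha>, \<beta>} = {k, Suc k}" "\<alpha> \<noteq> \<beta>" and bg: "{\<beta>, \<gamma>} = {y, Suc y}" "\<beta> \<noteq> \<gamma>" and ag: "\<alpha> \<noteq> \<gamma>" "\<alpha> \<noteq> y" "\<alpha> \<noteq> Suc y"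
    using y unfolding \<alpha>_def \<beta>_def \<gamma>_def by auto
  have lt: "\<alpha> < N" "\<beta> < N" "\<gamma> < N" using kN yN y unfolding \<alpha>_def \<beta>_def \<gamma>_def by auto
  obtain a b c where abc: "a < N" "b < N" "c < N" and pa: "pos w (Suc t) a = \<alpha>" and pb: "pos w (Suc t) b = \<beta>" and pc: "pos w t3 c = \<gamma>"
    using wire_at lt by metis
  have off: "\<delta> \<noteq> w ! s \<and> \<delta> \<noteq> Suc (w ! s)" if "t < s" "s < t2" "s \<noteq> t3" "\<delta> = \<alpha> \<or> \<delta> = \<beta>" for s \<delta>
    using wr[OF that(1-3)] that(4) ab(1) by (auto simp: doubleton_eq_iff)
  have a_at: "pos w s a = \<alpha>" if "t < s" "s \<le> t2" for s
  proof (rule pos_stays[OF pa])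
    fix r assume r: "Suc t \<le> r" "r < s"
    show "\<alpha> \<noteq> w ! r \<and> \<alpha> \<noteq> Suc (w ! r)"
      using off[of r \<alpha>] r that ag w3 by (cases "r = t3") auto
  qed (use that t2l in auto)
  have b_at: "pos w s b = \<beta>" if "t < s" "s \<le> t3" for s
  proof (rule pos_stays[OF pb])
    fix r assume r: "Suc t \<le> r" "r < s"
    show "\<beta> \<noteq> w ! r \<and> \<beta> \<noteq> Suc (w ! r)" using off[of r \<beta>] r that t2l by auto
  qed (use that t2l in auto)
  have "pos w (Suc t3) c = swp y \<gamma>" using pos_Suc[of t3 w c] t2l w3 pc by simp
  also have "\<dots> = \<beta>" using bg by (auto simp: swp_def doubleton_eq_iff)
  finally have pc': "pos w (Suc t3) c = \<beta>" .
  have c_at: "pos w s c = \<beta>" if "t3 < s" "s \<le> t2" for s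
  proof (rule pos_stays[OF pc'])
    fix r assume r: "Suc t3 \<le> r" "r < s"
    show "\<beta> \<noteq> w ! r \<and> \<beta> \<noteq> Suc (w ! r)" using off[of r \<beta>] r that t2l by auto
  qed (use that t2l in auto)
  have ne: "a \<noteq> b" "b \<noteq> c" "a \<noteq> c"
  proof -
    show "a \<noteq> b" using pa pb ab by auto
    show "b \<noteq> c" using b_at[of t3] pc bg t2l by auto
    show "a \<noteq> c" using a_at[of t3] pc ag t2l by auto
  qed
  have "pos w t a = swp k \<alpha>" "pos w t b = swp k \<beta>"
    using pos_pred[OF t, of a] pos_pred[OF t, of b] pa pb unfolding k_def by simp_all
  moreover have "{swp k \<alpha>, swp k \<beta>} = {k, Suc k}" using ab by (auto simp: swp_def doubleton_eq_iff)
  ultimately have "t \<in> exchanges a b" unfolding exchanges_def k_def using t by simp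
  then have T1: "time a b = t" using time_eqI abc ne by blast
  have "t3 \<in> exchanges b c" unfolding exchanges_def using t2l w3 pc b_at[of t3] bg by auto
  then have T3: "time b c = t3" using time_eqI abc ne by blast
  have "t2 \<in> exchanges a c" unfolding exchanges_def using t2l w2 a_at[of t2] c_at[of t2] ab by auto
  then have T2: "time a c = t2" using time_eqI abc ne by blast
  have free: "time a d \<notin> {t<..<t2} \<and> time b d \<notin> {t<..<t3} \<and> time c d \<notin> {t3<..<t2}" if d: "d < N" "d \<notin> {a, b, c}" for d
  proof -
    have ex: "pos w (time i d) i = w ! time i d \<or> pos w (time i d) i = Suc (w ! time i d)" if "i < N" "i \<noteq> d" for i
      using time_in[OF that(1) d(1) that(2)] unfolding exchanges_def by (auto simp: doubleton_eq_iff)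
    have "time a d \<notin> {t<..<t2}"
    proof
      assume m: "time a d \<in> {t<..<t2}"
      then have p: "pos w (time a d) a = \<alpha>" using a_at[of "time a d"] by auto
      show False
      proof (cases "time a d = t3")
        case True
        then show False using ex[of a] p ag w3 d abc by auto
      next
        case False
        then show False using ex[of a] p off[of "time a d" \<alpha>] m d abc by auto
      qed
    qed
    moreover have "time b d \<notin> {t<..<t3}"
    proof
      assume m: "time b d \<in> {t<..<t3}"
      then show False using ex[of b] b_at[of "time b d"] off[of "time b d" \<beta>] t2l d abc by auto
    qed
    moreover have "time c d \<notin> {t3<..<t2}"
    proof
      assume m: "time c d \<in> {t3<..<t2}"
      then show False using ex[of c] c_at[of "time c d"] off[of "time c d" \<beta>] t2l d abc by auto
    qed
    ultimately show ?thesis by blast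
  qed
  have "\<exists>R\<in>bounded_triangles lines. (\<lambda>p. p $ 1) ` R = {real (time a b) + 1/2<..<real (time a c) + 1/2}"
  proof (rule triangle_band[OF abc])
    show "distinct [a, b, c]" using ne by simp
    show "real (time a b) + 1/2 < real (time b c) + 1/2" "real (time b c) + 1/2 < real (time a c) + 1/2"
      using T1 T2 T3 t2l by auto
    show "real (time a d) + 1/2 \<notin> {real (time a b) + 1/2<..<real (time a c) + 1/2} \<and>
        real (time b d) + 1/2 \<notin> {real (time a b) + 1/2<..<real (time b c) + 1/2} \<and>
        real (time c d) + 1/2 \<notin> {real (time b c) + 1/2<..<real (time a c) + 1/2}" if "d < N" "d \<notin> {a, b, c}" for d
      using free[OF that] unfolding T1 T2 T3 by auto
  qed
  moreover have "real t + 1/2 < real t2 + 1/2" using t2l by simp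
  ultimately show ?thesis unfolding T1 T2 by blast
qed

text \<open>The abscissas of the triangle that opens at letter \<open>t\<close> have infimum
  \<open>t + 1/2\<close>, so different letters give different triangles.\<close>

lemma triangle_count: "card {t. t < length w \<and> starts_triangle (w ! t) (drop (Suc t) w)} \<le> a3 lines"
proof -
  let ?S = "{t. t < length w \<and> starts_triangle (w ! t) (drop (Suc t) w)}"
  have "\<forall>t\<in>?S. \<exists>R. R \<in> bounded_triangles lines \<and> (\<exists>x. real t + 1/2 < x \<and> (\<lambda>p. p $ 1) ` R = {real t + 1/2<..<x})"
    using triangle_at by blast
  then obtain R where R: "\<forall>t\<in>?S. R t \<in> bounded_triangles lines \<and> (\<exists>x. real t + 1/2 < x \<and> (\<lambda>p. p $ 1) ` R t = {real t + 1/2<..<x})"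
    by (rule bchoice[THEN exE])
  have Inf: "Inf ((\<lambda>p. p $ 1) ` R t) = real t + 1/2" if tS: "t \<in> ?S" for t
  proof -
    obtain x where x: "real t + 1/2 < x" "(\<lambda>p. p $ 1) ` R t = {real t + 1/2<..<x}" using bspec[OF R tS] by blast
    show ?thesis unfolding x(2) using x(1) by (rule cInf_greaterThanLessThan)
  qed
  have "inj_on R ?S"
  proof (rule inj_onI)
    fix s t assume "s \<in> ?S" "t \<in> ?S" "R s = R t"
    then have "real s + 1/2 = real t + 1/2" using Inf by metis
    then show "s = t" by simp
  qed
  moreover have "R ` ?S \<subseteq> bounded_triangles lines" using R by blast
  ultimately show ?thesis unfolding a3_def using finite_triangles[OF simple_lines] by (rule card_inj_on_le)
qed

end

section \<open>Alternating words\<close>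

text \<open>The face between two consecutive letters \<open>k\<close> is a triangle iff exactly one letter \<open>k - 1\<close> or \<open>k + 1\<close> occurs
  between them, so only the subword of these letters matters.\<close>

definition proj :: "nat \<Rightarrow> nat list \<Rightarrow> bool list" where
  "proj k w = map (\<lambda>x. x = k) (filter (\<lambda>x. x = k \<or> x = Suc k \<or> Suc x = k) w)"

definition alt :: "nat \<Rightarrow> bool list" where "alt g = concat (replicate g [True, False])"

abbreviation falses :: "nat \<Rightarrow> bool list" where "falses a \<equiv> replicate a False"

lemma proj_Nil [simp]: "proj k [] = []"
  and proj_Cons: "proj k (x # w) = (if x = k then [True] else if x = Suc k \<or> Suc x = k then [False] else []) @ proj k w"
  and proj_append [simp]: "proj k (v @ w) = proj k v @ proj k w"
  and proj_rev [simp]: "proj k (rev w) = rev (proj k w)"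
  by (auto simp: proj_def rev_filter rev_map)

lemma alt_0 [simp]: "alt 0 = []" and alt_Suc: "alt (Suc g) = True # False # alt g"
  by (simp_all add: alt_def)

lemma alt_append: "alt g @ alt h = alt (g + h)"
  by (simp add: alt_def replicate_add)

lemma alt_snoc: "alt g @ [True, False] = alt (Suc g)"
  using alt_append[of g 1] by (simp add: alt_def)

lemma alt_join: "alt g @ True # False # alt h = alt (Suc (g + h))"
  using alt_append[of g "Suc h"] by (simp add: alt_Suc)

lemma alt_join': "alt g @ True # False # alt h @ xs = alt (Suc (g + h)) @ xs"
  using alt_join[of g h] by simp

lemma rev_alt: "rev (alt g @ xs) = rev xs @ concat (replicate g [False, True])"
  by (induction g) (simp_all add: alt_Suc replicate_append_same[symmetric])

lemma rev_alt_True: "True # concat (replicate g [False, True]) = alt g @ [True]"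
  by (induction g) (simp_all add: alt_Suc)

text \<open>Occurrences of \<open>True\<close>, \<open>False\<close>, \<open>True\<close> are
  counted with overlaps, since the letter that closes a triangle may open the next.\<close>

fun triangle_pattern_count :: "bool list \<Rightarrow> nat" where
  "triangle_pattern_count [] = 0"
| "triangle_pattern_count (b # bs) = (if b \<and> take 2 bs = [False, True] then 1 else 0) + triangle_pattern_count bs"

lemma triangle_pattern_count_alt: "triangle_pattern_count (falses a @ alt g @ True # falses b) = g"
proof (induction a)
  case 0
  have f: "triangle_pattern_count (falses b) = 0" for b by (induction b) auto
  have t: "take 2 (falses b) \<noteq> [False, True]" for b
    by (cases b; cases "b - 1") (auto simp: numeral_2_eq_2)
  show ?case
  proof (induction g)
    case 0
    then show ?case using f t by simp
  next
    case (Suc g)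
    then show ?case by (cases g) (simp_all add: alt_Suc)
  qed
qed simp

lemma length_filter_proj: "length (filter id (proj k w)) = count_list w k"
  by (induction w) (auto simp: proj_Cons)

lemma proj_starts_triangle:
  assumes "take 2 (proj k v) = [False, True]"
  shows "starts_triangle k v"
proof -
  let ?P = "\<lambda>x. x = k \<or> x = Suc k \<or> Suc x = k"
  obtain ys where ys: "map (\<lambda>x. x = k) (filter ?P v) = False # True # ys"
    using assms unfolding proj_def by (metis (no_types, lifting) append_Cons append_Nil append_take_drop_id)
  then obtain y z zs where f: "filter ?P v = y # z # zs" "y \<noteq> k" "z = k" by (auto simp: map_eq_Cons_conv)
  obtain us r where us: "v = us @ y # r" "\<forall>u\<in>set us. \<not> ?P u" "?P y" "z # zs = filter ?P r"
    using filter_eq_ConsD[OF f(1)] by auto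
  obtain vs ws where vs: "r = vs @ z # ws" "\<forall>u\<in>set vs. \<not> ?P u"
    using filter_eq_ConsD[OF us(4)[symmetric]] by auto
  show ?thesis unfolding starts_triangle_def
    by (rule exI[of _ us], rule exI[of _ y], rule exI[of _ vs], rule exI[of _ ws]) (use us vs f in auto)
qed

definition triangle_positions :: "nat \<Rightarrow> nat list \<Rightarrow> nat set" where
  "triangle_positions k w = {t. t < length w \<and> w ! t = k \<and> starts_triangle k (drop (Suc t) w)}"

lemma triangle_positions_card: "triangle_pattern_count (proj k w) \<le> card (triangle_positions k w)"
proof (induction w)
  case (Cons x w)
  have fin: "finite (triangle_positions k w)" unfolding triangle_positions_def by simp
  have "triangle_positions k (x # w) =
      (if x = k \<and> starts_triangle k w then {0} else {}) \<union> Suc ` triangle_positions k w" (is "_ = ?R")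
  proof (rule set_eqI)
    fix t show "t \<in> triangle_positions k (x # w) \<longleftrightarrow> t \<in> ?R"
      unfolding triangle_positions_def by (cases t) auto
  qed
  then have "card (triangle_positions k (x # w)) =
      (if x = k \<and> starts_triangle k w then 1 else 0) + card (triangle_positions k w)"
    using fin by (simp add: card_image)
  moreover have "triangle_pattern_count (proj k (x # w)) \<le>
      (if x = k \<and> starts_triangle k w then 1 else 0) + triangle_pattern_count (proj k w)"
    using proj_starts_triangle[of k w] by (auto simp: proj_Cons)
  ultimately show ?case using Cons by linarith
qed simp

lemma even_letters_sum:
  "set w \<subseteq> {..<M :: nat} \<Longrightarrow> length (filter even w) = (\<Sum>k | even k \<and> k < M. count_list w k)"
proof (induction w)
  case (Cons x w)
  have "(\<Sum>k | even k \<and> k < M. count_list (x # w) k) = (\<Sum>k | even k \<and> k < M. (if x = k then 1 else 0) + count_list w k)"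
    by (intro sum.cong) auto
  also have "\<dots> = (if even x then 1 else 0) + (\<Sum>k | even k \<and> k < M. count_list w k)"
  proof -
    have "finite {k. even k \<and> k < M}" by simp
    then have "(\<Sum>k | even k \<and> k < M. if x = k then 1 else 0) = (if x \<in> {k. even k \<and> k < M} then 1 else 0 :: nat)"
      by (rule sum.delta')
    then show ?thesis using Cons.prems by (simp add: sum.distrib)
  qed
  finally show ?case using Cons by simp
qed simp

text \<open>At an even height, g + 1 letters in perfect alternation with their neighbours enclose g
  triangles, so only one even letter per height is lost.\<close>

lemma (in reversing_word) alternating_triangles:
  assumes pat: "\<And>k. even k \<Longrightarrow> k < N - 1 \<Longrightarrow> \<exists>a g b. proj k w = falses a @ alt g @ True # falses b"
  shows "length (filter even w) \<le> a3 lines + card {k. even k \<and> k < N - 1}"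
proof -
  let ?E = "{k. even k \<and> k < N - 1}"
  have fin: "finite ?E" by simp
  have c: "count_list w k \<le> card (triangle_positions k w) + 1" if k: "k \<in> ?E" for k
  proof -
    obtain a g b where p: "proj k w = falses a @ alt g @ True # falses b" using pat k by blast
    have "length (filter id (alt g)) = g" by (induction g) (simp_all add: alt_Suc)
    then have "count_list w k = g + 1" using length_filter_proj[of k w] unfolding p by simp
    then show ?thesis using triangle_positions_card[of k w] unfolding p triangle_pattern_count_alt by simp
  qed
  have "length (filter even w) \<le> (\<Sum>k\<in>?E. card (triangle_positions k w) + 1)"
    unfolding even_letters_sum[OF letters] by (intro sum_mono c) auto
  also have "\<dots> = (\<Sum>k\<in>?E. card (triangle_positions k w)) + card ?E" by (simp only: sum.distrib) simp
  also have "(\<Sum>k\<in>?E. card (triangle_positions k w)) = card (\<Union>k\<in>?E. triangle_positions k w)"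
    by (rule card_UN_disjoint[symmetric]) (auto simp: triangle_positions_def)
  also have "\<dots> \<le> card {t. t < length w \<and> starts_triangle (w ! t) (drop (Suc t) w)}"
    by (rule card_mono) (auto simp: triangle_positions_def)
  also have "\<dots> \<le> a3 lines" by (rule triangle_count)
  finally show ?thesis by simp
qed

section \<open>Projections of composite words\<close>

lemma proj_upt_far: "j \<le> k - 1 \<or> Suc k < i \<Longrightarrow> proj k [i..<j] = []"
  by (auto simp: proj_def filter_empty_conv)

lemma proj_shift: "c \<le> k \<Longrightarrow> proj k (map (\<lambda>x. x + c) w) = proj (k - c) w"
  by (induction w) (auto simp: proj_Cons)

lemma proj_shift_far: "Suc k < c \<Longrightarrow> proj k (map (\<lambda>x. x + c) w) = []"
  by (induction w) (auto simp: proj_Cons)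

lemma proj_far: "\<forall>x\<in>set w. x \<noteq> k \<and> x \<noteq> Suc k \<and> Suc x \<noteq> k \<Longrightarrow> proj k w = []"
  by (induction w) (auto simp: proj_Cons)

lemma proj_flip:
  assumes "set w \<subseteq> {1..<c}" "1 \<le> k" "k < c"
  shows "proj k (map (\<lambda>x. c - x) w) = proj (c - k) w"
  using assms by (induction w) (auto simp: proj_Cons)

lemma proj_upt:
  assumes "Suc k < j" "i < k"
  shows "proj k [i..<j] = [False, True, False]"
proof -
  have "[i..<j] = [i..<k - 1] @ [k - 1..<j]" using assms upt_add_eq_append[of i "k - 1" "j - (k - 1)"] by simp
  moreover have "[k - 1..<j] = [k - 1, k, Suc k] @ [Suc (Suc k)..<j]"
    using assms by (simp add: upt_conv_Cons Suc_lessD)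
  ultimately have "proj k [i..<j] = proj k [i..<k - 1] @ proj k [k - 1, k, Suc k] @ proj k [Suc (Suc k)..<j]"
    by (simp only: proj_append)
  then show ?thesis using assms by (simp add: proj_upt_far) (simp add: proj_Cons)
qed

lemma proj_upt_start:
  assumes "Suc k < j"
  shows "proj k [k..<j] = [True, False]"
proof -
  have "[k..<j] = [k, Suc k] @ [Suc (Suc k)..<j]" using assms by (simp add: upt_conv_Cons Suc_lessD)
  then have "proj k [k..<j] = proj k [k, Suc k] @ proj k [Suc (Suc k)..<j]" by (simp only: proj_append)
  then show ?thesis by (simp add: proj_upt_far) (simp add: proj_Cons)
qed

lemma proj_upt_below:
  assumes "i < k"
  shows "proj k [i..<k] = [False]"
proof -
  have "[i..<k] = [i..<k - 1] @ [k - 1]" using assms upt_Suc_append[of i "k - 1"] by simp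
  then have "proj k [i..<k] = proj k [i..<k - 1] @ proj k [k - 1]" by simp
  then show ?thesis using assms by (simp add: proj_upt_far) (simp add: proj_Cons)
qed

lemma proj_upt_end:
  assumes "i < k"
  shows "proj k [i..<Suc k] = [False, True]"
  using assms proj_upt_below[OF assms] by (simp add: proj_Cons)

section \<open>Permutations of composite words\<close>

lemma fold_upt: "a \<le> b \<Longrightarrow> fold swp [a..<b] p = (if p = a then b else if a < p \<and> p \<le> b then p - 1 else p)"
proof (induction b rule: dec_induct)
  case (step b)
  then show ?case by (auto simp: swp_def)
qed auto

lemma fold_rev_upt:
  assumes "a \<le> b"
  shows "fold swp (rev [a..<b]) p = (if p = b then a else if a \<le> p \<and> p < b then p + 1 else p)" (is "_ = ?q")
proof -
  have "fold swp [a..<b] ?q = p" unfolding fold_upt[OF assms] using assms by auto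
  then show ?thesis using fold_swp_rev[of "[a..<b]" ?q] by (simp only:)
qed

lemma fold_shift: "fold swp (map (\<lambda>x. x + c) w) (p + c) = fold swp w p + c"
proof (induction w arbitrary: p)
  case (Cons x w)
  have "swp (x + c) (p + c) = swp x p + c" by (simp add: swp_def)
  then show ?case using Cons by simp
qed simp

lemma fold_fixed: "\<forall>x\<in>set w. p \<noteq> x \<and> p \<noteq> Suc x \<Longrightarrow> fold swp w p = p"
  by (induction w) (auto simp: swp_def)

lemma fold_range:
  assumes "set w \<subseteq> {a..<b}" "a \<le> p" "p \<le> b"
  shows "a \<le> fold swp w p \<and> fold swp w p \<le> b"
  using assms by (induction w arbitrary: p) (auto simp: swp_def)

lemma fold_flip:
  assumes "set w \<subseteq> {1..<c}" "1 \<le> p" "p \<le> c"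
  shows "fold swp (map (\<lambda>x. c - x) w) (c + 1 - p) = c + 1 - fold swp w p"
  using assms
proof (induction w arbitrary: p)
  case (Cons x w)
  have "swp (c - x) (c + 1 - p) = c + 1 - swp x p" "1 \<le> swp x p" "swp x p \<le> c"
    using Cons.prems by (auto simp: swp_def)
  then show ?case using Cons by simp
qed simp

text \<open>\<open>stairs m m\<close> are the crossings of the sides and axes of the regular polygon on one side of its centre, with the
  first axis left out: it moves the axes, which start at the even heights, above the sides.\<close>

fun stair :: "nat \<Rightarrow> nat \<Rightarrow> nat list" where
  "stair 0 lo = [lo]"
| "stair (Suc g) lo = [lo + 2 * g + 2, lo + 2 * g, lo + 2 * g + 1] @ stair g lo"

definition stairs :: "nat \<Rightarrow> nat \<Rightarrow> nat list" where
  "stairs m r = concat (map (\<lambda>s. stair (2 * (m - 1 - s)) (2 * s + 2)) [0..<r])"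

lemma stairs_0 [simp]: "stairs m 0 = []"
  and stairs_Suc: "stairs m (Suc r) = stairs m r @ stair (2 * (m - 1 - r)) (2 * r + 2)"
  by (simp_all add: stairs_def)

lemma set_stair: "set (stair g lo) \<subseteq> {lo..lo + 2 * g}"
  by (induction g) auto

lemma set_stairs: "r \<le> m \<Longrightarrow> set (stairs m r) \<subseteq> {2..<4 * m - 1}"
proof (induction r)
  case (Suc r)
  have "set (stair (2 * (m - 1 - r)) (2 * r + 2)) \<subseteq> {2..<4 * m - 1}"
    using set_stair[of "2 * (m - 1 - r)" "2 * r + 2"] Suc.prems by force
  then show ?case using Suc by (simp add: stairs_Suc)
qed simp

text \<open>One side falls from the top height to \<open>lo\<close> through axes and sides in
  alternation. It meets each lower side on an axis: the letters x, x + 1, x, the last of which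
  begins the rest of the stair, resolve this triple point into a triangle, and the axis rises past
  both sides. The topmost axis meets the falling side alone and rises by one.\<close>

lemma fold_stair:
  "even lo \<Longrightarrow> fold swp (stair g lo) p = (if even p \<and> lo \<le> p \<and> p < lo + 2 * g then p + 2 else if p = lo + 2 * g then p + 1
     else if p = lo + 2 * g + 1 then lo else p)"
proof (induction g arbitrary: p)
  case 0
  then show ?case by (auto simp: swp_def)
next
  case (Suc g)
  define q where "q = fold swp [lo + 2 * g + 2, lo + 2 * g, lo + 2 * g + 1] p"
  have q: "q = (if p = lo + 2 * g then lo + 2 * g + 2 else if p = lo + 2 * g + 1 then lo + 2 * g
     else if p = lo + 2 * g + 2 then lo + 2 * g + 3 else if p = lo + 2 * g + 3 then lo + 2 * g + 1 else p)"
    unfolding q_def by (auto simp: swp_def)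
  have "fold swp (stair (Suc g) lo) p = fold swp (stair g lo) q" unfolding q_def by simp
  also have "\<dots> = (if even q \<and> lo \<le> q \<and> q < lo + 2 * g then q + 2 else if q = lo + 2 * g then q + 1
     else if q = lo + 2 * g + 1 then lo else q)" using Suc by blast
  also have "\<dots> = (if even p \<and> lo \<le> p \<and> p < lo + 2 * Suc g then p + 2 else if p = lo + 2 * Suc g then p + 1
     else if p = lo + 2 * Suc g + 1 then lo else p)"
  proof -
    consider "p < lo + 2 * g" | "p = lo + 2 * g" | "p = lo + 2 * g + 1" | "p = lo + 2 * g + 2" | "p = lo + 2 * g + 3" | "p > lo + 2 * g + 3"
      by linarith
    then show ?thesis using Suc.prems by cases (auto simp: q)
  qed
  finally show ?case .
qed

lemma fold_stair_cases:
  assumes "even lo"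
  shows "p < lo \<Longrightarrow> fold swp (stair g lo) p = p" "lo + 2 * g + 1 < p \<Longrightarrow> fold swp (stair g lo) p = p"
    "odd p \<Longrightarrow> p \<noteq> lo + 2 * g + 1 \<Longrightarrow> fold swp (stair g lo) p = p" "p = lo + 2 * g + 1 \<Longrightarrow> fold swp (stair g lo) p = lo"
    "p = lo + 2 * g \<Longrightarrow> fold swp (stair g lo) p = p + 1"
    "even p \<Longrightarrow> lo \<le> p \<Longrightarrow> p < lo + 2 * g \<Longrightarrow> fold swp (stair g lo) p = p + 2"
  using assms by (simp_all add: fold_stair) auto

text \<open>Each round brings down the highest side not yet moved; the sides below it return to
  their heights, and later rounds work above the height where it arrives.\<close>

lemma fold_stairs_odd:
  assumes "r \<le> m" "q < 2 * m"
  shows "fold swp (stairs m r) (2 * q + 1) = (if 2 * m \<le> q + r then 4 * m - 2 * q else 2 * q + 1)"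
  using assms(1)
proof (induction r)
  case 0
  then show ?case using assms by simp
next
  case (Suc r)
  define d where "d = m - 1 - r"
  have m: "m = d + 1 + r" using Suc.prems unfolding d_def by simp
  have e: "even (2 * r + 2)" by simp
  have "fold swp (stairs m (Suc r)) (2 * q + 1)
      = fold swp (stair (2 * d) (2 * r + 2)) (if 2 * m \<le> q + r then 4 * m - 2 * q else 2 * q + 1)"
    using Suc unfolding stairs_Suc d_def by simp
  also have "\<dots> = (if 2 * m \<le> q + Suc r then 4 * m - 2 * q else 2 * q + 1)"
  proof -
    consider "2 * m \<le> q + r" | "2 * m = q + Suc r" | "q + Suc r < 2 * m" by linarith
    then show ?thesis
    proof cases
      case 1
      then have "4 * m - 2 * q < 2 * r + 2" by linarith
      then show ?thesis using 1 fold_stair_cases(1)[OF e] by simp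
    next
      case 2
      then have "2 * q + 1 = 2 * r + 2 + 2 * (2 * d) + 1" "4 * m - 2 * q = 2 * r + 2" using m by linarith+
      then show ?thesis using 2 fold_stair_cases(4)[OF e, of "2 * q + 1" "2 * d"] by simp
    next
      case 3
      then have "2 * q + 1 \<noteq> 2 * r + 2 + 2 * (2 * d) + 1" using m by linarith
      then show ?thesis using 3 fold_stair_cases(3)[OF e, of "2 * q + 1" "2 * d"] by simp
    qed
  qed
  finally show ?case .
qed

text \<open>An axis rises by two heights per round until it reaches \<open>2 * m + q\<close>, or by
  a single one where it is the topmost axis of the round; from then on the rounds work below
  it.\<close>

lemma fold_stairs_even:
  assumes "r \<le> m" "1 \<le> q" "q \<le> 2 * m"
  shows "fold swp (stairs m r) (2 * q) = min (2 * r + 2 * q) (2 * m + q)"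
  using assms(1)
proof (induction r)
  case 0
  then show ?case using assms by simp
next
  case (Suc r)
  define d where "d = m - 1 - r"
  have m: "m = d + 1 + r" using Suc.prems unfolding d_def by simp
  have e: "even (2 * r + 2)" by simp
  have "fold swp (stairs m (Suc r)) (2 * q) = fold swp (stair (2 * d) (2 * r + 2)) (min (2 * r + 2 * q) (2 * m + q))"
    using Suc unfolding stairs_Suc d_def by simp
  also have "\<dots> = min (2 * Suc r + 2 * q) (2 * m + q)"
  proof -
    consider "q + 2 * r + 2 \<le> 2 * m" | "q + 2 * r + 1 = 2 * m" | "2 * m \<le> q + 2 * r" by linarith
    then show ?thesis
    proof cases
      case 1
      then have "min (2 * r + 2 * q) (2 * m + q) = 2 * r + 2 * q" "min (2 * Suc r + 2 * q) (2 * m + q) = 2 * r + 2 * q + 2"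
        by auto
      moreover have "2 * r + 2 * q < 2 * r + 2 + 2 * (2 * d)" "2 * r + 2 \<le> 2 * r + 2 * q" using 1 m assms(2) by linarith+
      ultimately show ?thesis using fold_stair_cases(6)[OF e, of "2 * r + 2 * q" "2 * d"] by simp
    next
      case 2
      then have "min (2 * r + 2 * q) (2 * m + q) = 2 * r + 2 + 2 * (2 * d)"
        "min (2 * Suc r + 2 * q) (2 * m + q) = 2 * r + 2 + 2 * (2 * d) + 1" using m by auto
      then show ?thesis using fold_stair_cases(5)[OF e, of "2 * r + 2 + 2 * (2 * d)" "2 * d"] by simp
    next
      case 3
      then have "min (2 * r + 2 * q) (2 * m + q) = 2 * m + q" "min (2 * Suc r + 2 * q) (2 * m + q) = 2 * m + q" by auto
      moreover have "2 * r + 2 + 2 * (2 * d) + 1 < 2 * m + q" using 3 m by linarith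
      ultimately show ?thesis using fold_stair_cases(2)[OF e, of "2 * d" "2 * m + q"] by simp
    qed
  qed
  finally show ?case .
qed

lemma length_stair: "length (stair g lo) = 3 * g + 1"
  by (induction g) auto

lemma evens_stair: "even lo \<Longrightarrow> length (filter even (stair g lo)) = 2 * g + 1"
  by (induction g) auto

lemma length_stairs: "r \<le> m \<Longrightarrow> length (stairs m r) + 3 * (r * r) + 2 * r = 6 * (m * r)"
proof (induction r)
  case (Suc r)
  define d where "d = m - 1 - r"
  have m: "m = d + 1 + r" using Suc.prems unfolding d_def by simp
  have "length (stairs m (Suc r)) = length (stairs m r) + 6 * d + 1"
    by (simp add: stairs_Suc length_stair d_def)
  then show ?case using Suc unfolding m by (simp add: algebra_simps)
qed simp

lemma evens_stairs: "r \<le> m \<Longrightarrow> length (filter even (stairs m r)) + 2 * (r * r) + r = 4 * (m * r)"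
proof (induction r)
  case (Suc r)
  define d where "d = m - 1 - r"
  have m: "m = d + 1 + r" using Suc.prems unfolding d_def by simp
  have "length (filter even (stairs m (Suc r))) = length (filter even (stairs m r)) + 4 * d + 1"
    by (simp add: stairs_Suc evens_stair d_def)
  then show ?case using Suc unfolding m by (simp add: algebra_simps)
qed simp

lemma proj_stair:
  assumes "even lo" "even k"
  shows "\<exists>h. proj k (stair g lo) = alt h @ (if k = lo then [True] else [])"
proof (induction g)
  case 0
  have "Suc k \<noteq> lo" "Suc lo \<noteq> k" using assms by auto
  then show ?case by (intro exI[of _ 0]) (auto simp: proj_Cons)
next
  case (Suc g)
  then obtain h where h: "proj k (stair g lo) = alt h @ (if k = lo then [True] else [])" by blast
  have "proj k [lo + 2 * g + 2, lo + 2 * g, lo + 2 * g + 1] = (if k = lo + 2 * g + 2 \<or> k = lo + 2 * g then [True, False] else [])"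
    using assms by (auto simp: proj_Cons) presburger+
  then have "proj k (stair (Suc g) lo) = alt (if k = lo + 2 * g + 2 \<or> k = lo + 2 * g then Suc h else h) @ (if k = lo then [True] else [])"
    by (simp only: stair.simps proj_append h) (simp add: alt_Suc)
  then show ?case by blast
qed

text \<open>Within a round an even letter and its neighbours come in complete \<open>True\<close>,
  \<open>False\<close> pairs. Only the lowest letter of a round ends with a lone
  \<open>True\<close>, and later rounds do not come near it again.\<close>

lemma proj_stairs:
  assumes "even k"
  shows "\<exists>h. proj k (stairs m r) = alt h @ (if 2 \<le> k \<and> k \<le> 2 * r then [True] else [])"
proof (induction r)
  case 0
  then show ?case by (intro exI[of _ 0]) auto
next
  case (Suc r)
  then obtain h where h: "proj k (stairs m r) = alt h @ (if 2 \<le> k \<and> k \<le> 2 * r then [True] else [])" by blast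
  show ?case
  proof (cases "k < 2 * r + 2")
    case True
    then have "k \<le> 2 * r" using assms by presburger
    have "proj k (stair (2 * (m - 1 - r)) (2 * r + 2)) = []"
      using set_stair[of "2 * (m - 1 - r)" "2 * r + 2"] \<open>k \<le> 2 * r\<close> by (intro proj_far) fastforce
    then show ?thesis using h \<open>k \<le> 2 * r\<close> by (auto simp: stairs_Suc)
  next
    case False
    obtain h' where h': "proj k (stair (2 * (m - 1 - r)) (2 * r + 2)) = alt h' @ (if k = 2 * r + 2 then [True] else [])"
      using proj_stair[of "2 * r + 2" k "2 * (m - 1 - r)"] assms by auto
    have "proj k (stairs m (Suc r)) = alt (h + h') @ (if 2 \<le> k \<and> k \<le> 2 * Suc r then [True] else [])"
      using h h' False by (auto simp: stairs_Suc alt_append[symmetric])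
    then show ?thesis by blast
  qed
qed

section \<open>Doubling\<close>

lemma alt_True_append: "alt g @ True # concat (replicate h [False, True]) = alt (g + h) @ [True]"
  by (simp add: rev_alt_True alt_append[symmetric])

abbreviation evens :: "nat list \<Rightarrow> nat" where "evens w \<equiv> length (filter even w)"

lemma card_evens: "card {k. even k \<and> k < 2 * m} = (m :: nat)"
proof -
  have "{k. even k \<and> k < 2 * m} = (*) 2 ` {..<m}" by (auto elim: evenE)
  then show ?thesis by (simp add: card_image inj_on_def)
qed

lemma evens_upt: "evens [0..<2 * m] = m"
  by (induction m) auto

lemma proj_even_letters:
  assumes "even k"
  shows "proj k (map ((*) 2) [0..<m]) = (if k < 2 * m then [True] else [])"
proof (induction m)
  case (Suc m)
  have "k \<noteq> Suc (2 * m)" "Suc k \<noteq> 2 * m" using assms by presburger+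
  then show ?case using Suc assms by (auto simp: proj_Cons)
qed simp

lemma fold_even_letters:
  "fold swp (map ((*) 2) [0..<m]) p = (if p < 2 * m then if even p then p + 1 else p - 1 else p)"
proof (induction m)
  case (Suc m)
  consider "p < 2 * m" | "p = 2 * m" | "p = 2 * m + 1" | "p > 2 * m + 1" by linarith
  then show ?case
  proof cases
    case 1
    define q where "q = (if even p then p + 1 else p - 1)"
    have "q < 2 * m" using 1 unfolding q_def by (auto elim!: evenE)
    then show ?thesis using Suc 1 by (simp add: swp_def q_def[symmetric])
  qed (use Suc in \<open>auto simp: swp_def\<close>)
qed simp

text \<open>The word \<open>U @ [0..<2 * m] @ V\<close> is a network of \<open>2 * m + 1\<close> wires, drawn so that its first wire crosses all
  others at once, \<open>U\<close> and \<open>V\<close> being the crossings on the two sides of that wire. Sending the first wire to infinity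
  makes the former line at infinity a wire, which gives the word \<open>odd_word\<close> below. There are \<open>d\<close> bounded segments
  of \<open>odd_word\<close> that belong to no triangle. They come from the \<open>a\<close> letters before the first \<open>k\<close> in \<open>V\<close> and the \<open>b\<close>
  letters after the last \<open>k\<close> in \<open>U\<close>, and are needed because \<open>n (n - 2)\<close> is no multiple of 3 for \<open>n = 7\<close>.
  The restrictions on \<open>a\<close> and \<open>b\<close> leave a half-plane at infinity in which a further line gains \<open>m\<close> triangles.\<close>

locale word_pair =
  fixes m d :: nat and U V :: "nat list"
  assumes m: "1 \<le> m" and V_set: "set V \<subseteq> {..<2 * m - 1}" and U_set: "set U \<subseteq> {2..<2 * m - 1}"
    and opposite: "\<And>i. 1 \<le> i \<Longrightarrow> i \<le> 2 * m \<Longrightarrow> fold swp V (fold swp U i - 1) = 2 * m - i"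
    and len: "length U + length V + m = 2 * (m * m)"
    and evens_count: "3 * (evens U + evens V) + d + 1 = 4 * (m * m)"
    and V_pat: "\<And>k. even k \<Longrightarrow> k < 2 * m \<Longrightarrow> \<exists>a g. proj k V = falses a @ alt g @ [True] \<and> (k + 2 = 2 * m \<longrightarrow> a = 0)"
    and U_pat: "\<And>k. even k \<Longrightarrow> 2 \<le> k \<Longrightarrow> k < 2 * m \<Longrightarrow> \<exists>g b. proj k U = alt g @ True # falses b \<and> (k + 4 \<le> 2 * m \<longrightarrow> b = 0)"
begin

section \<open>The doubled network\<close>

text \<open>The stairs carry the axes to the heights above \<open>2 * m\<close>, where they run
  through the smaller network \<open>U\<close>.\<close>

definition "U' = stairs m m @ map (\<lambda>x. x + 2 * m) U"
text \<open>Beyond the first axis, the letters 0, 2, ... exchange pairs of sides that are mirror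
  images in it, their common point on the axis being moved to this side. Then the axes run through
  \<open>V\<close>, and the rest is the mirror image of the stairs, preceded by the descent of the
  axis that had stayed on top.\<close>

definition "V' = map ((*) 2) [0..<m] @ map (\<lambda>x. x + 2 * m) V @ rev (stairs m m @ [0..<2 * m])"

lemma U'_pat:
  assumes k: "even k" "2 \<le> k" "k < 2 * (2 * m)"
  shows "\<exists>g b. proj k U' = alt g @ True # falses b \<and> (k + 4 \<le> 2 * (2 * m) \<longrightarrow> b = 0)"
proof -
  obtain h where h: "proj k (stairs m m) = alt h @ (if 2 \<le> k \<and> k \<le> 2 * m then [True] else [])"
    using proj_stairs[OF k(1)] by blast
  show ?thesis
  proof (cases "k \<le> 2 * m")
    case True
    have "proj k (map (\<lambda>x. x + 2 * m) U) = []"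
      using U_set True by (intro proj_far) fastforce
    then have "proj k U' = alt h @ True # falses 0" using h k True unfolding U'_def by simp
    then show ?thesis by blast
  next
    case False
    then have "even (k - 2 * m)" "2 \<le> k - 2 * m" "k - 2 * m < 2 * m" using k by presburger+
    then obtain g b where gb: "proj (k - 2 * m) U = alt g @ True # falses b" "k - 2 * m + 4 \<le> 2 * m \<longrightarrow> b = 0"
      using U_pat by blast
    have "proj k U' = alt (h + g) @ True # falses b"
      using h gb False proj_shift[of "2 * m" k U] unfolding U'_def by (simp add: alt_append[symmetric])
    moreover have "k + 4 \<le> 2 * (2 * m) \<longrightarrow> b = 0" using gb(2) False by linarith
    ultimately show ?thesis by blast
  qed
qed

text \<open>The pieces join without breaking the alternation. Below height \<open>2 * m\<close> the
  first piece gives a \<open>True\<close>, the descending axis a \<open>False\<close> on each side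
  of its own letter, and the mirrored stairs begin with a \<open>True\<close> or are preceded by
  one. From \<open>2 * m\<close> on, \<open>V\<close> ends with \<open>True\<close> and what
  follows, if anything, begins with \<open>False\<close>.\<close>

lemma V'_pat:
  assumes k: "even k" "k < 2 * (2 * m)"
  shows "\<exists>a g. proj k V' = falses a @ alt g @ [True] \<and> (k + 2 = 2 * (2 * m) \<longrightarrow> a = 0)"
proof -
  let ?FT = "\<lambda>h. concat (replicate h [False, True])"
  obtain h where h: "proj k (stairs m m) = alt h @ (if 2 \<le> k \<and> k \<le> 2 * m then [True] else [])"
    using proj_stairs[OF k(1)] by blast
  have split: "proj k V' = (if k < 2 * m then [True] else []) @ proj k (map (\<lambda>x. x + 2 * m) V) @
      rev (proj k [0..<2 * m]) @ (if 2 \<le> k \<and> k \<le> 2 * m then [True] else []) @ ?FT h"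
    unfolding V'_def by (simp add: proj_even_letters[OF k(1)] h rev_alt del: rev_append)
  consider "k = 0" | "2 \<le> k" "k < 2 * m" | "k = 2 * m" | "2 * m < k" using k(1) by fastforce
  then show ?thesis
  proof cases
    case 1
    have "proj k V' = [True, False, True] @ ?FT h"
      using split 1 m proj_upt_start[of 0 "2 * m"] by (simp add: proj_shift_far)
    also have "\<dots> = True # ?FT (Suc h)" by simp
    also have "\<dots> = falses 0 @ alt (Suc h) @ [True]" by (simp only: rev_alt_True) simp
    finally show ?thesis by blast
  next
    case 2
    then have "Suc k < 2 * m" using k by presburger
    then have "proj k V' = [True, False, True, False, True] @ ?FT h"
      using split 2 proj_upt[of k "2 * m" 0] by (simp add: proj_shift_far)
    also have "\<dots> = True # ?FT (Suc (Suc h))" by simp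
    also have "\<dots> = falses 0 @ alt (Suc (Suc h)) @ [True]" by (simp only: rev_alt_True) simp
    finally show ?thesis by blast
  next
    case 3
    obtain a g where ag: "proj (k - 2 * m) V = falses a @ alt g @ [True]" "k - 2 * m + 2 = 2 * m \<longrightarrow> a = 0"
      using V_pat[of "k - 2 * m"] 3 m by auto
    have "proj k V' = falses a @ alt g @ True # ?FT (Suc h)"
      using split 3 m ag(1) proj_upt_below[of 0 k] proj_shift[of "2 * m" k V] by simp
    also have "\<dots> = falses a @ alt (g + Suc h) @ [True]" by (simp only: alt_True_append)
    finally show ?thesis using ag(2) 3 by auto
  next
    case 4
    then have k': "even (k - 2 * m)" "k - 2 * m < 2 * m" using k by presburger+
    obtain a g where ag: "proj (k - 2 * m) V = falses a @ alt g @ [True]" "k - 2 * m + 2 = 2 * m \<longrightarrow> a = 0"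
      using V_pat[OF k'] by blast
    have "proj k V' = falses a @ alt g @ True # ?FT h"
      using split 4 ag(1) proj_upt_far[of "2 * m" k 0] proj_shift[of "2 * m" k V] by simp
    also have "\<dots> = falses a @ alt (g + h) @ [True]" by (simp only: alt_True_append)
    finally show ?thesis using ag(2) 4 by auto
  qed
qed

lemma stairs_odd: "q < 2 * m \<Longrightarrow> fold swp (stairs m m) (2 * q + 1) = (if m \<le> q then 4 * m - 2 * q else 2 * q + 1)"
  using fold_stairs_odd[of m m q] by auto

lemma stairs_even: "1 \<le> q \<Longrightarrow> q \<le> 2 * m \<Longrightarrow> fold swp (stairs m m) (2 * q) = 2 * m + q"
  using fold_stairs_even[of m m q] by auto

lemma stairs_zero: "fold swp (stairs m m) 0 = 0"
  using set_stairs[of m m] by (intro fold_fixed) auto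

lemma U_range: "1 \<le> i \<Longrightarrow> i \<le> 2 * m \<Longrightarrow> 1 \<le> fold swp U i \<and> fold swp U i \<le> 2 * m"
  using fold_range[of U 1 "2 * m" i] U_set by fastforce

lemma opposite':
  assumes i: "1 \<le> i" "i \<le> 2 * (2 * m)"
  shows "fold swp V' (fold swp U' i - 1) = 2 * (2 * m) - i"
proof -
  let ?Q = "stairs m m @ [0..<2 * m]"
  let ?u = "fold swp U' i - 1"
  let ?e = "fold swp (map ((*) 2) [0..<m]) ?u"
  let ?v = "fold swp (map (\<lambda>x. x + 2 * m) V) ?e"
  \<comment> \<open>The last part of \<open>V'\<close> is the inverse of \<open>?Q\<close>, so
    heights are compared before it. Even \<open>i\<close> are axes, to which \<open>opposite\<close>
    applies; odd \<open>i\<close> are sides.\<close>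
  have "?v = fold swp ?Q (4 * m - i)"
  proof (cases "even i")
    case True
    then obtain q where q: "i = 2 * q" "1 \<le> q" "q \<le> 2 * m" using i by (auto elim!: evenE)
    have "fold swp U' i = fold swp U q + 2 * m"
      using stairs_even[OF q(2,3)] fold_shift[of "2 * m" U q] unfolding U'_def q(1) by (simp add: add.commute)
    then have u: "?u = (fold swp U q - 1) + 2 * m" using U_range[OF q(2,3)] by linarith
    have "?e = ?u" using u by (simp add: fold_even_letters)
    then have v: "?v = 4 * m - q" using u fold_shift[of "2 * m" V "fold swp U q - 1"] opposite[OF q(2,3)] q(3) by simp
    have "fold swp ?Q (4 * m - i) = 4 * m - q"
    proof (cases "q = 2 * m")
      case True
      then show ?thesis using q(1) stairs_zero m by (simp add: fold_upt)
    next
      case False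
      have "4 * m - i = 2 * (2 * m - q)" using q by simp
      moreover have "fold swp (stairs m m) (2 * (2 * m - q)) = 2 * m + (2 * m - q)" using False q by (intro stairs_even) auto
      ultimately show ?thesis using False q(3) by (simp add: fold_upt)
    qed
    then show ?thesis using v by simp
  next
    case False
    then obtain q where q: "i = 2 * q + 1" "q < 2 * m" using i by (auto elim!: oddE)
    have small: "fold swp (stairs m m) i \<le> 2 * m" "1 \<le> fold swp (stairs m m) i" using stairs_odd[OF q(2)] q by auto
    have "fold swp U' i = fold swp (stairs m m) i"
      unfolding U'_def fold_append comp_apply using U_set small by (intro fold_fixed) fastforce
    then have u: "?u = (if m \<le> q then 4 * m - 2 * q - 1 else 2 * q)" "?u < 2 * m" using stairs_odd[OF q(2)] q small by auto
    have e: "?e = (if m \<le> q then 4 * m - 2 * q - 2 else 2 * q + 1)"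
    proof (cases "m \<le> q")
      case True
      then have "odd ?u" using u q by auto
      then show ?thesis using u True q(2) by (simp add: fold_even_letters)
    next
      case False
      then have "even ?u" using u by auto
      then show ?thesis using u False by (simp add: fold_even_letters)
    qed
    then have "?e < 2 * m" using q by auto
    then have v: "?v = ?e" by (intro fold_fixed) auto
    \<comment> \<open>\<open>r\<close> numbers the mirror image of the side \<open>q\<close> in the
      first axis.\<close>
    define r where "r = 2 * m - 1 - q"
    have r: "r < 2 * m" "4 * m - i = 2 * r + 1" "q = 2 * m - 1 - r" using q unfolding r_def by auto
    have "fold swp ?Q (4 * m - i) = ?e"
    proof (cases "m \<le> q")
      case True
      then have "\<not> m \<le> r" using q unfolding r_def by auto
      then have "fold swp ?Q (4 * m - i) = 2 * r" using stairs_odd[OF r(1)] r(2) by (simp add: fold_upt)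
      also have "2 * r = 4 * m - 2 * q - 2" using q(2) unfolding r_def by linarith
      also have "\<dots> = ?e" using e True by simp
      finally show ?thesis .
    next
      case False
      then have mr: "m \<le> r" using q unfolding r_def by auto
      then have "fold swp ?Q (4 * m - i) = 4 * m - 2 * r - 1" using stairs_odd[OF r(1)] r(1,2) by (auto simp: fold_upt)
      also have "4 * m - 2 * r - 1 = 2 * q + 1" using q(2) unfolding r_def by linarith
      also have "\<dots> = ?e" using e False by simp
      finally show ?thesis .
    qed
    then show ?thesis using v by simp
  qed
  then show ?thesis unfolding V'_def using fold_swp_rev[of ?Q "4 * m - i"] by simp
qed

lemma evens_shift: "evens (map (\<lambda>x. x + 2 * m) w) = evens w"
  by (induction w) auto

text \<open>Doubling adds \<open>4 * m * m\<close> even letters, so both sides of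
  \<open>evens_count\<close> grow by \<open>12 * m * m\<close> and \<open>d\<close> is
  inherited.\<close>

lemma next_pair: "word_pair (2 * m) d U' V'"
proof
  show "1 \<le> 2 * m" using m by simp
  have st: "set (stairs m m) \<subseteq> {2..<4 * m - 1}" using set_stairs by blast
  have "x < 4 * m - 1" if "x \<in> set V'" for x
    using that V_set st m unfolding V'_def by fastforce
  then show "set V' \<subseteq> {..<2 * (2 * m) - 1}" by auto
  show "set U' \<subseteq> {2..<2 * (2 * m) - 1}" using U_set st unfolding U'_def by fastforce
  show "length U' + length V' + 2 * m = 2 * (2 * m * (2 * m))"
    using len length_stairs[of m m] unfolding U'_def V'_def by simp
  have "length (filter even (map ((*) 2) [0..<m])) = m" by (simp add: filter_map comp_def)
  then have "evens U' + evens V'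
      = 2 * evens (stairs m m) + evens U + evens V + 2 * m"
    unfolding U'_def V'_def by (simp add: evens_shift evens_upt rev_filter[symmetric] del: length_filter_map)
  then show "3 * (evens U' + evens V') + d + 1 = 4 * (2 * m * (2 * m))"
    using evens_count evens_stairs[of m m] by simp
qed (use opposite' V'_pat U'_pat in auto)

section \<open>An odd number of lines\<close>

text \<open>With the first wire at infinity, reading starts behind it with \<open>V\<close>; then
  the wire that was at infinity descends from the top, and \<open>U\<close> follows upside down,
  because passing through infinity interchanges up and down.\<close>

definition "odd_word = V @ rev [0..<2 * m] @ map (\<lambda>x. 2 * m - x) U"

lemma U_set1: "set U \<subseteq> {1..<2 * m}"
  using U_set by fastforce

lemma odd_word_set: "set odd_word \<subseteq> {..<2 * m}"
  using V_set U_set m unfolding odd_word_def by fastforce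

lemma odd_word_reversal:
  assumes "q \<le> 2 * m"
  shows "fold swp odd_word q = 2 * m - q"
proof (cases "q = 2 * m")
  case True
  have "fold swp V (2 * m) = 2 * m" using V_set m by (intro fold_fixed) fastforce
  moreover have "fold swp (map (\<lambda>x. 2 * m - x) U) 0 = 0" using U_set by (intro fold_fixed) fastforce
  ultimately show ?thesis using True by (simp add: odd_word_def fold_rev_upt)
next
  case False
  define v where "v = fold swp V q"
  have v: "v < 2 * m" using fold_range[of V 0 "2 * m - 1" q] V_set False assms m unfolding v_def by fastforce
  \<comment> \<open>\<open>i\<close> names, in the original network, the wire that \<open>U\<close>
    brings to height \<open>q + 1\<close>; the first wire then shifts it to \<open>q\<close>, where
    \<open>V\<close> begins.\<close>
  define i where "i = fold swp (rev U) (q + 1)"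
  have i: "1 \<le> i" "i \<le> 2 * m" using fold_range[of "rev U" 1 "2 * m" "q + 1"] U_set1 False assms unfolding i_def by auto
  have Ui: "fold swp U i = q + 1" unfolding i_def by (rule fold_swp_rev')
  have "v = 2 * m - i" using opposite[OF i] Ui unfolding v_def by simp
  then have "v + 1 = 2 * m + 1 - i" using i by simp
  moreover have "fold swp odd_word q = fold swp (map (\<lambda>x. 2 * m - x) U) (v + 1)"
    using v by (simp add: odd_word_def v_def fold_rev_upt)
  ultimately show ?thesis using fold_flip[OF U_set1 i] Ui by simp
qed

text \<open>\<open>V\<close> ends with \<open>True\<close> and the descending wire supplies the
  neighbours up to the first letter from \<open>U\<close>. Turning \<open>U\<close> upside down
  exchanges \<open>k\<close> with \<open>2 * m - k\<close>, which converts the condition on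
  \<open>b\<close> into one for heights from 4 upwards.\<close>

lemma odd_word_pat:
  assumes k: "even k" "k < 2 * m"
  shows "\<exists>a g b. proj k odd_word = falses a @ alt g @ True # falses b \<and> (k + 2 = 2 * m \<longrightarrow> a = 0) \<and> (4 \<le> k \<longrightarrow> b = 0)"
proof -
  obtain a g where ag: "proj k V = falses a @ alt g @ [True]" "k + 2 = 2 * m \<longrightarrow> a = 0" using V_pat[OF k] by blast
  show ?thesis
  proof (cases "k = 0")
    case True
    have "proj k (map (\<lambda>x. 2 * m - x) U) = []" using U_set True by (intro proj_far) fastforce
    then have "proj k odd_word = falses a @ alt g @ [True, False, True]"
      using ag True proj_upt_start[of 0 "2 * m"] m by (simp add: odd_word_def)
    also have "\<dots> = falses a @ alt (Suc g) @ True # falses 0" using alt_snoc[of g] by simp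
    finally show ?thesis using ag(2) by blast
  next
    case False
    then have k2: "2 \<le> k" "Suc k < 2 * m" using k by presburger+
    then have kk: "even (2 * m - k)" "2 \<le> 2 * m - k" "2 * m - k < 2 * m" using k by simp_all
    obtain h b where hb: "proj (2 * m - k) U = alt h @ True # falses b" "2 * m - k + 4 \<le> 2 * m \<longrightarrow> b = 0"
      using U_pat[OF kk] by blast
    have "proj k odd_word = falses a @ (alt g @ True # False # [True, False]) @ alt h @ True # falses b"
      using ag hb proj_upt[of k "2 * m" 0] k2 proj_flip[OF U_set1, of k] by (simp add: odd_word_def)
    also have "alt g @ True # False # [True, False] = alt (g + 2)" using alt_append[of g 2] by (simp add: alt_Suc numeral_2_eq_2)
    also have "falses a @ alt (g + 2) @ alt h @ True # falses b = falses a @ alt (g + 2 + h) @ True # falses b"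
      by (simp only: alt_append[symmetric] append_assoc)
    finally have "proj k odd_word = falses a @ alt (g + 2 + h) @ True # falses b" .
    moreover have "4 \<le> k \<longrightarrow> b = 0" using hb(2) k(2) by linarith
    ultimately show ?thesis using ag(2) by blast
  qed
qed

lemma evens_flip: "set w \<subseteq> {..2 * m} \<Longrightarrow> evens (map (\<lambda>x. 2 * m - x) w) = evens w"
  by (induction w) auto

lemma evens_odd_word: "evens odd_word = evens U + evens V + m"
proof -
  have "set U \<subseteq> {..2 * m}" using U_set1 by fastforce
  note evens_flip[OF this]
  then show ?thesis unfolding odd_word_def by (simp add: evens_upt rev_filter[symmetric] del: length_filter_map)
qed

lemma odd_word_length: "length odd_word = length U + length V + 2 * m"
  by (simp add: odd_word_def)

lemma reversing_odd_word: "reversing_word odd_word (2 * m + 1)"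
proof
  show "set odd_word \<subseteq> {..<2 * m + 1 - 1}" using odd_word_set by simp
  show "2 * length odd_word = (2 * m + 1) * (2 * m + 1 - 1)" using len odd_word_length by (simp add: algebra_simps)
  show "fold swp odd_word i = 2 * m + 1 - 1 - i" if "i < 2 * m + 1" for i using odd_word_reversal that by simp
qed

text \<open>The descending wire contributes \<open>m\<close> even letters, one for each even height,
  and this pays for the letter lost there.\<close>

lemma odd_arrangement:
  "\<exists>A. simple_affine_arrangement (2 * m + 1) A \<and> evens U + evens V \<le> a3 A"
proof -
  interpret reversing_word odd_word "2 * m + 1" by (rule reversing_odd_word)
  have "evens odd_word \<le> a3 lines + card {k. even k \<and> k < 2 * m + 1 - 1}"
    by (rule alternating_triangles) (use odd_word_pat in fastforce)
  then have "evens U + evens V \<le> a3 lines"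
    using evens_odd_word card_evens[of m] by simp
  then show ?thesis using simple_lines by blast
qed

section \<open>One more line\<close>

text \<open>The further line starts at height \<open>2 * m - 3\<close>, climbs to the top, stays
  there during \<open>odd_word\<close> and then descends to the opposite height (2 m + 1) - (2 m -
  3) = 4. Its even letters are \<open>2 * m - 2\<close> and \<open>2 * m\<close> while climbing and
  those from 4 on while descending. Apart from the new height \<open>2 * m\<close>, these are
  heights where \<open>odd_word\<close> has no neighbour before its first letter, respectively after
  its last, so the alternation goes on.\<close>

definition "start = [2 * m - 3, 2 * m - 2, 2 * m - 1, 2 * m]"

definition "even_word = start @ odd_word @ rev [4..<2 * m + 1]"

lemma even_word_pat:
  assumes m3: "3 \<le> m" and k: "even k" "k < 2 * m + 1"
  shows "\<exists>a g b. proj k even_word = falses a @ alt g @ True # falses b"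
proof (cases "k = 2 * m")
  case True
  have A: "proj k odd_word = [False]"
  proof -
    have "proj k V = []" using V_set True m by (intro proj_far) fastforce
    moreover have "proj k (map (\<lambda>x. 2 * m - x) U) = []" using U_set True m by (intro proj_far) fastforce
    ultimately show ?thesis using proj_upt_below[of 0 k] True m by (simp add: odd_word_def)
  qed
  have B: "proj k [4..<2 * m + 1] = [False, True]" using proj_upt_end[of 4 k] True m3 by simp
  have C: "proj k start = [False, True]"
    using True m3 by (auto simp: start_def proj_Cons)
  have "proj k even_word = [False, True] @ [False] @ rev [False, True]"
    by (simp only: even_word_def proj_append proj_rev A B C)
  also have "\<dots> = falses 1 @ alt 1 @ True # falses 1" by (simp add: alt_Suc)
  finally have "proj k even_word = falses 1 @ alt 1 @ True # falses 1" .
  then show ?thesis by blast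
next
  case False
  then have k2: "k < 2 * m" using k by simp
  obtain a g b where w: "proj k odd_word = falses a @ alt g @ True # falses b" "k + 2 = 2 * m \<longrightarrow> a = 0" "4 \<le> k \<longrightarrow> b = 0"
    using odd_word_pat[OF k(1) k2] by blast
  \<comment> \<open>On the left only height \<open>2 * m - 2\<close> receives a letter of its own,
    and there \<open>a = 0\<close>; lower heights get at most a further leading
    \<open>False\<close>.\<close>
  have "\<exists>l. proj k start = falses l \<or> (k + 2 = 2 * m \<and> proj k start = [False, True, False])"
  proof -
    have "k + 2 = 2 * m \<or> k + 4 = 2 * m \<or> k + 4 < 2 * m" using k k2 by presburger
    then consider "k + 2 = 2 * m" | "k + 4 = 2 * m" | "k + 4 < 2 * m" by blast
    then show ?thesis
    proof cases
      case 1
      then have l: "start = [k - 1, k, Suc k, Suc (Suc k)]" unfolding start_def by auto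
      have "1 \<le> k" using 1 m3 by linarith
      then have "proj k start = [False, True, False]" unfolding l by (simp add: proj_Cons)
      then show ?thesis using 1 by blast
    next
      case 2
      then have l: "start = [Suc k, Suc (Suc k), Suc (Suc (Suc k)), Suc (Suc (Suc (Suc k)))]" unfolding start_def by auto
      have "proj k start = falses 1" unfolding l by (simp add: proj_Cons)
      then show ?thesis by blast
    next
      case 3
      then have "proj k start = falses 0" by (intro trans[OF proj_far]) (auto simp: start_def)
      then show ?thesis by blast
    qed
  qed
  then obtain a' g' where left: "proj k start @ falses a @ alt g = falses a' @ alt g'"
  proof (elim exE disjE conjE)
    fix l assume "proj k start = falses l"
    then have "proj k start @ falses a @ alt g = falses (l + a) @ alt g"
      by (simp add: replicate_add)
    then show thesis by (rule that)
  next
    assume "k + 2 = 2 * m" "proj k start = [False, True, False]"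
    then have "proj k start @ falses a @ alt g = falses 1 @ alt (Suc g)"
      using w(2) by (simp add: alt_Suc)
    then show thesis by (rule that)
  qed
  \<comment> \<open>On the right the heights from 4 on receive a letter of their own, and there
    \<open>b = 0\<close>; lower heights are not touched.\<close>
  have "\<exists>g'' b'. alt g' @ True # falses b @ rev (proj k [4..<2 * m + 1]) = alt g'' @ True # falses b'"
  proof (cases "4 \<le> k")
    case True
    then have b: "b = 0" using w(3) by simp
    show ?thesis
    proof (cases "k = 4")
      case True
      have "proj k [4..<2 * m + 1] = [True, False]" using proj_upt_start[of 4 "2 * m + 1"] True m3 by simp
      then have "alt g' @ True # falses b @ rev (proj k [4..<2 * m + 1]) = alt (Suc g') @ True # falses 0"
        using b alt_join'[of g' 0 "[True]"] by simp
      then show ?thesis by blast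
    next
      case False
      then have "proj k [4..<2 * m + 1] = [False, True, False]" using proj_upt[of k "2 * m + 1" 4] True k2 by simp
      then have "alt g' @ True # falses b @ rev (proj k [4..<2 * m + 1]) = alt (Suc g') @ True # falses 1"
        using b alt_join'[of g' 0 "[True, False]"] by simp
      then show ?thesis by blast
    qed
  next
    case False
    then have "Suc k < 4" using k(1) by presburger
    then have "proj k [4..<2 * m + 1] = []" by (intro proj_upt_far) simp
    then show ?thesis by auto
  qed
  then obtain g'' b' where right: "alt g' @ True # falses b @ rev (proj k [4..<2 * m + 1]) = alt g'' @ True # falses b'" by blast
  have "proj k even_word = (proj k start @ falses a @ alt g) @ True # falses b @ rev (proj k [4..<2 * m + 1])"
  proof -
    have "proj k even_word = proj k start @ proj k odd_word @ rev (proj k [4..<2 * m + 1])"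
      by (simp only: even_word_def proj_append proj_rev)
    then show ?thesis unfolding w(1) by (simp only: append_assoc append_Cons append_Nil)
  qed
  also have "\<dots> = falses a' @ (alt g' @ True # falses b @ rev (proj k [4..<2 * m + 1]))"
    by (simp only: left append_assoc)
  also have "\<dots> = falses a' @ alt g'' @ True # falses b'" by (simp only: right)
  finally show ?thesis by blast
qed

lemma even_word_reversal:
  assumes m3: "3 \<le> m" and i: "i \<le> 2 * m + 1"
  shows "fold swp even_word i = 2 * m + 1 - i"
proof -
  have up: "fold swp start i = (if i = 2 * m - 3 then 2 * m + 1 else if 2 * m - 3 < i then i - 1 else i)"
  proof -
    have "start = [2 * m - 3..<2 * m + 1]"
      unfolding start_def using m3 by (simp add: upt_conv_Cons Suc_diff_Suc numeral_3_eq_3 numeral_2_eq_2)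
    then show ?thesis using i by (simp only: fold_upt) (auto simp: fold_upt)
  qed
  have top: "fold swp odd_word (2 * m + 1) = 2 * m + 1" using odd_word_set by (intro fold_fixed) fastforce
  have down: "fold swp (rev [4..<2 * m + 1]) p = (if p = 2 * m + 1 then 4 else if 4 \<le> p \<and> p < 2 * m + 1 then p + 1 else p)" for p
    using fold_rev_upt[of 4 "2 * m + 1" p] m3 by simp
  have "fold swp even_word i = fold swp (rev [4..<2 * m + 1]) (fold swp odd_word (fold swp start i))"
    by (simp only: even_word_def fold_append comp_apply)
  also have "\<dots> = 2 * m + 1 - i"
  proof -
    consider "i = 2 * m - 3" | "i < 2 * m - 3" | "2 * m - 3 < i" by linarith
    then show ?thesis
    proof cases
      case 1
      then show ?thesis unfolding up using top down m3 by auto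
    next
      case 2
      then show ?thesis unfolding up using odd_word_reversal[of i] down m3 by auto
    next
      case 3
      then show ?thesis unfolding up using odd_word_reversal[of "i - 1"] down m3 i by auto
    qed
  qed
  finally show ?thesis .
qed

lemma evens_even_word:
  assumes m3: "3 \<le> m"
  shows "evens even_word = evens U + evens V + 2 * m + 1"
proof -
  have "[0..<2 * (m + 1)] = [0..<4] @ [4..<2 * m + 1] @ [2 * m + 1]"
    using m3 upt_add_eq_append[of 0 4 "2 * m - 3"] by simp
  then have "m + 1 = evens ([0..<4] @ [4..<2 * m + 1] @ [2 * m + 1])" using evens_upt[of "m + 1"] by simp
  also have "\<dots> = 2 + evens [4..<2 * m + 1]"
  proof -
    have "[0..<4] = [0, 1, 2, 3 :: nat]" by code_simp
    then show ?thesis by (simp only: filter_append length_append) simp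
  qed
  finally have "evens [4..<2 * m + 1] + 1 = m" by simp
  moreover have "evens start = 2" unfolding start_def using m3 by auto
  moreover have "evens even_word = evens start +
      (evens odd_word + evens [4..<2 * m + 1])"
    by (simp only: even_word_def filter_append length_append rev_filter[symmetric] length_rev)
  ultimately show ?thesis using evens_odd_word by linarith
qed

text \<open>The new line brings \<open>m + 1\<close> even letters and a single new even height,
  \<open>2 * m\<close>, which costs one of them; the net gain is \<open>m\<close> triangles.\<close>

lemma even_arrangement:
  assumes m3: "3 \<le> m"
  shows "\<exists>A. simple_affine_arrangement (2 * m + 2) A \<and> evens U + evens V + m \<le> a3 A"
proof -
  interpret reversing_word even_word "2 * m + 2"
  proof
    show "set even_word \<subseteq> {..<2 * m + 2 - 1}" using odd_word_set m3 unfolding even_word_def start_def by fastforce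
    have "length even_word = length U + length V + 2 * m + 4 + (2 * m + 1 - 4)"
      unfolding even_word_def start_def by (simp only: length_append length_rev length_upt odd_word_length) simp
    then show "2 * length even_word = (2 * m + 2) * (2 * m + 2 - 1)" using len m3 by (simp add: algebra_simps)
    show "fold swp even_word i = 2 * m + 2 - 1 - i" if "i < 2 * m + 2" for i using even_word_reversal[OF m3] that by simp
  qed
  have "{k. even k \<and> k < 2 * m + 2 - 1} = {k. even k \<and> k < 2 * (m + 1)}" by auto presburger
  then have "card {k. even k \<and> k < 2 * m + 2 - 1} = m + 1" using card_evens[of "m + 1"] by simp
  moreover have "evens even_word \<le> a3 lines + card {k. even k \<and> k < 2 * m + 2 - 1}"
    by (rule alternating_triangles) (use even_word_pat[OF m3] in fastforce)
  ultimately have "evens U + evens V + m \<le> a3 lines"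
    using evens_even_word[OF m3] by simp
  then show ?thesis using simple_lines by blast
qed

end

section \<open>Starting networks and residues modulo 6\<close>

lemma word_pair_three_lines: "word_pair 1 0 [] [0]"
proof
  show "\<exists>a g. proj k [0] = falses a @ alt g @ [True] \<and> (k + 2 = 2 * 1 \<longrightarrow> a = 0)" if "even k" "k < 2 * 1" for k
  proof -
    have "k = 0" using that by presburger
    then have "proj k [0] = falses 0 @ alt 0 @ [True]" by (simp add: proj_Cons)
    then show ?thesis by blast
  qed
  show "fold swp [0] (fold swp [] i - 1) = 2 * 1 - i" if "1 \<le> i" "i \<le> 2 * 1" for i :: nat
    using that by (auto simp: swp_def)
qed auto

text \<open>The eleven even letters stand for triangles that take 33 of the 35 bounded segments of
  seven lines, so the defect \<open>d = 2\<close> is the least possible. It is visible as the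
  leading \<open>False\<close> of \<open>V\<close> at height 2 and the trailing \<open>False\<close>
  of \<open>U\<close> at height 4, where the locale allows them.\<close>

lemma word_pair_seven_lines: "word_pair 3 2 [2, 4, 3, 2] [4, 3, 4, 2, 0, 1, 2, 3, 4, 2, 0]"
proof
  show "fold swp [4, 3, 4, 2, 0, 1, 2, 3, 4, 2, 0] (fold swp [2, 4, 3, 2] i - 1) = 2 * 3 - i" if "1 \<le> i" "i \<le> 2 * 3" for i
  proof -
    have "i = 1 \<or> i = 2 \<or> i = 3 \<or> i = 4 \<or> i = 5 \<or> i = 6" using that by linarith
    then show ?thesis by (elim disjE) (simp_all add: swp_def)
  qed
  show "\<exists>a g. proj k [4, 3, 4, 2, 0, 1, 2, 3, 4, 2, 0] = falses a @ alt g @ [True] \<and> (k + 2 = 2 * 3 \<longrightarrow> a = 0)"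
    if "even k" "k < 2 * 3" for k
  proof -
    have "k = 0 \<or> k = 2 \<or> k = 4" using that by presburger
    then consider "k = 0" | "k = 2" | "k = 4" by blast
    then show ?thesis
    proof cases
      case 1
      then show ?thesis by (intro exI[of _ 0] exI[of _ 1]) (simp add: proj_Cons alt_Suc)
    next
      case 2
      then show ?thesis by (intro exI[of _ 1] exI[of _ 2]) (simp add: proj_Cons alt_Suc numeral_2_eq_2)
    next
      case 3
      then show ?thesis by (intro exI[of _ 0] exI[of _ 2]) (simp add: proj_Cons alt_Suc numeral_2_eq_2)
    qed
  qed
  show "\<exists>g b. proj k [2, 4, 3, 2] = alt g @ True # falses b \<and> (k + 4 \<le> 2 * 3 \<longrightarrow> b = 0)"
    if "even k" "2 \<le> k" "k < 2 * 3" for k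
  proof -
    have "k = 2 \<or> k = 4" using that by presburger
    then consider "k = 2" | "k = 4" by blast
    then show ?thesis
    proof cases
      case 1
      then show ?thesis by (intro exI[of _ 1] exI[of _ 0]) (simp add: proj_Cons alt_Suc)
    next
      case 2
      then show ?thesis by (intro exI[of _ 0] exI[of _ 1]) (simp add: proj_Cons)
    qed
  qed
qed auto

lemma word_pair_doubling: "word_pair m d U V \<Longrightarrow> \<exists>U V. word_pair (2 ^ j * m) d U V"
proof (induction j)
  case (Suc j)
  then obtain U V where "word_pair (2 ^ j * m) d U V" by blast
  from word_pair.next_pair[OF this] show ?case by (auto simp: mult.assoc)
qed auto

abbreviation attains_bound :: "nat \<Rightarrow> bool" where
  "attains_bound n \<equiv> \<exists>A. simple_affine_arrangement n A \<and> real (a3 A) = a3_bound n"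

text \<open>For n = 2 m + 1 one has 4 m^2 - 1 = n (n - 2), so \<open>evens_count\<close> reads 3 e =
  n (n - 2) - d, and the prescribed \<open>d\<close> is the rounding in the bound.\<close>

lemma odd_bound_attained:
  assumes "word_pair m d U V" and d: "d = (if (2 * m + 1) mod 6 = 1 then 2 else 0)"
  shows "attains_bound (2 * m + 1)"
proof -
  interpret word_pair m d U V by fact
  define e where "e = evens U + evens V"
  obtain A where A: "simple_affine_arrangement (2 * m + 1) A" "e \<le> a3 A" using odd_arrangement unfolding e_def by blast
  have "3 * e + d + 1 = 4 * (m * m)" using evens_count unfolding e_def by simp
  then have "real (3 * e + d + 1) = real (4 * (m * m))" by (rule arg_cong)
  then have ev: "3 * real e = 4 * (real m * real m) - real d - 1" by simp
  have "(2 * m + 1) mod 6 \<noteq> 0" "(2 * m + 1) mod 6 \<noteq> 4" "(2 * m + 1) mod 6 \<noteq> 2" by presburger+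
  then have "a3_bound (2 * m + 1) = real e"
    unfolding a3_bound_def using ev d by (auto simp: field_simps)
  then show ?thesis using a3_upper_bound[OF _ A(1)] A m by (intro exI[of _ A]) auto
qed

text \<open>For n = 2 m + 2 the bound equals (4 m^2 - 1 - d) / 3 + m, that is, the bound for
  \<open>2 * m + 1\<close> lines increased by the \<open>m\<close> triangles gained with the further
  line.\<close>

lemma even_bound_attained:
  assumes "word_pair m d U V" and d: "d = (if (2 * m + 2) mod 6 = 2 then 2 else 0)" and m3: "3 \<le> m"
  shows "attains_bound (2 * m + 2)"
proof -
  interpret word_pair m d U V by fact
  define e where "e = evens U + evens V"
  obtain A where A: "simple_affine_arrangement (2 * m + 2) A" "e + m \<le> a3 A" using even_arrangement[OF m3] unfolding e_def by blast
  have "3 * e + d + 1 = 4 * (m * m)" using evens_count unfolding e_def by simp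
  then have "real (3 * e + d + 1) = real (4 * (m * m))" by (rule arg_cong)
  then have ev: "3 * real e = 4 * (real m * real m) - real d - 1" by simp
  have "(2 * m + 2) mod 6 = 0 \<or> (2 * m + 2) mod 6 = 4 \<or> (2 * m + 2) mod 6 = 2" by presburger
  then have "a3_bound (2 * m + 2) = real e + real m"
    unfolding a3_bound_def using ev d by (auto simp: field_simps)
  then show ?thesis using a3_upper_bound[OF _ A(1)] A m by (intro exI[of _ A]) auto
qed

lemma infinite_residue_class:
  assumes "\<And>j. f j mod 6 = k \<and> attains_bound (f j)" "strict_mono (f :: nat \<Rightarrow> nat)"
  shows "infinite {n. n mod 6 = k \<and> attains_bound n}"
proof -
  have "infinite (range f)" using assms(2) by (simp add: range_inj_infinite strict_mono_imp_inj_on)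
  moreover have "range f \<subseteq> {n. n mod 6 = k \<and> attains_bound n}" using assms(1) by blast
  ultimately show ?thesis using infinite_super by blast
qed

lemma pow4_mod: "(2 * 4 ^ j :: nat) mod 6 = 2"
proof (induction j)
  case (Suc j)
  have "(2 * 4 ^ Suc j :: nat) mod 6 = (4 * ((2 * 4 ^ j) mod 6)) mod 6" by (simp add: mod_mult_right_eq mult.left_commute)
  then show ?case using Suc by simp
qed simp

theorem theorem1p1:
  shows "(\<forall>n \<A>. 3 \<le> n \<longrightarrow> simple_affine_arrangement n \<A> \<longrightarrow> real (a3 \<A>) \<le> a3_bound n) \<and>
         (\<forall>k\<in>{0..5::nat}. infinite {n. n mod 6 = k \<and>
            (\<exists>\<A>. simple_affine_arrangement n \<A> \<and> real (a3 \<A>) = a3_bound n)})"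
proof (intro conjI allI impI ballI)
  fix n \<A> assume "3 \<le> n" "simple_affine_arrangement n \<A>"
  then show "real (a3 \<A>) \<le> a3_bound n" by (rule a3_upper_bound)
next
  fix k :: nat assume "k \<in> {0..5}"
  \<comment> \<open>The residue of \<open>2 * m + 1\<close> modulo 6 depends on the parity of the
    number of doublings, so even and odd numbers are kept apart.\<close>
  have pow: "\<exists>U V. word_pair (4 ^ j) 0 U V" "\<exists>U V. word_pair (2 * 4 ^ j) 0 U V" for j
    using word_pair_doubling[OF word_pair_three_lines, of "2 * j"] word_pair_doubling[OF word_pair_three_lines, of "Suc (2 * j)"]
    by (simp_all add: power_mult)
  have pow3: "\<exists>U V. word_pair (3 * 2 ^ j) 2 U V" for j
    using word_pair_doubling[OF word_pair_seven_lines, of j] by (simp add: mult.commute)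
  have r: "(2 * 4 ^ j + 1 :: nat) mod 6 = 3" "(2 * 4 ^ j + 2 :: nat) mod 6 = 4"
    "(2 * (2 * 4 ^ j) + 1 :: nat) mod 6 = 5" "(2 * (2 * 4 ^ j) + 2 :: nat) mod 6 = 0" for j
    using pow4_mod[of j] by presburger+
  have r6: "(2 * (3 * 2 ^ j) + 1 :: nat) mod 6 = 1" "(2 * (3 * 2 ^ j) + 2 :: nat) mod 6 = 2" for j
    by presburger+
  have big: "3 \<le> (4 :: nat) ^ Suc j" "3 \<le> (2 :: nat) * 4 ^ Suc j" "3 \<le> (3 :: nat) * 2 ^ j" for j
    by (simp_all add: le_trans[of 3 4])
  have k0: "infinite {n. n mod 6 = 0 \<and> attains_bound n}"
  \<comment> \<open>The exponent \<open>Suc j\<close> ensures \<open>3 \<le> m\<close>, which the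
    further line requires.\<close>
  proof (rule infinite_residue_class[of "\<lambda>j. 2 * (2 * 4 ^ Suc j) + 2"])
    fix j :: nat
    obtain U V where wp: "word_pair (2 * 4 ^ Suc j) 0 U V" using pow(2)[of "Suc j"] by blast
    show "(2 * (2 * 4 ^ Suc j) + 2 :: nat) mod 6 = 0 \<and> attains_bound (2 * (2 * 4 ^ Suc j) + 2)"
      using r(4)[of "Suc j"] by (intro conjI even_bound_attained[OF wp _ big(2)]) simp_all
  qed (simp add: strict_mono_def)
  have k1: "infinite {n. n mod 6 = 1 \<and> attains_bound n}"
  proof (rule infinite_residue_class[of "\<lambda>j. 2 * (3 * 2 ^ j) + 1"])
    fix j :: nat
    obtain U V where wp: "word_pair (3 * 2 ^ j) 2 U V" using pow3[of j] by blast
    show "(2 * (3 * 2 ^ j) + 1 :: nat) mod 6 = 1 \<and> attains_bound (2 * (3 * 2 ^ j) + 1)"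
      using r6(1)[of j] by (intro conjI odd_bound_attained[OF wp]) simp_all
  qed (simp add: strict_mono_def)
  have k2: "infinite {n. n mod 6 = 2 \<and> attains_bound n}"
  proof (rule infinite_residue_class[of "\<lambda>j. 2 * (3 * 2 ^ j) + 2"])
    fix j :: nat
    obtain U V where wp: "word_pair (3 * 2 ^ j) 2 U V" using pow3[of j] by blast
    show "(2 * (3 * 2 ^ j) + 2 :: nat) mod 6 = 2 \<and> attains_bound (2 * (3 * 2 ^ j) + 2)"
      using r6(2)[of j] by (intro conjI even_bound_attained[OF wp _ big(3)]) simp_all
  qed (simp add: strict_mono_def)
  have k3: "infinite {n. n mod 6 = 3 \<and> attains_bound n}"
  proof (rule infinite_residue_class[of "\<lambda>j. 2 * 4 ^ j + 1"])
    fix j :: nat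
    obtain U V where wp: "word_pair (4 ^ j) 0 U V" using pow(1)[of j] by blast
    show "(2 * 4 ^ j + 1 :: nat) mod 6 = 3 \<and> attains_bound (2 * 4 ^ j + 1)"
      using r(1)[of j] by (intro conjI odd_bound_attained[OF wp]) simp_all
  qed (simp add: strict_mono_def)
  have k4: "infinite {n. n mod 6 = 4 \<and> attains_bound n}"
  proof (rule infinite_residue_class[of "\<lambda>j. 2 * 4 ^ Suc j + 2"])
    fix j :: nat
    obtain U V where wp: "word_pair (4 ^ Suc j) 0 U V" using pow(1)[of "Suc j"] by blast
    show "(2 * 4 ^ Suc j + 2 :: nat) mod 6 = 4 \<and> attains_bound (2 * 4 ^ Suc j + 2)"
      using r(2)[of "Suc j"] by (intro conjI even_bound_attained[OF wp _ big(1)]) simp_all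
  qed (simp add: strict_mono_def)
  have k5: "infinite {n. n mod 6 = 5 \<and> attains_bound n}"
  proof (rule infinite_residue_class[of "\<lambda>j. 2 * (2 * 4 ^ j) + 1"])
    fix j :: nat
    obtain U V where wp: "word_pair (2 * 4 ^ j) 0 U V" using pow(2)[of j] by blast
    show "(2 * (2 * 4 ^ j) + 1 :: nat) mod 6 = 5 \<and> attains_bound (2 * (2 * 4 ^ j) + 1)"
      using r(3)[of j] by (intro conjI odd_bound_attained[OF wp]) simp_all
  qed (simp add: strict_mono_def)
  have "k = 0 \<or> k = 1 \<or> k = 2 \<or> k = 3 \<or> k = 4 \<or> k = 5" using \<open>k \<in> {0..5}\<close> by fastforce
  then show "infinite {n. n mod 6 = k \<and> attains_bound n}"
    by (elim disjE) (simp_all only: k0 k1 k2 k3 k4 k5 not_False_eq_True)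
qed

end
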